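(* Consider the coupled risk model described in the context, with parameters $r_1,r_2\in(0,\infty)$ satisfying the safety loading condition \[\mu_1,\mu_2> 0\quad \text{or}\quad\mu_1\leq 0,\ \mu_2+r_1\mu_1>0\quad \text{or}\quad\mu_2\leq 0,\ \mu_1+r_2\mu_2>0.\] Then \[U_{r_1,r_2}\stackrel{\rm d}{=} U_{r_1,0}+U'_{0,r_2},\] where $U'_{0,r_2}$ denotes a copy of $U_{0,r_2}$ independent of $U_{r_1,0}$. Moreover, \begin{align*} U_{r_1,0}&\stackrel{\rm d}{=} \big(U_{r_1,\infty}\,\big|\,\{U_{0,\infty}=0\}\big) &&\text{if } \mu_2>0,\\ U_{\infty,r_2}&\stackrel{\rm d}{=} U_{0,r_2}+U'_{\infty,0} &&\text{if } \mu_1>0, \end{align*} where again $U'_{\infty,0}$ is an independent copy of $U_{\infty,0}$.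
   Context: Let $X_1,X_2$ be independent processes $X_i(t)=c_i t-\sum_{k=1}^{N_i(t)} J_{i,k}$, $t\ge 0$, where $c_i>0$, $N_i$ is a Poisson process of rate $\lambda_i$, and $J_{i,k}$, $k\ge1$, are i.i.d. positive random variables independent of $N_i$. Let $\mu_i=\mathbb E X_i(1)$. Coupled risk model with rates $r_1,r_2\in[0,\infty]$: given initial capitals $(x_1,x_2)\in[0,\infty)^2$, the capitals evolve as $(x_1+X_1(t),x_2+X_2(t))$ until the first time one of them becomes negative (this happens by a claim of one company; the two processes a.s. do not jump simultaneously). If $(y_1,y_2)$ is the state at that instant, the bivariate process is restarted (driven by the subsequent increments of $X_1,X_2$) from $(0,\,y_2+r_1y_1)$ if $y_1<0$, and from $(y_1+r_2y_2,\,0)$ if $y_2<0$, unless one coordinate of this restart point is negative, in which case ruin is declared; this procedure is iterated. Thus the deficit of company $i$ is covered by the other company, which pays $r_i$ per unit transferred. Convention: $r_i=0$ means company $i$ refills to $0$ at no cost to the other; $r_i=\infty$ means that a deficit of company $i$ causes ruin. Survival means no ruin ever occurs on $[0,\infty)$. For $r_1,r_2\in[0,\infty]$, all defined on the same probability space (the one carrying $X_1,X_2$), let $U_{r_1,r_2}$ be the minimal initial capital $u\ge0$ of the first company such that the model with rates $(r_1,r_2)$ started from $(u,0)$ survives (with $U_{r_1,r_2}=\infty$ if there is no such $u$); thus $\mathbb P(U_{r_1,r_2}\le u)$ is the survival probability from initial capitals $(u,0)$. In particular $\{U_{0,\infty}=0\}$ is the event that the model with rates $(0,\infty)$ started at $(0,0)$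 survives, and $U_{\infty,0}=-\inf_{t\ge0}X_1(t)$. *)

theory Defs
  imports "HOL-Probability.Probability"
begin

(* Companies are indexed by 1 and 2.
   W i k : (k+1)-th inter-arrival time of the Poisson claim process N_i (k = 0,1,...)
   J i k : (k+1)-th claim size of company i
   c i   : premium rate of company i *)

definition arr :: "(nat \<Rightarrow> nat \<Rightarrow> 'a \<Rightarrow> real) \<Rightarrow> nat \<Rightarrow> nat \<Rightarrow> 'a \<Rightarrow> real" where
  "arr W i k \<omega> = (\<Sum>j\<le>k. W i j \<omega>)"

definition Xproc :: "(nat \<Rightarrow> real) \<Rightarrow> (nat \<Rightarrow> nat \<Rightarrow> 'a \<Rightarrow> real) \<Rightarrow> (nat \<Rightarrow> nat \<Rightarrow> 'a \<Rightarrow> real)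
      \<Rightarrow> nat \<Rightarrow> real \<Rightarrow> 'a \<Rightarrow> real" where
  "Xproc c W J i t \<omega> = c i * t - (\<Sum>k\<in>{k. arr W i k \<omega> \<le> t}. J i k \<omega>)"

definition mu :: "'a measure \<Rightarrow> (nat \<Rightarrow> real) \<Rightarrow> (nat \<Rightarrow> nat \<Rightarrow> 'a \<Rightarrow> real) \<Rightarrow> (nat \<Rightarrow> nat \<Rightarrow> 'a \<Rightarrow> real)
      \<Rightarrow> nat \<Rightarrow> ereal" where
  "mu M c W J i = enn2ereal (\<integral>\<^sup>+\<omega>. ennreal (Xproc c W J i 1 \<omega>) \<partial>M)
                 - enn2ereal (\<integral>\<^sup>+\<omega>. ennreal (- Xproc c W J i 1 \<omega>) \<partial>M)"

(* One step of the coupled model, from one claim instant to the next.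
   State: Some (x1, x2, current time, index of next claim of company 1, of company 2);
   None = ruin.  Rates r1 r2 :: ereal in [0,\<infinity>]; r = \<infinity> means a deficit causes ruin. *)
definition cstep :: "(nat \<Rightarrow> real) \<Rightarrow> (nat \<Rightarrow> nat \<Rightarrow> 'a \<Rightarrow> real) \<Rightarrow> (nat \<Rightarrow> nat \<Rightarrow> 'a \<Rightarrow> real)
      \<Rightarrow> ereal \<Rightarrow> ereal \<Rightarrow> 'a \<Rightarrow> (real \<times> real \<times> real \<times> nat \<times> nat) option
      \<Rightarrow> (real \<times> real \<times> real \<times> nat \<times> nat) option" where
  "cstep c W J r1 r2 \<omega> s = (case s of None \<Rightarrow> None
     | Some (x1, x2, \<tau>, k1, k2) \<Rightarrow>
        (let t1 = arr W 1 k1 \<omega>; t2 = arr W 2 k2 \<omega> in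
         if t1 \<le> t2 then
           (let y1 = x1 + c 1 * (t1 - \<tau>) - J 1 k1 \<omega>; y2 = x2 + c 2 * (t1 - \<tau>) in
            if 0 \<le> y1 then Some (y1, y2, t1, Suc k1, k2)
            else if r1 = \<infinity> then None
            else (let z = y2 + real_of_ereal r1 * y1 in
                  if z < 0 then None else Some (0, z, t1, Suc k1, k2)))
         else
           (let y1 = x1 + c 1 * (t2 - \<tau>); y2 = x2 + c 2 * (t2 - \<tau>) - J 2 k2 \<omega> in
            if 0 \<le> y2 then Some (y1, y2, t2, k1, Suc k2)
            else if r2 = \<infinity> then None
            else (let z = y1 + real_of_ereal r2 * y2 in
                  if z < 0 then None else Some (z, 0, t2, k1, Suc k2)))))"

definition survives :: "(nat \<Rightarrow> real) \<Rightarrow> (nat \<Rightarrow> nat \<Rightarrow> 'a \<Rightarrow> real) \<Rightarrow> (nat \<Rightarrow> nat \<Rightarrow> 'a \<Rightarrow> real)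
      \<Rightarrow> ereal \<Rightarrow> ereal \<Rightarrow> 'a \<Rightarrow> real \<Rightarrow> real \<Rightarrow> bool" where
  "survives c W J r1 r2 \<omega> x1 x2 \<longleftrightarrow>
     (\<forall>n. (cstep c W J r1 r2 \<omega> ^^ n) (Some (x1, x2, 0, 0, 0)) \<noteq> None)"

(* U_{r1,r2}: minimal initial capital u \<ge> 0 of company 1 such that the model from (u,0) survives;
   \<infinity> if there is none (Inf {} = \<infinity> in ereal). *)
definition Ucap :: "(nat \<Rightarrow> real) \<Rightarrow> (nat \<Rightarrow> nat \<Rightarrow> 'a \<Rightarrow> real) \<Rightarrow> (nat \<Rightarrow> nat \<Rightarrow> 'a \<Rightarrow> real)
      \<Rightarrow> ereal \<Rightarrow> ereal \<Rightarrow> 'a \<Rightarrow> ereal" where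
  "Ucap c W J r1 r2 \<omega> = Inf (ereal ` {u. 0 \<le> u \<and> survives c W J r1 r2 \<omega> u 0})"

end

theory Submission
  imports Defs
begin

text \<open>
  Let \<phi>(x1, x2) be the survival probability from capitals (x1, x2) in the model with rates (r1, r2), and \<phi>' and
  \<phi>'' the ones for (r1, 0) and (0, r2). By memorylessness of the waiting times \<phi> is the decreasing limit of the
  iterates, started at 1, of the first-claim operator T. Let \<nu> be the law with distribution function
  f(x) = \<phi>'(x, 0), \<eta> the law with distribution function g(y) = \<phi>''(0, y), and let *1, *2 denote convolution in
  the first and the second coordinate. Then
    \<phi>(x, y) = (\<nu> *1 \<phi>'')(x, y) + (\<eta> *2 \<phi>')(x, y) - f(x) g(y).
  The right-hand side is a fixed point of T: a company with rate 0 restarts at 0, so the mass of a convolution that is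
  lost when a claim causes a deficit reappears in the product term, while the terms arising when the premium line
  x1 + c1 t crosses the support of \<nu> cancel by integrating the product along that line. Bounded
  fixed points with the same behaviour far from ruin agree, because some iterate of T is a strict contraction near
  ruin. On the axis y = 0 the formula becomes \<phi>(., 0) = \<nu> *1 \<phi>''(., 0), which is the convolution
  identity for U; the case r1 = \<infinity> gives the third identity, and the same formula on the other axis with an infinite
  rate gives the conditional law.
\<close>

section \<open>The first-claim operator\<close>

definition expint :: "real \<Rightarrow> (real \<Rightarrow> ennreal) \<Rightarrow> ennreal" where
  "expint l h = (\<integral>\<^sup>+t. ennreal (exp (- l * t)) * h t * indicator {0..} t \<partial>lborel)"

lemma expint_cong:
  assumes "\<And>t. 0 \<le> t \<Longrightarrow> h t = k t"
  shows "expint l h = expint l k"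
  unfolding expint_def by (intro nn_integral_cong) (auto simp: assms indicator_def)

lemma expint_mono:
  assumes "\<And>t. 0 \<le> t \<Longrightarrow> h t \<le> k t"
  shows "expint l h \<le> expint l k"
  unfolding expint_def by (intro nn_integral_mono) (auto simp: assms indicator_def mult_left_mono)

lemma expint_add:
  assumes [measurable]: "h \<in> borel_measurable borel" "k \<in> borel_measurable borel"
  shows "expint l (\<lambda>t. h t + k t) = expint l h + expint l k"
  unfolding expint_def by (subst nn_integral_add[symmetric]) (auto simp: distrib_left distrib_right)

lemma expint_cmult:
  assumes [measurable]: "h \<in> borel_measurable borel"
  shows "expint l (\<lambda>t. a * h t) = a * expint l h"
  unfolding expint_def by (subst nn_integral_cmult[symmetric]) (auto simp: ac_simps)

lemma expint_shift:
  assumes [measurable]: "h \<in> borel_measurable borel" and s: "0 \<le> s"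
  shows "expint l (\<lambda>t. h t * indicator {s..} t) = ennreal (exp (- l * s)) * expint l (\<lambda>t. h (s + t))"
proof -
  have "expint l (\<lambda>t. h t * indicator {s..} t)
      = (\<integral>\<^sup>+t. ennreal (exp (- l * (s + t))) * (h (s + t) * indicator {s..} (s + t)) * indicator {0..} (s + t) \<partial>lborel)"
    unfolding expint_def by (subst nn_integral_real_affine[where c=1 and t=s]) auto
  also have "\<dots> = (\<integral>\<^sup>+t. ennreal (exp (- l * s)) * (ennreal (exp (- l * t)) * h (s + t) * indicator {0..} t) \<partial>lborel)"
  proof (intro nn_integral_cong)
    fix t
    show "ennreal (exp (- l * (s + t))) * (h (s + t) * indicator {s..} (s + t)) * indicator {0..} (s + t)
      = ennreal (exp (- l * s)) * (ennreal (exp (- l * t)) * h (s + t) * indicator {0..} t)"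
    proof -
      have "ennreal (exp (- l * (s + t))) = ennreal (exp (- l * s)) * ennreal (exp (- l * t))"
        by (simp add: ennreal_mult[symmetric] exp_add[symmetric] distrib_left)
      then show ?thesis
        using s by (auto simp: indicator_def mult.assoc)
    qed
  qed
  also have "\<dots> = ennreal (exp (- l * s)) * expint l (\<lambda>t. h (s + t))"
    unfolding expint_def by (rule nn_integral_cmult) measurable
  finally show ?thesis .
qed

lemma expint_one:
  assumes l: "0 < l"
  shows "ennreal l * expint l (\<lambda>_. 1) = 1"
proof -
  interpret prob_space "density lborel (exponential_density l)"
    using l by (rule prob_space_exponential_density)
  have "1 = (\<integral>\<^sup>+t. ennreal (exponential_density l t) \<partial>lborel)"
    using emeasure_space_1 by (simp add: emeasure_density)
  also have "\<dots> = (\<integral>\<^sup>+t. ennreal l * (ennreal (exp (- l * t)) * 1 * indicator {0..} t) \<partial>lborel)"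
    using l by (intro nn_integral_cong) (auto simp: exponential_density_def indicator_def ennreal_mult mult.commute)
  also have "\<dots> = ennreal l * expint l (\<lambda>_. 1)"
    unfolding expint_def by (rule nn_integral_cmult) measurable
  finally show ?thesis by simp
qed

lemma expint_indicator_atLeast:
  assumes l: "0 < l"
  shows "ennreal l * expint l (indicator {s..}) = ennreal (exp (- l * max 0 s))"
proof -
  have "expint l (indicator {s..}) = expint l (\<lambda>t. 1 * indicator {max 0 s..} t)"
    by (rule expint_cong) (auto simp: indicator_def)
  also have "\<dots> = ennreal (exp (- l * max 0 s)) * expint l (\<lambda>_. 1)"
    by (subst expint_shift) auto
  finally show ?thesis
    using expint_one[OF l] by (metis mult.left_commute mult.right_neutral)
qed

lemma expint_fubini:
  assumes "sigma_finite_measure N"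
    and h: "(\<lambda>(u, t). h u t) \<in> borel_measurable (N \<Otimes>\<^sub>M borel)"
  shows "expint l (\<lambda>t. \<integral>\<^sup>+u. h u t \<partial>N) = (\<integral>\<^sup>+u. expint l (h u) \<partial>N)"
proof -
  interpret sigma_finite_measure N by fact
  interpret pair_sigma_finite N lborel ..
  note h[measurable]
  have "(\<integral>\<^sup>+u. expint l (h u) \<partial>N)
      = (\<integral>\<^sup>+t. \<integral>\<^sup>+u. ennreal (exp (- l * t)) * h u t * indicator {0..} t \<partial>N \<partial>lborel)"
    unfolding expint_def by (rule Fubini'[symmetric]) measurable
  also have "\<dots> = expint l (\<lambda>t. \<integral>\<^sup>+u. h u t \<partial>N)"
    unfolding expint_def
    by (intro nn_integral_cong) (simp add: nn_integral_cmult nn_integral_multc)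
  finally show ?thesis ..
qed

lemma expint_INF_decseq:
  assumes [measurable]: "\<And>n. h n \<in> borel_measurable borel" and dec: "decseq h"
    and fin: "expint l (h 0) < \<infinity>"
  shows "expint l (\<lambda>t. INF n. h n t) = (INF n. expint l (h n))"
proof -
  have dec': "h n t \<le> h m t" if "m \<le> n" for m n t
    using dec that by (auto simp: monotone_on_def le_fun_def)
  have "expint l (\<lambda>t. INF n. h n t)
      = (\<integral>\<^sup>+t. (INF n. ennreal (exp (- l * t)) * h n t * indicator {0..} t) \<partial>lborel)"
    unfolding expint_def
  proof (intro nn_integral_cong)
    fix t
    have "(\<lambda>n. ennreal (exp (- l * t)) * h n t) \<longlonglongrightarrow> ennreal (exp (- l * t)) * (INF n. h n t)"
      by (intro ennreal_tendsto_cmult LIMSEQ_INF) (auto simp: decseq_def dec')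
    moreover have "(\<lambda>n. ennreal (exp (- l * t)) * h n t) \<longlonglongrightarrow> (INF n. ennreal (exp (- l * t)) * h n t)"
      by (intro LIMSEQ_INF) (auto simp: decseq_def intro!: mult_left_mono dec')
    ultimately have "ennreal (exp (- l * t)) * (INF n. h n t) = (INF n. ennreal (exp (- l * t)) * h n t)"
      by (rule LIMSEQ_unique)
    then show "ennreal (exp (- l * t)) * (INF n. h n t) * indicator {0..} t
        = (INF n. ennreal (exp (- l * t)) * h n t * indicator {0..} t)"
      by (auto simp: indicator_def)
  qed
  also have "\<dots> = (INF n. expint l (h n))"
    unfolding expint_def
    by (rule nn_integral_monotone_convergence_INF_decseq[where i=0])
       (use fin in \<open>auto simp: expint_def intro!: antimonoI le_funI mult_left_mono mult_right_mono dec'\<close>)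
  finally show ?thesis .
qed

lemma expint_measurable[measurable]:
  assumes [measurable]: "(\<lambda>(x, t). h x t) \<in> borel_measurable (N \<Otimes>\<^sub>M borel)"
  shows "(\<lambda>x. expint l (h x)) \<in> borel_measurable N"
  unfolding expint_def by measurable

definition after_claim :: "ereal \<Rightarrow> (real \<Rightarrow> real \<Rightarrow> ennreal) \<Rightarrow> real \<Rightarrow> real \<Rightarrow> ennreal" where
  "after_claim r h y z =
     (if 0 \<le> y then h y z else if r = \<infinity> then 0
      else if z + real_of_ereal r * y < 0 then 0 else h 0 (z + real_of_ereal r * y))"

abbreviation measurable2 :: "(real \<Rightarrow> real \<Rightarrow> ennreal) \<Rightarrow> bool" where
  "measurable2 h \<equiv> (\<lambda>(x, y). h x y) \<in> borel_measurable (borel \<Otimes>\<^sub>M borel)"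

definition mono_quadrant :: "(real \<Rightarrow> real \<Rightarrow> ennreal) \<Rightarrow> bool" where
  "mono_quadrant h \<longleftrightarrow> (\<forall>x y x' y'. 0 \<le> x \<longrightarrow> 0 \<le> y \<longrightarrow> x \<le> x' \<longrightarrow> y \<le> y' \<longrightarrow> h x y \<le> h x' y')"

lemma mono_quadrantD:
  "mono_quadrant h \<Longrightarrow> 0 \<le> x \<Longrightarrow> 0 \<le> y \<Longrightarrow> x \<le> x' \<Longrightarrow> y \<le> y' \<Longrightarrow> h x y \<le> h x' y'"
  by (auto simp: mono_quadrant_def)

lemma mono_quadrant_swap: "mono_quadrant h \<Longrightarrow> mono_quadrant (\<lambda>x y. h y x)"
  by (auto simp: mono_quadrant_def)

lemma measurable2_swap:
  assumes [measurable]: "measurable2 h"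
  shows "measurable2 (\<lambda>x y. h y x)"
  by measurable

lemma after_claim_measurable[measurable (raw)]:
  assumes [measurable]: "measurable2 h" "f \<in> borel_measurable N" "g \<in> borel_measurable N"
  shows "(\<lambda>w. after_claim r h (f w) (g w)) \<in> borel_measurable N"
  unfolding after_claim_def by measurable

lemma after_claim_le:
  assumes "\<And>x y. 0 \<le> x \<Longrightarrow> 0 \<le> y \<Longrightarrow> h x y \<le> k x y" "0 \<le> z"
  shows "after_claim r h y z \<le> after_claim r k y z"
  using assms by (auto simp: after_claim_def not_less)

lemma after_claim_cong:
  assumes "\<And>x y. 0 \<le> x \<Longrightarrow> 0 \<le> y \<Longrightarrow> h x y = k x y" "0 \<le> z"
  shows "after_claim r h y z = after_claim r k y z"
  using assms by (auto simp: after_claim_def not_less)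

lemma after_claim_le_fun: "h \<le> k \<Longrightarrow> after_claim r h y z \<le> after_claim r k y z"
  by (auto simp: after_claim_def le_fun_def)

lemma after_claim_add:
  "after_claim r (\<lambda>x y. h x y + k x y) y z = after_claim r h y z + after_claim r k y z"
  by (auto simp: after_claim_def)

lemma after_claim_cmult: "after_claim r (\<lambda>x y. a * h x y) y z = a * after_claim r h y z"
  by (auto simp: after_claim_def)

lemma after_claim_1_le: "after_claim r (\<lambda>_ _. 1) y z \<le> 1"
  by (auto simp: after_claim_def)

lemma after_claim_mono:
  assumes h: "mono_quadrant h" and r: "0 \<le> r" and "0 \<le> z" "z \<le> z'" "y \<le> y'"
  shows "after_claim r h y z \<le> after_claim r h y' z'"
proof -
  have r0: "0 \<le> real_of_ereal r" using r by (simp add: real_of_ereal_pos)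
  have *: "z + real_of_ereal r * y \<le> z' + real_of_ereal r * y'"
    using assms r0 by (intro add_mono mult_left_mono) auto
  have **: "z + real_of_ereal r * y \<le> z" if "y < 0"
    using r0 that by (simp add: mult_nonneg_nonpos)
  show ?thesis
  proof (cases "0 \<le> y")
    case True
    then show ?thesis using assms by (auto simp: after_claim_def intro!: mono_quadrantD[OF h])
  next
    case False
    then show ?thesis
      using assms * ** by (auto simp: after_claim_def not_less not_le intro!: mono_quadrantD[OF h])
  qed
qed

lemma after_claim_rate_antimono:
  assumes h: "mono_quadrant h" and r: "0 \<le> r" "r \<le> r'" and "0 \<le> z"
  shows "after_claim r' h y z \<le> after_claim r h y z"
proof (cases "0 \<le> y \<or> r' = \<infinity>")
  case True
  then show ?thesis by (auto simp: after_claim_def)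
next
  case False
  then have fin: "r \<noteq> \<infinity>" "r' \<noteq> \<infinity>" and y: "y < 0" using r by auto
  have "real_of_ereal r \<le> real_of_ereal r'"
    using r fin by (intro real_of_ereal_positive_mono) auto
  then have le: "z + real_of_ereal r' * y \<le> z + real_of_ereal r * y"
    using y by (simp add: mult_right_mono_neg)
  show ?thesis
  proof (cases "z + real_of_ereal r' * y < 0")
    case True
    then show ?thesis using fin y by (simp add: after_claim_def)
  next
    case nonneg: False
    have nn: "\<not> z + real_of_ereal r * y < 0" using le nonneg by linarith
    have "after_claim r' h y z = h 0 (z + real_of_ereal r' * y)"
      using fin y nonneg by (simp add: after_claim_def)
    also have "\<dots> \<le> h 0 (z + real_of_ereal r * y)"
      using nonneg le by (intro mono_quadrantD[OF h]) auto
    also have "\<dots> = after_claim r h y z"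
      using fin y nn by (simp add: after_claim_def)
    finally show ?thesis .
  qed
qed

locale coupled_risk =
  fixes c1 c2 l1 l2 :: real and D1 D2 :: "real measure"
  assumes c_pos: "0 < c1" "0 < c2" and l_pos: "0 < l1" "0 < l2"
    and D1_prob: "prob_space D1" and D2_prob: "prob_space D2"
    and sets_D1[measurable_cong, simp]: "sets D1 = sets borel"
    and sets_D2[measurable_cong, simp]: "sets D2 = sets borel"
    and D1_pos: "AE j in D1. 0 < j" and D2_pos: "AE j in D2. 0 < j"
begin

abbreviation l :: real where "l \<equiv> l1 + l2"

lemma lam_pos: "0 < l" using l_pos by simp

sublocale D1: prob_space D1 by (rule D1_prob)
sublocale D2: prob_space D2 by (rule D2_prob)

definition claim1 :: "ereal \<Rightarrow> (real \<Rightarrow> real \<Rightarrow> ennreal) \<Rightarrow> real \<Rightarrow> real \<Rightarrow> ennreal" where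
  "claim1 r h x1 x2 = (\<integral>\<^sup>+j. after_claim r h (x1 - j) x2 \<partial>D1)"

definition claim2 :: "ereal \<Rightarrow> (real \<Rightarrow> real \<Rightarrow> ennreal) \<Rightarrow> real \<Rightarrow> real \<Rightarrow> ennreal" where
  "claim2 r h x1 x2 = (\<integral>\<^sup>+j. after_claim r (\<lambda>x y. h y x) (x2 - j) x1 \<partial>D2)"

definition jump :: "ereal \<Rightarrow> ereal \<Rightarrow> (real \<Rightarrow> real \<Rightarrow> ennreal) \<Rightarrow> real \<Rightarrow> real \<Rightarrow> ennreal" where
  "jump r1 r2 h x1 x2 = ennreal l1 * claim1 r1 h x1 x2 + ennreal l2 * claim2 r2 h x1 x2"

definition ray :: "(real \<Rightarrow> real \<Rightarrow> ennreal) \<Rightarrow> real \<Rightarrow> real \<Rightarrow> ennreal" where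
  "ray h x1 x2 = expint l (\<lambda>t. h (x1 + c1 * t) (x2 + c2 * t))"

definition step :: "ereal \<Rightarrow> ereal \<Rightarrow> (real \<Rightarrow> real \<Rightarrow> ennreal) \<Rightarrow> real \<Rightarrow> real \<Rightarrow> ennreal" where
  "step r1 r2 h = ray (jump r1 r2 h)"

definition surv_upto :: "ereal \<Rightarrow> ereal \<Rightarrow> nat \<Rightarrow> real \<Rightarrow> real \<Rightarrow> ennreal" where
  "surv_upto r1 r2 n = (step r1 r2 ^^ n) (\<lambda>_ _. 1)"

definition surv :: "ereal \<Rightarrow> ereal \<Rightarrow> real \<Rightarrow> real \<Rightarrow> ennreal" where
  "surv r1 r2 x1 x2 = (INF n. surv_upto r1 r2 n x1 x2)"

lemma surv_upto_0: "surv_upto r1 r2 0 = (\<lambda>_ _. 1)"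
  and surv_upto_Suc: "surv_upto r1 r2 (Suc n) = step r1 r2 (surv_upto r1 r2 n)"
  by (simp_all add: surv_upto_def)

lemma claim1_measurable[measurable (raw)]:
  assumes [measurable]: "measurable2 h" "f \<in> borel_measurable N" "g \<in> borel_measurable N"
  shows "(\<lambda>w. claim1 r h (f w) (g w)) \<in> borel_measurable N"
  unfolding claim1_def by measurable

lemma claim2_measurable[measurable (raw)]:
  assumes [measurable]: "measurable2 h" "f \<in> borel_measurable N" "g \<in> borel_measurable N"
  shows "(\<lambda>w. claim2 r h (f w) (g w)) \<in> borel_measurable N"
  unfolding claim2_def using measurable2_swap[OF assms(1), measurable] by measurable

lemma jump_measurable[measurable (raw)]:
  assumes [measurable]: "measurable2 h" "f \<in> borel_measurable N" "g \<in> borel_measurable N"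
  shows "(\<lambda>w. jump r1 r2 h (f w) (g w)) \<in> borel_measurable N"
  unfolding jump_def by measurable

lemma ray_measurable[measurable (raw)]:
  assumes [measurable]: "measurable2 h" "f \<in> borel_measurable N" "g \<in> borel_measurable N"
  shows "(\<lambda>w. ray h (f w) (g w)) \<in> borel_measurable N"
  unfolding ray_def by measurable

lemma measurable2_jump:
  assumes [measurable]: "measurable2 h"
  shows "measurable2 (jump r1 r2 h)"
  by measurable

lemma step_measurable[measurable (raw)]:
  assumes [measurable]: "measurable2 h" "f \<in> borel_measurable N" "g \<in> borel_measurable N"
  shows "(\<lambda>w. step r1 r2 h (f w) (g w)) \<in> borel_measurable N"
  unfolding step_def using measurable2_jump[OF assms(1), measurable] by measurable

lemma measurable2_surv_upto: "measurable2 (surv_upto r1 r2 n)"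
proof (induction n)
  case (Suc n)
  note Suc[measurable]
  show ?case unfolding surv_upto_Suc by measurable
qed (simp add: surv_upto_0)

lemma surv_upto_measurable[measurable (raw)]:
  assumes [measurable]: "f \<in> borel_measurable N" "g \<in> borel_measurable N"
  shows "(\<lambda>w. surv_upto r1 r2 n (f w) (g w)) \<in> borel_measurable N"
  using measurable_compose[OF _ measurable2_surv_upto, of "\<lambda>w. (f w, g w)"] by simp

lemma surv_measurable[measurable (raw)]:
  assumes [measurable]: "f \<in> borel_measurable N" "g \<in> borel_measurable N"
  shows "(\<lambda>w. surv r1 r2 (f w) (g w)) \<in> borel_measurable N"
  unfolding surv_def by measurable

lemma ray_mono:
  assumes "\<And>x y. 0 \<le> x \<Longrightarrow> 0 \<le> y \<Longrightarrow> h x y \<le> k x y" "0 \<le> x1" "0 \<le> x2"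
  shows "ray h x1 x2 \<le> ray k x1 x2"
  unfolding ray_def using assms c_pos by (intro expint_mono) auto

lemma jump_mono:
  assumes "\<And>x y. 0 \<le> x \<Longrightarrow> 0 \<le> y \<Longrightarrow> h x y \<le> k x y" "0 \<le> x1" "0 \<le> x2"
  shows "jump r1 r2 h x1 x2 \<le> jump r1 r2 k x1 x2"
  unfolding jump_def claim1_def claim2_def using assms
  by (intro add_mono mult_left_mono nn_integral_mono after_claim_le) auto

lemma step_mono:
  assumes "\<And>x y. 0 \<le> x \<Longrightarrow> 0 \<le> y \<Longrightarrow> h x y \<le> k x y" "0 \<le> x1" "0 \<le> x2"
  shows "step r1 r2 h x1 x2 \<le> step r1 r2 k x1 x2"
  unfolding step_def using assms by (intro ray_mono jump_mono) auto

lemma step_le_fun: "h \<le> k \<Longrightarrow> step r1 r2 h \<le> step r1 r2 k"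
  unfolding step_def ray_def jump_def claim1_def claim2_def
  by (intro le_funI expint_mono add_mono mult_left_mono nn_integral_mono after_claim_le_fun)
     (auto simp: le_fun_def)

lemma step_cong:
  assumes "\<And>x y. 0 \<le> x \<Longrightarrow> 0 \<le> y \<Longrightarrow> h x y = k x y" "0 \<le> x1" "0 \<le> x2"
  shows "step r1 r2 h x1 x2 = step r1 r2 k x1 x2"
  by (intro antisym step_mono) (auto simp: assms)

lemma jump_add:
  assumes [measurable]: "measurable2 h" "measurable2 k"
  shows "jump r1 r2 (\<lambda>x y. h x y + k x y) x1 x2 = jump r1 r2 h x1 x2 + jump r1 r2 k x1 x2"
  unfolding jump_def claim1_def claim2_def
  using assms[THEN measurable2_swap, measurable]
  by (simp add: after_claim_add nn_integral_add distrib_left add.assoc add.left_commute)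

lemma jump_cmult:
  assumes [measurable]: "measurable2 h"
  shows "jump r1 r2 (\<lambda>x y. a * h x y) x1 x2 = a * jump r1 r2 h x1 x2"
  unfolding jump_def claim1_def claim2_def
  using assms[THEN measurable2_swap, measurable]
  by (simp add: after_claim_cmult nn_integral_cmult distrib_left mult.left_commute)

lemma ray_add:
  assumes [measurable]: "measurable2 h" "measurable2 k"
  shows "ray (\<lambda>x y. h x y + k x y) x1 x2 = ray h x1 x2 + ray k x1 x2"
  unfolding ray_def by (subst expint_add) auto

lemma ray_cmult:
  assumes [measurable]: "measurable2 h"
  shows "ray (\<lambda>x y. a * h x y) x1 x2 = a * ray h x1 x2"
  unfolding ray_def by (subst expint_cmult) auto

lemma step_add:
  assumes "measurable2 h" "measurable2 k"
  shows "step r1 r2 (\<lambda>x y. h x y + k x y) x1 x2 = step r1 r2 h x1 x2 + step r1 r2 k x1 x2"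
proof -
  have "jump r1 r2 (\<lambda>x y. h x y + k x y) = (\<lambda>x y. jump r1 r2 h x y + jump r1 r2 k x y)"
    by (intro ext jump_add assms)
  then show ?thesis
    unfolding step_def using assms by (simp add: ray_add measurable2_jump)
qed

lemma step_cmult:
  assumes "measurable2 h"
  shows "step r1 r2 (\<lambda>x y. a * h x y) x1 x2 = a * step r1 r2 h x1 x2"
proof -
  have "jump r1 r2 (\<lambda>x y. a * h x y) = (\<lambda>x y. a * jump r1 r2 h x y)"
    by (intro ext jump_cmult assms)
  then show ?thesis
    unfolding step_def using assms by (simp add: ray_cmult measurable2_jump)
qed

lemma ray_const: "ray (\<lambda>_ _. ennreal l) x1 x2 = 1"
  using ray_cmult[of "\<lambda>_ _. 1" "ennreal l" x1 x2] expint_one[OF lam_pos]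
  by (simp add: ray_def)

lemma jump_1_le: "jump r1 r2 (\<lambda>_ _. 1) x1 x2 \<le> ennreal l"
proof -
  have "claim1 r1 (\<lambda>_ _. 1) x1 x2 \<le> (\<integral>\<^sup>+j. 1 \<partial>D1)"
    unfolding claim1_def by (intro nn_integral_mono after_claim_1_le)
  moreover have "claim2 r2 (\<lambda>_ _. 1) x1 x2 \<le> (\<integral>\<^sup>+j. 1 \<partial>D2)"
    unfolding claim2_def by (intro nn_integral_mono after_claim_1_le)
  ultimately have "jump r1 r2 (\<lambda>_ _. 1) x1 x2 \<le> ennreal l1 * 1 + ennreal l2 * 1"
    unfolding jump_def by (intro add_mono mult_left_mono) (auto simp: D1.emeasure_space_1 D2.emeasure_space_1)
  then show ?thesis using l_pos by simp
qed

lemma step_1_le: "step r1 r2 (\<lambda>_ _. 1) x1 x2 \<le> 1"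
proof -
  have "step r1 r2 (\<lambda>_ _. 1) x1 x2 \<le> ray (\<lambda>_ _. ennreal l) x1 x2"
    unfolding step_def ray_def using jump_1_le by (intro expint_mono) auto
  then show ?thesis by (simp add: ray_const)
qed

lemma surv_upto_Suc_le: "surv_upto r1 r2 (Suc n) \<le> surv_upto r1 r2 n"
proof (induction n)
  case 0
  then show ?case by (simp add: surv_upto_Suc surv_upto_0 le_fun_def step_1_le)
next
  case (Suc n)
  then show ?case by (subst (1 2) surv_upto_Suc) (intro step_le_fun)
qed

lemma surv_upto_antimono: "m \<le> n \<Longrightarrow> surv_upto r1 r2 n x y \<le> surv_upto r1 r2 m x y"
  using lift_Suc_antimono_le[of "surv_upto r1 r2", OF surv_upto_Suc_le] by (auto simp: le_fun_def)

lemma surv_upto_le_1: "surv_upto r1 r2 n x y \<le> 1"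
  using surv_upto_antimono[of 0 n] by (simp add: surv_upto_0)

lemma surv_le_surv_upto: "surv r1 r2 x y \<le> surv_upto r1 r2 n x y"
  unfolding surv_def by (rule INF_lower) simp

lemma surv_le_1: "surv r1 r2 x y \<le> 1"
  using surv_le_surv_upto surv_upto_le_1 order_trans by blast

lemma surv_finite[simp]: "surv r1 r2 x y < \<top>" "surv r1 r2 x y \<noteq> \<top>"
  using surv_le_1[of r1 r2 x y] by (auto simp: top_unique intro: le_less_trans)

lemma surv_upto_LIMSEQ: "(\<lambda>n. surv_upto r1 r2 n x y) \<longlonglongrightarrow> surv r1 r2 x y"
  unfolding surv_def by (rule LIMSEQ_INF) (auto simp: decseq_def surv_upto_antimono)

lemma after_claim_INF:
  fixes h :: "nat \<Rightarrow> real \<Rightarrow> real \<Rightarrow> ennreal"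
  shows "after_claim r (\<lambda>x y. INF n. h n x y) y z = (INF n. after_claim r (h n) y z)"
  by (auto simp: after_claim_def)

lemma claim_INF:
  shows "claim1 r1 (surv r1 r2) x y = (INF n. claim1 r1 (surv_upto r1 r2 n) x y)"
    and "claim2 r2 (surv r1 r2) x y = (INF n. claim2 r2 (surv_upto r1 r2 n) x y)"
proof -
  have le: "after_claim r (surv_upto r1 r2 n) y z \<le> 1"
    "after_claim r (\<lambda>x y. surv_upto r1 r2 n y x) y z \<le> 1" for r n y z
    by (auto simp: after_claim_def surv_upto_le_1)
  show "claim1 r1 (surv r1 r2) x y = (INF n. claim1 r1 (surv_upto r1 r2 n) x y)"
    unfolding claim1_def surv_def[abs_def] after_claim_INF
  proof (rule nn_integral_monotone_convergence_INF_decseq[where i=0])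
    show "decseq (\<lambda>n j. after_claim r1 (surv_upto r1 r2 n) (x - j) y)"
      by (intro antimonoI le_funI after_claim_le_fun surv_upto_antimono)
    have "(\<integral>\<^sup>+j. after_claim r1 (surv_upto r1 r2 0) (x - j) y \<partial>D1) \<le> (\<integral>\<^sup>+j. 1 \<partial>D1)"
      by (intro nn_integral_mono le)
    then show "(\<integral>\<^sup>+j. after_claim r1 (surv_upto r1 r2 0) (x - j) y \<partial>D1) < \<infinity>"
      by (auto simp: D1.emeasure_space_1 intro: le_less_trans)
  qed measurable
  show "claim2 r2 (surv r1 r2) x y = (INF n. claim2 r2 (surv_upto r1 r2 n) x y)"
    unfolding claim2_def surv_def[abs_def] after_claim_INF
  proof (rule nn_integral_monotone_convergence_INF_decseq[where i=0])
    show "decseq (\<lambda>n j. after_claim r2 (\<lambda>x y. surv_upto r1 r2 n y x) (y - j) x)"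
      by (intro antimonoI le_funI after_claim_le_fun surv_upto_antimono)
    have "(\<integral>\<^sup>+j. after_claim r2 (\<lambda>x y. surv_upto r1 r2 0 y x) (y - j) x \<partial>D2) \<le> (\<integral>\<^sup>+j. 1 \<partial>D2)"
      by (intro nn_integral_mono le)
    then show "(\<integral>\<^sup>+j. after_claim r2 (\<lambda>x y. surv_upto r1 r2 0 y x) (y - j) x \<partial>D2) < \<infinity>"
      by (auto simp: D2.emeasure_space_1 intro: le_less_trans)
  qed measurable
qed

lemma claim_surv_upto_antimono:
  "m \<le> n \<Longrightarrow> claim1 r1 (surv_upto r1 r2 n) x y \<le> claim1 r1 (surv_upto r1 r2 m) x y"
  "m \<le> n \<Longrightarrow> claim2 r2 (surv_upto r1 r2 n) x y \<le> claim2 r2 (surv_upto r1 r2 m) x y"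
  unfolding claim1_def claim2_def
  by (auto intro!: nn_integral_mono after_claim_le_fun simp: le_fun_def surv_upto_antimono)

lemma jump_surv: "jump r1 r2 (surv r1 r2) x y = (INF n. jump r1 r2 (surv_upto r1 r2 n) x y)"
proof (rule LIMSEQ_unique)
  show "(\<lambda>n. jump r1 r2 (surv_upto r1 r2 n) x y) \<longlonglongrightarrow> jump r1 r2 (surv r1 r2) x y"
    unfolding jump_def claim_INF
    by (intro tendsto_add ennreal_tendsto_cmult LIMSEQ_INF)
       (auto simp: decseq_def claim_surv_upto_antimono)
  show "(\<lambda>n. jump r1 r2 (surv_upto r1 r2 n) x y) \<longlonglongrightarrow> (INF n. jump r1 r2 (surv_upto r1 r2 n) x y)"
    by (rule LIMSEQ_INF)
       (auto simp: decseq_def jump_def intro!: add_mono mult_left_mono claim_surv_upto_antimono)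
qed

lemma step_surv: "step r1 r2 (surv r1 r2) x y = surv r1 r2 x y"
proof -
  have "step r1 r2 (surv r1 r2) x y = (INF n. step r1 r2 (surv_upto r1 r2 n) x y)"
    unfolding step_def ray_def jump_surv
  proof (rule expint_INF_decseq)
    show "decseq (\<lambda>n t. jump r1 r2 (surv_upto r1 r2 n) (x + c1 * t) (y + c2 * t))"
      by (auto simp: jump_def intro!: antimonoI le_funI add_mono mult_left_mono claim_surv_upto_antimono)
    show "expint l (\<lambda>t. jump r1 r2 (surv_upto r1 r2 0) (x + c1 * t) (y + c2 * t)) < \<infinity>"
      using step_1_le[of r1 r2 x y] by (auto simp: step_def ray_def surv_upto_0 intro: le_less_trans)
  qed measurable
  also have "\<dots> = (INF n. surv_upto r1 r2 (Suc n) x y)"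
    by (simp add: surv_upto_Suc)
  also have "\<dots> = surv r1 r2 x y"
  proof (rule LIMSEQ_unique)
    show "(\<lambda>n. surv_upto r1 r2 (Suc n) x y) \<longlonglongrightarrow> surv r1 r2 x y"
      using surv_upto_LIMSEQ by (rule LIMSEQ_Suc)
    show "(\<lambda>n. surv_upto r1 r2 (Suc n) x y) \<longlonglongrightarrow> (INF n. surv_upto r1 r2 (Suc n) x y)"
      by (rule LIMSEQ_INF) (auto simp: decseq_def surv_upto_antimono)
  qed
  finally show ?thesis .
qed

lemma surv_eq_ray: "surv r1 r2 x y = ray (jump r1 r2 (surv r1 r2)) x y"
  using step_surv[of r1 r2 x y] by (simp add: step_def)

lemma mono_quadrant_step:
  assumes h: "mono_quadrant h" and r: "0 \<le> r1" "0 \<le> r2"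
  shows "mono_quadrant (step r1 r2 h)"
  unfolding mono_quadrant_def step_def ray_def jump_def claim1_def claim2_def
  using c_pos r
  by (auto intro!: expint_mono add_mono mult_left_mono nn_integral_mono after_claim_mono h mono_quadrant_swap[OF h])

lemma mono_quadrant_surv_upto:
  assumes "0 \<le> r1" "0 \<le> r2"
  shows "mono_quadrant (surv_upto r1 r2 n)"
  by (induction n) (auto simp: surv_upto_0 surv_upto_Suc mono_quadrant_step assms, auto simp: mono_quadrant_def)

lemma mono_quadrant_surv:
  assumes "0 \<le> r1" "0 \<le> r2"
  shows "mono_quadrant (surv r1 r2)"
  unfolding mono_quadrant_def surv_def
  by (auto intro!: INF_mono' mono_quadrantD[OF mono_quadrant_surv_upto[OF assms]])

lemma surv_upto_rate_antimono:
  assumes r: "0 \<le> r1" "r1 \<le> r1'" "0 \<le> r2" "r2 \<le> r2'" and "0 \<le> x" "0 \<le> y"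
  shows "surv_upto r1' r2' n x y \<le> surv_upto r1 r2 n x y"
  using assms(5,6)
proof (induction n arbitrary: x y)
  case (Suc n)
  have r': "0 \<le> r1'" "0 \<le> r2'" using r by auto
  note m = mono_quadrant_surv_upto[OF r']
  have "surv_upto r1' r2' (Suc n) x y \<le> step r1 r2 (surv_upto r1' r2' n) x y"
    unfolding surv_upto_Suc step_def ray_def jump_def claim1_def claim2_def
    using c_pos r Suc.prems
    by (intro expint_mono add_mono mult_left_mono nn_integral_mono after_claim_rate_antimono
        m mono_quadrant_swap[OF m]) auto
  also have "\<dots> \<le> surv_upto r1 r2 (Suc n) x y"
    unfolding surv_upto_Suc using Suc by (intro step_mono) auto
  finally show ?case .
qed (simp add: surv_upto_0)

lemma surv_rate_antimono:
  assumes "0 \<le> r1" "r1 \<le> r1'" "0 \<le> r2" "r2 \<le> r2'" "0 \<le> x" "0 \<le> y"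
  shows "surv r1' r2' x y \<le> surv r1 r2 x y"
  unfolding surv_def by (intro INF_mono' surv_upto_rate_antimono assms)

lemma surv_shift_le:
  assumes s: "0 \<le> s"
  shows "ennreal (exp (- l * s)) * surv r1 r2 (x + c1 * s) (y + c2 * s) \<le> surv r1 r2 x y"
proof -
  let ?h = "\<lambda>t. jump r1 r2 (surv r1 r2) (x + c1 * t) (y + c2 * t)"
  have "ennreal (exp (- l * s)) * surv r1 r2 (x + c1 * s) (y + c2 * s)
      = ennreal (exp (- l * s)) * expint l (\<lambda>t. ?h (s + t))"
    by (subst surv_eq_ray) (simp add: ray_def distrib_left add.assoc)
  also have "\<dots> = expint l (\<lambda>t. ?h t * indicator {s..} t)"
    using s by (subst expint_shift) auto
  also have "\<dots> \<le> expint l ?h"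
    by (rule expint_mono) (auto simp: indicator_def)
  also have "\<dots> = surv r1 r2 x y"
    using surv_eq_ray[of r1 r2 x y] by (simp add: ray_def)
  finally show ?thesis .
qed

lemma coupled_risk_swap: "coupled_risk c2 c1 l2 l1 D2 D1"
  by unfold_locales (use c_pos l_pos D1_pos D2_pos in auto)

end

sublocale coupled_risk \<subseteq> swapped: coupled_risk c2 c1 l2 l1 D2 D1
  by (rule coupled_risk_swap)

section \<open>Convolutions with the survival functions\<close>

lemma pred_mem_ray[measurable (raw)]:
  fixes f g :: "'a \<Rightarrow> real"
  assumes [measurable]: "f \<in> borel_measurable M" "g \<in> borel_measurable M"
  shows "Measurable.pred M (\<lambda>x. g x \<in> {..f x})" "Measurable.pred M (\<lambda>x. g x \<in> {..<f x})"
    "Measurable.pred M (\<lambda>x. g x \<in> {f x..})" "Measurable.pred M (\<lambda>x. g x \<in> {f x<..})"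
  unfolding atMost_iff lessThan_iff atLeast_iff greaterThan_iff by measurable

definition conv1 :: "real measure \<Rightarrow> (real \<Rightarrow> real \<Rightarrow> ennreal) \<Rightarrow> real \<Rightarrow> real \<Rightarrow> ennreal" where
  "conv1 N h x1 x2 = (\<integral>\<^sup>+u. h (x1 - u) x2 * indicator {..x1} u \<partial>N)"

definition conv2 :: "real measure \<Rightarrow> (real \<Rightarrow> real \<Rightarrow> ennreal) \<Rightarrow> real \<Rightarrow> real \<Rightarrow> ennreal" where
  "conv2 N h x1 x2 = conv1 N (\<lambda>x y. h y x) x2 x1"

locale nonneg_measure = finite_measure N for N :: "real measure" +
  assumes sets_N[measurable_cong, simp]: "sets N = sets borel"
    and nonneg_N: "AE u in N. 0 \<le> u"
begin

lemma space_N[simp]: "space N = UNIV"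
  using sets_eq_imp_space_eq[OF sets_N] by simp

lemma conv1_measurable[measurable (raw)]:
  assumes [measurable]: "measurable2 h" "f \<in> borel_measurable K" "g \<in> borel_measurable K"
  shows "(\<lambda>w. conv1 N h (f w) (g w)) \<in> borel_measurable K"
  unfolding conv1_def by measurable

lemma conv2_measurable[measurable (raw)]:
  assumes [measurable]: "measurable2 h" "f \<in> borel_measurable K" "g \<in> borel_measurable K"
  shows "(\<lambda>w. conv2 N h (f w) (g w)) \<in> borel_measurable K"
  unfolding conv2_def using measurable2_swap[OF assms(1), measurable] by measurable

lemma cdf_measurable[measurable (raw)]:
  assumes [measurable]: "f \<in> borel_measurable K"
  shows "(\<lambda>w. emeasure N {..f w}) \<in> borel_measurable K"
proof -
  have "(\<lambda>w. \<integral>\<^sup>+u. indicator {..f w} u \<partial>N) \<in> borel_measurable K"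
    by measurable
  then show ?thesis by simp
qed

lemma conv1_0:
  "conv1 N h 0 x2 = emeasure N {..0} * h 0 x2"
proof -
  have "conv1 N h 0 x2 = (\<integral>\<^sup>+u. h 0 x2 * indicator {..0} u \<partial>N)"
    unfolding conv1_def using nonneg_N by (intro nn_integral_cong_AE) (auto simp: indicator_def)
  then show ?thesis by (simp add: nn_integral_cmult mult.commute)
qed

lemma after_claim_conv2:
  assumes [measurable]: "measurable2 h" and r: "0 \<le> r"
  shows "after_claim r (conv2 N h) y z = (\<integral>\<^sup>+v. after_claim r h y (z - v) * indicator {..z} v \<partial>N)"
proof -
  have ry: "real_of_ereal r * y \<le> 0" if "y < 0"
    using r that by (simp add: mult_nonneg_nonpos real_of_ereal_pos)
  consider "0 \<le> y" | "y < 0" "r = \<infinity>" | "y < 0" "r \<noteq> \<infinity>" "z + real_of_ereal r * y < 0"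
    | "y < 0" "r \<noteq> \<infinity>" "0 \<le> z + real_of_ereal r * y"
    by linarith
  then show ?thesis
  proof cases
    case 3
    have "(\<integral>\<^sup>+v. after_claim r h y (z - v) * indicator {..z} v \<partial>N) = (\<integral>\<^sup>+v. 0 \<partial>N)"
      using nonneg_N 3 by (intro nn_integral_cong_AE) (auto simp: after_claim_def)
    with 3 show ?thesis by (simp add: after_claim_def)
  next
    case 4
    have "(\<integral>\<^sup>+v. after_claim r h y (z - v) * indicator {..z} v \<partial>N)
        = (\<integral>\<^sup>+v. h 0 (z + real_of_ereal r * y - v) * indicator {..z + real_of_ereal r * y} v \<partial>N)"
      using 4 ry by (intro nn_integral_cong) (auto simp: after_claim_def indicator_def algebra_simps)
    with 4 show ?thesis by (simp add: after_claim_def conv2_def conv1_def)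
  qed (auto simp: after_claim_def conv2_def conv1_def)
qed

end

context coupled_risk
begin

lemma claim2_swap: "claim2 r h x1 x2 = swapped.claim1 r (\<lambda>x y. h y x) x2 x1"
  by (simp add: claim2_def swapped.claim1_def)

lemma swapped_jump: "swapped.jump r2 r1 (\<lambda>x y. h y x) x2 x1 = jump r1 r2 h x1 x2"
  by (simp add: jump_def swapped.jump_def claim2_def claim1_def swapped.claim2_def swapped.claim1_def add.commute)

lemma swapped_ray: "swapped.ray (\<lambda>x y. h y x) x2 x1 = ray h x1 x2"
  by (simp add: ray_def swapped.ray_def add.commute)

lemma swapped_step: "swapped.step r2 r1 (\<lambda>x y. h y x) x2 x1 = step r1 r2 h x1 x2"
proof -
  have "swapped.jump r2 r1 (\<lambda>x y. h y x) = (\<lambda>x y. jump r1 r2 h y x)"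
    by (intro ext swapped_jump)
  then show ?thesis by (simp add: step_def swapped.step_def swapped_ray)
qed

lemma swapped_surv_upto: "swapped.surv_upto r2 r1 n x2 x1 = surv_upto r1 r2 n x1 x2"
proof (induction n arbitrary: x1 x2)
  case (Suc n)
  then have "swapped.surv_upto r2 r1 n = (\<lambda>x y. surv_upto r1 r2 n y x)"
    by (intro ext)
  then show ?case by (simp add: surv_upto_Suc swapped.surv_upto_Suc swapped_step)
qed (simp add: surv_upto_0 swapped.surv_upto_0)

lemma swapped_surv: "swapped.surv r2 r1 x2 x1 = surv r1 r2 x1 x2"
  by (simp add: surv_def swapped.surv_def swapped_surv_upto)

lemma claim1_conv2:
  assumes "nonneg_measure N" and h[measurable]: "measurable2 h" and r: "0 \<le> r"
  shows "claim1 r (conv2 N h) x1 x2 = conv2 N (claim1 r h) x1 x2"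
proof -
  interpret nonneg_measure N by fact
  interpret pair_sigma_finite D1 N ..
  have "claim1 r (conv2 N h) x1 x2
      = (\<integral>\<^sup>+j. \<integral>\<^sup>+v. after_claim r h (x1 - j) (x2 - v) * indicator {..x2} v \<partial>N \<partial>D1)"
    unfolding claim1_def by (simp add: after_claim_conv2 r h)
  also have "\<dots> = (\<integral>\<^sup>+v. \<integral>\<^sup>+j. after_claim r h (x1 - j) (x2 - v) * indicator {..x2} v \<partial>D1 \<partial>N)"
    by (rule Fubini'[symmetric]) measurable
  also have "\<dots> = conv2 N (claim1 r h) x1 x2"
    unfolding conv2_def conv1_def claim1_def by (simp add: nn_integral_multc)
  finally show ?thesis .
qed

lemma claim1_conv1:
  assumes "nonneg_measure N" and h[measurable]: "measurable2 h" and r: "0 \<le> r"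
    and x: "0 \<le> x1" "0 \<le> x2"
  shows "claim1 r (conv1 N h) x1 x2 + emeasure N {..x1} * h 0 x2
    = conv1 N (claim1 0 h) x1 x2 + claim1 r (\<lambda>x y. emeasure N {..x} * h 0 y) x1 x2"
proof -
  interpret nonneg_measure N by fact
  interpret pair_sigma_finite N D1 ..
  let ?m = "\<lambda>x y. emeasure N {..x} * h 0 y"
  have pt: "after_claim r (conv1 N h) (x1 - j) x2 + ?m x1 x2
      = (\<integral>\<^sup>+u. after_claim 0 h (x1 - u - j) x2 * indicator {..x1} u \<partial>N) + after_claim r ?m (x1 - j) x2"
    if j: "0 < j" for j
  proof (cases "0 \<le> x1 - j")
    case True
    have "(\<integral>\<^sup>+u. after_claim 0 h (x1 - u - j) x2 * indicator {..x1} u \<partial>N)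
        = (\<integral>\<^sup>+u. h (x1 - j - u) x2 * indicator {..x1 - j} u + h 0 x2 * indicator {x1 - j<..x1} u \<partial>N)"
      using j x by (intro nn_integral_cong) (auto simp: after_claim_def indicator_def algebra_simps)
    also have "\<dots> = conv1 N h (x1 - j) x2 + h 0 x2 * emeasure N {x1 - j<..x1}"
      by (subst nn_integral_add) (auto simp: conv1_def nn_integral_cmult)
    finally have "(\<integral>\<^sup>+u. after_claim 0 h (x1 - u - j) x2 * indicator {..x1} u \<partial>N) + after_claim r ?m (x1 - j) x2
        = conv1 N h (x1 - j) x2 + h 0 x2 * (emeasure N {x1 - j<..x1} + emeasure N {..x1 - j})"
      using True by (simp add: after_claim_def distrib_left mult.commute add.assoc)
    also have "emeasure N {x1 - j<..x1} + emeasure N {..x1 - j} = emeasure N {..x1}"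
      using j by (subst plus_emeasure) (auto intro!: arg_cong[where f="emeasure N"])
    finally show ?thesis
      using True by (simp add: after_claim_def mult.commute)
  next
    case False
    have "(\<integral>\<^sup>+u. after_claim 0 h (x1 - u - j) x2 * indicator {..x1} u \<partial>N)
        = (\<integral>\<^sup>+u. h 0 x2 * indicator {..x1} u \<partial>N)"
      using False x nonneg_N by (intro nn_integral_cong_AE) (auto simp: after_claim_def indicator_def)
    then show ?thesis
      using False by (simp add: after_claim_def conv1_0 nn_integral_cmult mult.commute add.commute)
  qed
  have "claim1 r (conv1 N h) x1 x2 + ?m x1 x2
      = (\<integral>\<^sup>+j. after_claim r (conv1 N h) (x1 - j) x2 + ?m x1 x2 \<partial>D1)"
    unfolding claim1_def by (subst nn_integral_add) (auto simp: D1.emeasure_space_1)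
  also have "\<dots> = (\<integral>\<^sup>+j. (\<integral>\<^sup>+u. after_claim 0 h (x1 - u - j) x2 * indicator {..x1} u \<partial>N)
      + after_claim r ?m (x1 - j) x2 \<partial>D1)"
    using D1_pos by (intro nn_integral_cong_AE) (auto simp: pt)
  also have "\<dots> = (\<integral>\<^sup>+j. \<integral>\<^sup>+u. after_claim 0 h (x1 - u - j) x2 * indicator {..x1} u \<partial>N \<partial>D1)
      + claim1 r ?m x1 x2"
    unfolding claim1_def by (subst nn_integral_add) auto
  also have "(\<integral>\<^sup>+j. \<integral>\<^sup>+u. after_claim 0 h (x1 - u - j) x2 * indicator {..x1} u \<partial>N \<partial>D1)
      = (\<integral>\<^sup>+u. \<integral>\<^sup>+j. after_claim 0 h (x1 - u - j) x2 * indicator {..x1} u \<partial>D1 \<partial>N)"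
    by (rule Fubini') measurable
  also have "\<dots> = conv1 N (claim1 0 h) x1 x2"
    unfolding conv1_def claim1_def by (simp add: nn_integral_multc)
  finally show ?thesis .
qed

text \<open>The boundary term created when the premium line enters the support of the measure after time 0.\<close>

definition entry1 :: "real measure \<Rightarrow> (real \<Rightarrow> ennreal) \<Rightarrow> real \<Rightarrow> real \<Rightarrow> ennreal" where
  "entry1 N g x1 x2 = (\<integral>\<^sup>+u. ennreal (exp (- l * ((u - x1) / c1))) * g (x2 + c2 * ((u - x1) / c1))
     * indicator {x1<..} u \<partial>N)"

lemma ray_conv1:
  assumes "nonneg_measure N" and h[measurable]: "measurable2 h"
  shows "ray (conv1 N h) x1 x2 = conv1 N (ray h) x1 x2 + entry1 N (ray h 0) x1 x2"
proof -
  interpret nonneg_measure N by fact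
  have pt: "expint l (\<lambda>t. h (x1 + c1 * t - u) (x2 + c2 * t) * indicator {..x1 + c1 * t} u)
      = ray h (x1 - u) x2 * indicator {..x1} u
        + ennreal (exp (- l * ((u - x1) / c1))) * ray h 0 (x2 + c2 * ((u - x1) / c1)) * indicator {x1<..} u" for u
  proof (cases "u \<le> x1")
    case True
    have "expint l (\<lambda>t. h (x1 + c1 * t - u) (x2 + c2 * t) * indicator {..x1 + c1 * t} u)
        = expint l (\<lambda>t. h (x1 - u + c1 * t) (x2 + c2 * t))"
    proof (intro expint_cong)
      fix t :: real assume "0 \<le> t"
      then have "0 \<le> c1 * t" using c_pos by simp
      then show "h (x1 + c1 * t - u) (x2 + c2 * t) * indicator {..x1 + c1 * t} u = h (x1 - u + c1 * t) (x2 + c2 * t)"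
        using True by (simp add: indicator_def algebra_simps)
    qed
    then show ?thesis using True by (simp add: ray_def)
  next
    case False
    define s where "s = (u - x1) / c1"
    have s: "0 \<le> s" "c1 * s = u - x1" using False c_pos by (auto simp: s_def)
    have "expint l (\<lambda>t. h (x1 + c1 * t - u) (x2 + c2 * t) * indicator {..x1 + c1 * t} u)
        = expint l (\<lambda>t. h (x1 + c1 * t - u) (x2 + c2 * t) * indicator {s..} t)"
      using c_pos by (intro expint_cong) (auto simp: s_def indicator_def field_simps)
    also have "\<dots> = ennreal (exp (- l * s)) * expint l (\<lambda>t. h (x1 + c1 * (s + t) - u) (x2 + c2 * (s + t)))"
      using s by (subst expint_shift) auto
    also have "expint l (\<lambda>t. h (x1 + c1 * (s + t) - u) (x2 + c2 * (s + t))) = ray h 0 (x2 + c2 * s)"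
      using s by (simp add: ray_def distrib_left add.assoc[symmetric])
    finally show ?thesis using False by (simp add: s_def)
  qed
  have "ray (conv1 N h) x1 x2
      = (\<integral>\<^sup>+u. expint l (\<lambda>t. h (x1 + c1 * t - u) (x2 + c2 * t) * indicator {..x1 + c1 * t} u) \<partial>N)"
    unfolding ray_def conv1_def by (subst expint_fubini) (auto intro: sigma_finite_measure_axioms)
  also have "\<dots> = conv1 N (ray h) x1 x2 + entry1 N (ray h 0) x1 x2"
    unfolding pt conv1_def entry1_def by (rule nn_integral_add) measurable
  finally show ?thesis .
qed

end

context coupled_risk
begin

lemma exp_first_entry:
  fixes N K :: "real measure"
  assumes N: "nonneg_measure N" and K: "nonneg_measure K"
    and atomless: "\<And>u. 0 < u \<Longrightarrow> emeasure N {u} = 0" and x: "0 \<le> x1" "0 \<le> x2"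
  shows "ennreal l * ray (\<lambda>x y. emeasure N {..x} * emeasure K {..y}) x1 x2
    = emeasure N {..x1} * emeasure K {..x2} + entry1 N (\<lambda>y. emeasure K {..y}) x1 x2
      + swapped.entry1 K (\<lambda>x. emeasure N {..x}) x2 x1"
proof -
  interpret N: nonneg_measure N by fact
  interpret K: nonneg_measure K by fact
  define tu where "tu u = (u - x1) / c1" for u
  define tv where "tv v = (v - x2) / c2" for v
  have [measurable]: "tu \<in> borel_measurable borel" "tv \<in> borel_measurable borel"
    unfolding tu_def[abs_def] tv_def[abs_def] by measurable
  have u_iff: "u \<le> x1 + c1 * t \<longleftrightarrow> tu u \<le> t" for u t
    using c_pos by (simp add: tu_def field_simps)
  have v_iff: "v \<le> x2 + c2 * t \<longleftrightarrow> tv v \<le> t" for v t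
    using c_pos by (simp add: tv_def field_simps)
  have m_eq: "emeasure N {..x} * emeasure K {..y} = (\<integral>\<^sup>+u. \<integral>\<^sup>+v. indicator {..x} u * indicator {..y} v \<partial>K \<partial>N)" for x y
    by (simp add: nn_integral_cmult nn_integral_multc)
  have "ray (\<lambda>x y. emeasure N {..x} * emeasure K {..y}) x1 x2
      = (\<integral>\<^sup>+u. \<integral>\<^sup>+v. expint l (\<lambda>t. indicator {..x1 + c1 * t} u * indicator {..x2 + c2 * t} v) \<partial>K \<partial>N)"
    unfolding ray_def m_eq
    by (simp add: expint_fubini N.sigma_finite_measure_axioms K.sigma_finite_measure_axioms)
  also have "\<dots> = (\<integral>\<^sup>+u. \<integral>\<^sup>+v. expint l (indicator {max (tu u) (tv v)..}) \<partial>K \<partial>N)"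
    by (intro nn_integral_cong expint_cong) (auto simp: indicator_def u_iff v_iff)
  finally have "ennreal l * ray (\<lambda>x y. emeasure N {..x} * emeasure K {..y}) x1 x2
      = (\<integral>\<^sup>+u. \<integral>\<^sup>+v. ennreal l * expint l (indicator {max (tu u) (tv v)..}) \<partial>K \<partial>N)"
    by (simp add: nn_integral_cmult)
  also have "\<dots> = (\<integral>\<^sup>+u. \<integral>\<^sup>+v. ennreal (exp (- l * max 0 (max (tu u) (tv v)))) \<partial>K \<partial>N)"
    by (simp add: expint_indicator_atLeast[OF lam_pos] del: minus_add_distrib)
  also have "\<dots> = (\<integral>\<^sup>+u. \<integral>\<^sup>+v. indicator {..x1} u * indicator {..x2} v
        + ennreal (exp (- l * tu u)) * indicator {..x2 + c2 * tu u} v * indicator {x1<..} u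
        + ennreal (exp (- l * tv v)) * indicator {..<x1 + c1 * tv v} u * indicator {x2<..} v \<partial>K \<partial>N)"
  proof (intro nn_integral_cong)
    fix u v
    have *: "u \<le> x1 \<longleftrightarrow> tu u \<le> 0" "v \<le> x2 \<longleftrightarrow> tv v \<le> 0" "x1 < u \<longleftrightarrow> 0 < tu u" "x2 < v \<longleftrightarrow> 0 < tv v"
      "u < x1 + c1 * t \<longleftrightarrow> tu u < t" for t
      using c_pos by (auto simp: tu_def tv_def field_simps)
    show "ennreal (exp (- l * max 0 (max (tu u) (tv v)))) = indicator {..x1} u * indicator {..x2} v
        + ennreal (exp (- l * tu u)) * indicator {..x2 + c2 * tu u} v * indicator {x1<..} u
        + ennreal (exp (- l * tv v)) * indicator {..<x1 + c1 * tv v} u * indicator {x2<..} v"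
      by (auto simp: indicator_def * v_iff max_def)
  qed
  also have "\<dots> = emeasure N {..x1} * emeasure K {..x2}
      + (\<integral>\<^sup>+u. \<integral>\<^sup>+v. ennreal (exp (- l * tu u)) * indicator {..x2 + c2 * tu u} v * indicator {x1<..} u \<partial>K \<partial>N)
      + (\<integral>\<^sup>+u. \<integral>\<^sup>+v. ennreal (exp (- l * tv v)) * indicator {..<x1 + c1 * tv v} u * indicator {x2<..} v \<partial>K \<partial>N)"
    by (simp add: nn_integral_add m_eq)
  also have "(\<integral>\<^sup>+u. \<integral>\<^sup>+v. ennreal (exp (- l * tu u)) * indicator {..x2 + c2 * tu u} v * indicator {x1<..} u \<partial>K \<partial>N)
      = entry1 N (\<lambda>y. emeasure K {..y}) x1 x2"
    unfolding entry1_def tu_def by (simp add: nn_integral_cmult nn_integral_multc)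
  also have "(\<integral>\<^sup>+u. \<integral>\<^sup>+v. ennreal (exp (- l * tv v)) * indicator {..<x1 + c1 * tv v} u * indicator {x2<..} v \<partial>K \<partial>N)
      = (\<integral>\<^sup>+v. \<integral>\<^sup>+u. ennreal (exp (- l * tv v)) * indicator {..<x1 + c1 * tv v} u * indicator {x2<..} v \<partial>N \<partial>K)"
  proof -
    interpret pair_sigma_finite N K ..
    show ?thesis by (rule Fubini'[symmetric]) measurable
  qed
  also have "\<dots> = (\<integral>\<^sup>+v. ennreal (exp (- l * tv v)) * emeasure N {..<x1 + c1 * tv v} * indicator {x2<..} v \<partial>K)"
    by (simp add: nn_integral_cmult nn_integral_multc)
  also have "\<dots> = (\<integral>\<^sup>+v. ennreal (exp (- l * tv v)) * emeasure N {..x1 + c1 * tv v} * indicator {x2<..} v \<partial>K)"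
  proof (intro nn_integral_cong)
    fix v
    show "ennreal (exp (- l * tv v)) * emeasure N {..<x1 + c1 * tv v} * indicator {x2<..} v
      = ennreal (exp (- l * tv v)) * emeasure N {..x1 + c1 * tv v} * indicator {x2<..} v"
    proof (cases "x2 < v")
      case True
      then have "0 < x1 + c1 * tv v" using x c_pos by (simp add: tv_def add_nonneg_pos)
      then have "emeasure N {..<x1 + c1 * tv v} + emeasure N {x1 + c1 * tv v} = emeasure N {..<x1 + c1 * tv v}"
        using atomless by simp
      then have "emeasure N {..x1 + c1 * tv v} = emeasure N {..<x1 + c1 * tv v}"
        by (subst (asm) plus_emeasure) (auto simp: ivl_disj_un_singleton(2)[symmetric])
      then show ?thesis by simp
    qed simp
  qed
  also have "\<dots> = swapped.entry1 K (\<lambda>x. emeasure N {..x}) x2 x1"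
    unfolding swapped.entry1_def tv_def by (simp add: add.commute)
  finally show ?thesis .
qed

lemma jump_conv1:
  assumes N: "nonneg_measure N" and h[measurable]: "measurable2 h" and r: "0 \<le> r1" "0 \<le> r2"
    and x: "0 \<le> x1" "0 \<le> x2"
  shows "jump r1 r2 (conv1 N h) x1 x2 + ennreal l1 * (emeasure N {..x1} * h 0 x2)
    = conv1 N (jump 0 r2 h) x1 x2 + ennreal l1 * claim1 r1 (\<lambda>x y. emeasure N {..x} * h 0 y) x1 x2"
proof -
  interpret nonneg_measure N by fact
  have c2: "claim2 r2 (conv1 N h) x1 x2 = conv1 N (claim2 r2 h) x1 x2"
    using swapped.claim1_conv2[OF N measurable2_swap[OF h] r(2), of x2 x1]
    by (simp add: claim2_def[abs_def] swapped.claim1_def[abs_def] conv2_def[abs_def])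
  have "conv1 N (jump 0 r2 h) x1 x2 = ennreal l1 * conv1 N (claim1 0 h) x1 x2 + ennreal l2 * conv1 N (claim2 r2 h) x1 x2"
    unfolding conv1_def jump_def
    by (simp add: nn_integral_add nn_integral_cmult distrib_right mult.assoc)
  moreover have "ennreal l1 * claim1 r1 (conv1 N h) x1 x2 + ennreal l1 * (emeasure N {..x1} * h 0 x2)
      = ennreal l1 * conv1 N (claim1 0 h) x1 x2 + ennreal l1 * claim1 r1 (\<lambda>x y. emeasure N {..x} * h 0 y) x1 x2"
    using claim1_conv1[OF N h r(1) x] by (simp only: distrib_left[symmetric])
  ultimately show ?thesis
    unfolding jump_def c2 by (simp only: add.assoc add.left_commute[of _ "ennreal l2 * _"] add.commute[of _ "ennreal l2 * _"])
qed

end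

context coupled_risk
begin

lemma jump_conv2:
  assumes N: "nonneg_measure N" and h[measurable]: "measurable2 h" and r: "0 \<le> r1" "0 \<le> r2"
    and x: "0 \<le> x1" "0 \<le> x2"
  shows "jump r1 r2 (conv2 N h) x1 x2 + ennreal l2 * (h x1 0 * emeasure N {..x2})
    = conv2 N (jump r1 0 h) x1 x2 + ennreal l2 * claim2 r2 (\<lambda>x y. h x 0 * emeasure N {..y}) x1 x2"
proof -
  have 1: "swapped.jump r2 r1 (conv1 N (\<lambda>x y. h y x)) x2 x1 = jump r1 r2 (conv2 N h) x1 x2"
    using swapped_jump[of r2 r1 "conv2 N h" x2 x1] by (simp add: conv2_def)
  have "swapped.jump 0 r1 (\<lambda>x y. h y x) = (\<lambda>x y. jump r1 0 h y x)"
    by (intro ext swapped_jump)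
  then have 2: "conv1 N (swapped.jump 0 r1 (\<lambda>x y. h y x)) x2 x1 = conv2 N (jump r1 0 h) x1 x2"
    by (simp add: conv2_def)
  have 3: "swapped.claim1 r2 (\<lambda>x y. emeasure N {..x} * h y 0) x2 x1
      = claim2 r2 (\<lambda>x y. h x 0 * emeasure N {..y}) x1 x2"
    by (simp add: claim2_swap mult.commute)
  show ?thesis
    using swapped.jump_conv1[OF N measurable2_swap[OF h] r(2,1) x(2,1)]
    unfolding 1 2 3 by (simp add: mult.commute)
qed

lemma entry1_finite:
  assumes "nonneg_measure N" and "\<And>y. g y \<le> a" "a < \<infinity>"
  shows "entry1 N g x1 x2 < \<infinity>"
proof -
  interpret nonneg_measure N by fact
  have "entry1 N g x1 x2 \<le> (\<integral>\<^sup>+u. a \<partial>N)"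
    unfolding entry1_def
  proof (intro nn_integral_mono)
    fix u
    have "ennreal (exp (- l * ((u - x1) / c1))) * g (x2 + c2 * ((u - x1) / c1)) \<le> 1 * a" if "x1 < u"
    proof (intro mult_mono assms(2))
      have "- l * ((u - x1) / c1) \<le> 0"
        using that c_pos l_pos by (intro mult_nonpos_nonneg divide_nonneg_pos) auto
      then show "ennreal (exp (- l * ((u - x1) / c1))) \<le> 1"
        by (simp only: exp_le_one_iff ennreal_le_1)
    qed auto
    then show "ennreal (exp (- l * ((u - x1) / c1))) * g (x2 + c2 * ((u - x1) / c1)) * indicator {x1<..} u \<le> a"
      by (auto simp: indicator_def)
  qed
  also have "\<dots> < \<infinity>"
  proof -
    have "emeasure N UNIV < \<top>" by (simp add: less_top[symmetric])
    then show ?thesis using assms(3) by (simp add: ennreal_mult_less_top)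
  qed
  finally show ?thesis .
qed

end

context coupled_risk
begin

lemma step_conv_sum:
  fixes N K :: "real measure"
  assumes N: "nonneg_measure N" and K: "nonneg_measure K" and r: "0 \<le> r1" "0 \<le> r2"
    and cdfN: "\<And>x. 0 \<le> x \<Longrightarrow> emeasure N {..x} = surv r1 0 x 0"
    and cdfK: "\<And>y. 0 \<le> y \<Longrightarrow> emeasure K {..y} = surv 0 r2 0 y"
    and atomless: "\<And>u. 0 < u \<Longrightarrow> emeasure N {u} = 0" and x: "0 \<le> x1" "0 \<le> x2"
  defines "P \<equiv> \<lambda>x y. conv1 N (surv 0 r2) x y + conv2 K (surv r1 0) x y"
    and "m \<equiv> \<lambda>x y. emeasure N {..x} * emeasure K {..y}"
  shows "step r1 r2 P x1 x2 + m x1 x2 = P x1 x2 + step r1 r2 m x1 x2"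
proof -
  interpret N: nonneg_measure N by fact
  interpret K: nonneg_measure K by fact
  have ms[measurable]: "measurable2 (surv 0 r2)" "measurable2 (surv r1 0)" by measurable
  have mm[measurable]: "measurable2 m" unfolding m_def by measurable
  have mP[measurable]: "measurable2 P" unfolding P_def by measurable
  have mj[measurable]: "measurable2 (jump 0 r2 (surv 0 r2))" "measurable2 (jump r1 0 (surv r1 0))"
    by measurable
  have jump_eq: "jump r1 r2 P x y + ennreal l * m x y
      = conv1 N (jump 0 r2 (surv 0 r2)) x y + conv2 K (jump r1 0 (surv r1 0)) x y + jump r1 r2 m x y"
    if xy: "0 \<le> x" "0 \<le> y" for x y
  proof -
    have sum_eq: "a + b + (p + q) = A + B + (p' + q')"
      if "a + p = A + p'" "b + q = B + q'" for a b p q A B p' q' :: ennreal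
    proof -
      have "a + b + (p + q) = (a + p) + (b + q)" by (simp only: ac_simps)
      also have "\<dots> = A + B + (p' + q')" unfolding that by (simp only: ac_simps)
      finally show ?thesis .
    qed
    have m1: "claim1 r1 (\<lambda>x y. emeasure N {..x} * surv 0 r2 0 y) x y = claim1 r1 m x y"
      unfolding claim1_def m_def using xy
      by (intro nn_integral_cong after_claim_cong) (auto simp: cdfK)
    have m2: "claim2 r2 (\<lambda>x y. surv r1 0 x 0 * emeasure K {..y}) x y = claim2 r2 m x y"
      unfolding claim2_def m_def using xy
      by (intro nn_integral_cong after_claim_cong) (auto simp: cdfN)
    have m3: "emeasure N {..x} * surv 0 r2 0 y = m x y" "surv r1 0 x 0 * emeasure K {..y} = m x y"
      unfolding m_def using xy by (simp_all add: cdfN cdfK)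
    have "jump r1 r2 P x y = jump r1 r2 (conv1 N (surv 0 r2)) x y + jump r1 r2 (conv2 K (surv r1 0)) x y"
      unfolding P_def by (rule jump_add) measurable
    moreover have "ennreal l * m x y = ennreal l1 * m x y + ennreal l2 * m x y"
      using l_pos by (simp add: distrib_right)
    ultimately show ?thesis
      using sum_eq[OF jump_conv1[OF N ms(1) r xy] jump_conv2[OF K ms(2) r xy]]
      unfolding jump_def[of r1 r2 m] m1 m2 m3 by (simp only:)
  qed
  let ?E1 = "entry1 N (\<lambda>y. emeasure K {..y}) x1 x2"
  let ?E2 = "swapped.entry1 K (\<lambda>x. emeasure N {..x}) x2 x1"
  have ray_surv: "ray (jump r1 r2 (surv r1 r2)) = surv r1 r2" for r1 r2
    by (intro ext surv_eq_ray[symmetric])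
  have 1: "ray (conv1 N (jump 0 r2 (surv 0 r2))) x1 x2 = conv1 N (surv 0 r2) x1 x2 + ?E1"
  proof -
    have "entry1 N (surv 0 r2 0) x1 x2 = ?E1"
      unfolding entry1_def using x c_pos
      by (intro nn_integral_cong) (auto simp: indicator_def cdfK)
    then show ?thesis using ray_conv1[OF N mj(1), of x1 x2] by (simp add: ray_surv)
  qed
  have 2: "ray (conv2 K (jump r1 0 (surv r1 0))) x1 x2 = conv2 K (surv r1 0) x1 x2 + ?E2"
  proof -
    have e: "swapped.entry1 K (\<lambda>x. surv r1 0 x 0) x2 x1 = ?E2"
      unfolding swapped.entry1_def using x c_pos
      by (intro nn_integral_cong) (auto simp: indicator_def cdfN)
    have s: "swapped.ray (\<lambda>x y. jump r1 0 (surv r1 0) y x) = (\<lambda>x y. surv r1 0 y x)"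
      by (intro ext) (simp add: swapped_ray ray_surv)
    have "conv2 K (jump r1 0 (surv r1 0)) = (\<lambda>x y. conv1 K (\<lambda>x y. jump r1 0 (surv r1 0) y x) y x)"
      by (intro ext conv2_def)
    then have "ray (conv2 K (jump r1 0 (surv r1 0))) x1 x2
        = swapped.ray (conv1 K (\<lambda>x y. jump r1 0 (surv r1 0) y x)) x2 x1"
      using swapped_ray[of "\<lambda>x y. conv1 K (\<lambda>x y. jump r1 0 (surv r1 0) y x) y x" x2 x1] by (simp only:)
    then show ?thesis
      using swapped.ray_conv1[OF K measurable2_swap[OF mj(2)], of x2 x1] by (simp add: s e conv2_def)
  qed
  have "step r1 r2 P x1 x2 + ennreal l * ray m x1 x2 = ray (\<lambda>x y. jump r1 r2 P x y + ennreal l * m x y) x1 x2"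
    unfolding step_def by (subst ray_add) (auto simp: ray_cmult measurable2_jump)
  also have "\<dots> = ray (\<lambda>x y. conv1 N (jump 0 r2 (surv 0 r2)) x y + conv2 K (jump r1 0 (surv r1 0)) x y
      + jump r1 r2 m x y) x1 x2"
    using x by (intro antisym ray_mono) (simp_all only: jump_eq order_refl)
  also have "\<dots> = conv1 N (surv 0 r2) x1 x2 + ?E1 + (conv2 K (surv r1 0) x1 x2 + ?E2) + step r1 r2 m x1 x2"
    unfolding step_def by (subst ray_add, measurable, subst ray_add, measurable) (simp add: 1 2)
  also have "\<dots> = P x1 x2 + step r1 r2 m x1 x2 + (?E1 + ?E2)"
    unfolding P_def by (simp only: ac_simps)
  finally have "step r1 r2 P x1 x2 + ennreal l * ray m x1 x2 = P x1 x2 + step r1 r2 m x1 x2 + (?E1 + ?E2)" .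
  moreover have "ennreal l * ray m x1 x2 = m x1 x2 + (?E1 + ?E2)"
    unfolding m_def using exp_first_entry[OF N K atomless x] by (simp add: add.assoc)
  ultimately have "(?E1 + ?E2) + (step r1 r2 P x1 x2 + m x1 x2) = (?E1 + ?E2) + (P x1 x2 + step r1 r2 m x1 x2)"
    by (simp only: ac_simps)
  moreover have "?E1 < \<infinity>"
    by (rule entry1_finite[OF N, where a="emeasure K UNIV"])
       (auto intro!: emeasure_mono simp: less_top[symmetric])
  moreover have "?E2 < \<infinity>"
    by (rule swapped.entry1_finite[OF K, where a="emeasure N UNIV"])
       (auto intro!: emeasure_mono simp: less_top[symmetric])
  ultimately show ?thesis
    by (simp only: ennreal_add_left_cancel) auto
qed

end

section \<open>Uniqueness of fixed points\<close>

lemma (in prob_space) AE_eq_1_of_nn_integral: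
  assumes [measurable]: "f \<in> borel_measurable M" and le: "\<And>x. f x \<le> 1"
    and "(\<integral>\<^sup>+x. f x \<partial>M) = 1"
  shows "AE x in M. f x = (1::ennreal)"
proof -
  have "(\<integral>\<^sup>+x. (1 - f x) + f x \<partial>M) = (\<integral>\<^sup>+x. 1 \<partial>M)"
    by (intro nn_integral_cong) (simp add: diff_add_cancel_ennreal le)
  then have "(\<integral>\<^sup>+x. (1 - f x) \<partial>M) + 1 = 1"
    using assms(3) by (subst (asm) nn_integral_add) (auto simp: emeasure_space_1)
  then have "(\<integral>\<^sup>+x. (1 - f x) \<partial>M) = 0"
    using ennreal_add_left_cancel[of 1 "\<integral>\<^sup>+x. (1 - f x) \<partial>M" 0] by (simp add: add.commute)
  then have "AE x in M. 1 - f x = 0"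
    by (subst (asm) nn_integral_0_iff_AE) auto
  then show ?thesis
    by eventually_elim (rule antisym[OF le ennreal_minus_eq_0])
qed

lemma AE_and_not_AE_not:
  assumes "AE x in M. P x" "\<not> (AE x in M. \<not> Q x)"
  shows "\<exists>x. P x \<and> Q x"
proof (rule ccontr)
  assume "\<nexists>x. P x \<and> Q x"
  then have "\<not> Q x" if "P x" for x using that by blast
  with assms(1) have "AE x in M. \<not> Q x" by (rule eventually_mono)
  with assms(2) show False by contradiction
qed

context coupled_risk
begin

lemma jump_surv_le: "jump r1 r2 (surv r1' r2') x y \<le> ennreal l"
proof -
  have "jump r1 r2 (surv r1' r2') x y \<le> jump r1 r2 (\<lambda>_ _. 1) x y"
    unfolding jump_def claim1_def claim2_def
    by (intro add_mono mult_left_mono nn_integral_mono after_claim_le_fun) (auto simp: le_fun_def surv_le_1)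
  then show ?thesis using jump_1_le order_trans by blast
qed

lemma claim_surv_le_1: "claim1 r (surv r1 r2) x y \<le> 1" "claim2 r (surv r1 r2) x y \<le> 1"
proof -
  have "claim1 r (surv r1 r2) x y \<le> (\<integral>\<^sup>+j. 1 \<partial>D1)" "claim2 r (surv r1 r2) x y \<le> (\<integral>\<^sup>+j. 1 \<partial>D2)"
    unfolding claim1_def claim2_def
    by (intro nn_integral_mono; simp add: after_claim_def surv_le_1)+
  then show "claim1 r (surv r1 r2) x y \<le> 1" "claim2 r (surv r1 r2) x y \<le> 1"
    by (simp_all add: D1.emeasure_space_1 D2.emeasure_space_1)
qed

lemma claim1_size: "\<exists>\<theta>>0. 0 < emeasure D1 {\<theta>..}"
proof (rule ccontr)
  assume "\<not> ?thesis"
  then have "emeasure D1 {\<theta>..} = 0" if "0 < \<theta>" for \<theta>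
    using that by (auto simp: zero_less_iff_neq_zero)
  then have "emeasure D1 {1 / real (Suc n)..} = 0" for n
    by simp
  then have "AE j in D1. j \<notin> {1 / real (Suc n)..}" for n
    by (intro AE_not_in) (auto simp: null_sets_def)
  then have "AE j in D1. \<forall>n. j \<notin> {1 / real (Suc n)..}"
    by (simp add: AE_all_countable)
  with D1_pos have "AE j in D1. False"
  proof eventually_elim
    case (elim j)
    then obtain n where "1 / real (Suc n) < j"
      using reals_Archimedean[of j] by (auto simp: inverse_eq_divide)
    moreover have "j < 1 / real (Suc n)" using elim(2) by (simp add: not_le)
    ultimately show False by simp
  qed
  then show False using D1.not_empty by (auto simp: D1.AE_False)
qed

lemma surv_eq_1_descend:
  assumes s: "surv r1 r2 x y = 1" and \<theta>: "0 < emeasure D1 {\<theta>..}" and \<delta>: "0 < \<delta>"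
  shows "\<exists>t j. 0 \<le> t \<and> t \<le> \<delta> \<and> \<theta> \<le> j \<and> after_claim r1 (surv r1 r2) (x + c1 * t - j) (y + c2 * t) = 1"
proof -
  define g where "g t = jump r1 r2 (surv r1 r2) (x + c1 * t) (y + c2 * t)" for t
  have [measurable]: "g \<in> borel_measurable borel" unfolding g_def[abs_def] by measurable
  have "expint l (\<lambda>t. (ennreal l - g t) + g t) = expint l (\<lambda>t. ennreal l * 1)"
    by (rule expint_cong) (simp add: diff_add_cancel_ennreal g_def jump_surv_le)
  also have "\<dots> = 1"
    by (subst expint_cmult) (auto simp: expint_one[OF lam_pos, simplified])
  finally have "expint l (\<lambda>t. ennreal l - g t) + expint l g = 1"
    by (subst (asm) expint_add) auto
  moreover have "expint l g = 1"
    using s surv_eq_ray[of r1 r2 x y] by (simp add: ray_def g_def[abs_def])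
  ultimately have "expint l (\<lambda>t. ennreal l - g t) = 0"
    using ennreal_add_left_cancel[of 1 "expint l (\<lambda>t. ennreal l - g t)" 0] by (simp add: add.commute)
  then have "AE t in lborel. ennreal (exp (- l * t)) * (ennreal l - g t) * indicator {0..} t = 0"
    unfolding expint_def by (subst (asm) nn_integral_0_iff_AE) auto
  then have "AE t in lborel. 0 \<le> t \<longrightarrow> g t = ennreal l"
  proof eventually_elim
    case (elim t)
    show ?case
    proof
      assume "0 \<le> t"
      then have "ennreal l - g t = 0" using elim by simp
      then have "ennreal l \<le> g t" by (rule ennreal_minus_eq_0)
      moreover have "g t \<le> ennreal l" unfolding g_def by (rule jump_surv_le)
      ultimately show "g t = ennreal l" by simp
    qed
  qed
  moreover have "\<not> (AE t in lborel. t \<notin> {0..\<delta>})"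
  proof
    assume "AE t in lborel. t \<notin> {0..\<delta>}"
    then have "emeasure lborel {0..\<delta>} = 0"
      by (subst (asm) AE_iff_measurable[of "{0..\<delta>}"]) auto
    then show False using \<delta> by simp
  qed
  ultimately have "\<exists>t. (0 \<le> t \<longrightarrow> g t = ennreal l) \<and> t \<in> {0..\<delta>}"
    by (rule AE_and_not_AE_not)
  then obtain t where t: "0 \<le> t" "t \<le> \<delta>" "g t = ennreal l"
    by auto
  let ?c1 = "claim1 r1 (surv r1 r2) (x + c1 * t) (y + c2 * t)"
  have "?c1 = 1"
  proof (rule ccontr)
    assume "?c1 \<noteq> 1"
    then have "?c1 < 1" using claim_surv_le_1(1)[of r1 r1 r2] by (simp add: less_le)
    then have "ennreal l1 * ?c1 < ennreal l1 * 1"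
      using l_pos by (intro ennreal_mult_strict_left_mono) auto
    moreover have "ennreal l2 * claim2 r2 (surv r1 r2) (x + c1 * t) (y + c2 * t) \<le> ennreal l2 * 1"
      by (intro mult_left_mono claim_surv_le_1) auto
    ultimately have "g t < ennreal l2 * 1 + ennreal l1 * 1"
      unfolding g_def jump_def
      by (subst add.commute) (rule order.strict_trans1[OF add_right_mono], auto simp: ennreal_add_left_cancel_less)
    then show False using t l_pos by simp
  qed
  then have "AE j in D1. after_claim r1 (surv r1 r2) (x + c1 * t - j) (y + c2 * t) = 1"
    unfolding claim1_def by (intro D1.AE_eq_1_of_nn_integral) (auto simp: after_claim_def surv_le_1)
  moreover have "\<not> (AE j in D1. j \<notin> {\<theta>..})"
  proof
    assume "AE j in D1. j \<notin> {\<theta>..}"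
    then have "emeasure D1 {\<theta>..} = 0"
      by (subst (asm) AE_iff_measurable[of "{\<theta>..}"]) (auto simp: sets_eq_imp_space_eq[OF sets_D1])
    then show False using \<theta> by simp
  qed
  ultimately have "\<exists>j. after_claim r1 (surv r1 r2) (x + c1 * t - j) (y + c2 * t) = 1 \<and> j \<in> {\<theta>..}"
    by (rule AE_and_not_AE_not)
  with t show ?thesis by auto
qed

lemma surv_less_1:
  assumes r1: "0 < r1" and x: "0 \<le> x" "0 \<le> y"
  shows "surv r1 r2 x y < 1"
proof (rule ccontr)
  assume "\<not> surv r1 r2 x y < 1"
  then have s: "surv r1 r2 x y = 1" using surv_le_1[of r1 r2 x y] by (simp add: less_le)
  obtain \<theta> where \<theta>: "0 < \<theta>" "0 < emeasure D1 {\<theta>..}" using claim1_size by blast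
  define a b where "a = (if r1 = \<infinity> then 1 else real_of_ereal r1)"
    and "b = (if r1 = \<infinity> then 0 else 1 :: real)"
  have a: "0 < a"
    using r1 by (cases r1) (auto simp: a_def)
  have b: "0 \<le> b" by (simp add: b_def)
  \<comment> \<open>A quick claim of company 1 lowers this potential by a fixed amount, wherever the deficit is booked.\<close>
  define pot where "pot x y = a * x + b * y" for x y
  define \<delta> where "\<delta> = a * \<theta> / (2 * (a * c1 + b * c2))"
  have den: "0 < a * c1 + b * c2" using a b c_pos by (simp add: add_pos_nonneg)
  have \<delta>: "0 < \<delta>" using a \<theta> den by (simp add: \<delta>_def)
  have step: "\<exists>x' y'. 0 \<le> x' \<and> 0 \<le> y' \<and> surv r1 r2 x' y' = 1 \<and> pot x' y' \<le> pot x y - a * \<theta> / 2"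
    if xy: "0 \<le> x" "0 \<le> y" "surv r1 r2 x y = 1" for x y
  proof -
    obtain t j where tj: "0 \<le> t" "t \<le> \<delta>" "\<theta> \<le> j"
      and ac: "after_claim r1 (surv r1 r2) (x + c1 * t - j) (y + c2 * t) = 1"
      using surv_eq_1_descend[OF xy(3) \<theta>(2) \<delta>] by blast
    have "(a * c1 + b * c2) * t \<le> (a * c1 + b * c2) * \<delta>"
      using tj den by (intro mult_left_mono) auto
    also have "\<dots> = a * \<theta> / 2"
    proof -
      have "D * (e / (2 * D)) = e / 2" if "0 < D" for D e :: real using that by simp
      then show ?thesis unfolding \<delta>_def using den by blast
    qed
    finally have drift: "(a * c1 + b * c2) * t \<le> a * \<theta> / 2" .
    have aj: "a * \<theta> \<le> a * j" using tj a by simp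
    let ?y1 = "x + c1 * t - j" and ?y2 = "y + c2 * t"
    have pot1: "a * ?y1 + b * ?y2 \<le> pot x y - a * \<theta> / 2"
      using drift aj by (simp add: pot_def algebra_simps)
    have y2: "0 \<le> ?y2" using xy tj c_pos by simp
    show ?thesis
    proof (cases "0 \<le> ?y1")
      case True
      then have "surv r1 r2 ?y1 ?y2 = 1" using ac by (simp add: after_claim_def)
      then show ?thesis
        using True y2 pot1 by (intro exI[of _ ?y1] exI[of _ ?y2]) (simp add: pot_def)
    next
      case False
      then have fin: "r1 \<noteq> \<infinity>" and z: "0 \<le> ?y2 + real_of_ereal r1 * ?y1"
        and s: "surv r1 r2 0 (?y2 + real_of_ereal r1 * ?y1) = 1"
        using ac by (auto simp: after_claim_def split: if_splits)
      have "pot 0 (?y2 + real_of_ereal r1 * ?y1) = a * ?y1 + b * ?y2"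
        using fin by (simp add: pot_def a_def b_def)
      then show ?thesis
        using z s pot1 by (intro exI[of _ 0] exI[of _ "?y2 + real_of_ereal r1 * ?y1"]) simp
    qed
  qed
  have "\<exists>x' y'. 0 \<le> x' \<and> 0 \<le> y' \<and> surv r1 r2 x' y' = 1 \<and> pot x' y' \<le> pot x y - real n * (a * \<theta> / 2)" for n
  proof (induction n)
    case 0
    then show ?case using s x by auto
  next
    case (Suc n)
    then obtain x' y' where "0 \<le> x'" "0 \<le> y'" "surv r1 r2 x' y' = 1" "pot x' y' \<le> pot x y - real n * (a * \<theta> / 2)"
      by blast
    moreover from step[OF this(1-3)] obtain x'' y'' where "0 \<le> x''" "0 \<le> y''" "surv r1 r2 x'' y'' = 1"
      "pot x'' y'' \<le> pot x' y' - a * \<theta> / 2" by blast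
    ultimately have "0 \<le> x'' \<and> 0 \<le> y'' \<and> surv r1 r2 x'' y'' = 1 \<and> pot x'' y'' \<le> pot x y - real (Suc n) * (a * \<theta> / 2)"
      by (simp add: distrib_right add_divide_distrib)
    then show ?case by blast
  qed
  moreover obtain n where "pot x y < real n * (a * \<theta> / 2)"
    using reals_Archimedean3[of "a * \<theta> / 2"] a \<theta> by auto
  ultimately obtain x' y' where xy': "0 \<le> x'" "0 \<le> y'" "pot x' y' \<le> pot x y - real n * (a * \<theta> / 2)"
    and n: "pot x y < real n * (a * \<theta> / 2)"
    by blast
  have "0 \<le> pot x' y'" using xy'(1,2) a b by (simp add: pot_def)
  then show False using xy'(3) n by linarith
qed

lemma surv_upto_less_1:
  assumes "0 < r1" "0 \<le> x" "0 \<le> y"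
  shows "\<exists>n. surv_upto r1 r2 n x y < 1"
  using surv_less_1[OF assms, of r2] by (auto simp: surv_def INF_less_iff)

lemma claim2_zero_rate:
  assumes "\<And>y. 0 \<le> y \<Longrightarrow> h x y = k" "0 \<le> x"
  shows "claim2 0 h x y = k"
proof -
  have "claim2 0 h x y = (\<integral>\<^sup>+j. k \<partial>D2)"
    unfolding claim2_def using assms by (intro nn_integral_cong) (auto simp: after_claim_def)
  then show ?thesis by (simp add: D2.emeasure_space_1)
qed

lemma surv_upto_inf_0_indep:
  assumes "0 \<le> x" "0 \<le> y"
  shows "surv_upto \<infinity> 0 n x y = surv_upto \<infinity> 0 n x 0"
  using assms
proof (induction n arbitrary: x y)
  case (Suc n)
  have "jump \<infinity> 0 (surv_upto \<infinity> 0 n) x y = jump \<infinity> 0 (surv_upto \<infinity> 0 n) x y'"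
    if "0 \<le> x" "0 \<le> y" "0 \<le> y'" for x y y'
  proof -
    have "claim2 0 (surv_upto \<infinity> 0 n) x z = surv_upto \<infinity> 0 n x 0" for z
    proof (rule claim2_zero_rate)
      show "surv_upto \<infinity> 0 n x y = surv_upto \<infinity> 0 n x 0" if "0 \<le> y" for y
        using \<open>0 \<le> x\<close> that by (rule Suc.IH)
    qed (rule that)
    moreover have "claim1 \<infinity> (surv_upto \<infinity> 0 n) x y = claim1 \<infinity> (surv_upto \<infinity> 0 n) x y'"
      unfolding claim1_def
    proof (intro nn_integral_cong)
      fix j
      have "surv_upto \<infinity> 0 n (x - j) y = surv_upto \<infinity> 0 n (x - j) y'" if "0 \<le> x - j"
        by (rule trans[OF Suc.IH[OF that \<open>0 \<le> y\<close>] Suc.IH[OF that \<open>0 \<le> y'\<close>, symmetric]])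
      then show "after_claim \<infinity> (surv_upto \<infinity> 0 n) (x - j) y = after_claim \<infinity> (surv_upto \<infinity> 0 n) (x - j) y'"
        unfolding after_claim_def by presburger
    qed
    ultimately show ?thesis by (simp add: jump_def)
  qed
  note jump_eq = this
  show ?case
    unfolding surv_upto_Suc step_def ray_def
    by (intro expint_cong jump_eq) (use Suc.prems c_pos in auto)
qed (simp add: surv_upto_0)

lemma surv_inf_0_indep:
  assumes "0 \<le> x" "0 \<le> y"
  shows "surv \<infinity> 0 x y = surv \<infinity> 0 x 0"
  by (simp add: surv_def surv_upto_inf_0_indep[OF assms])

definition near_ruin :: "ereal \<Rightarrow> real \<Rightarrow> real \<Rightarrow> real \<Rightarrow> bool" where
  "near_ruin r1 R x y \<longleftrightarrow> x \<le> R \<and> (r1 = \<infinity> \<or> y \<le> R)"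

lemma near_ruin_contraction:
  assumes r: "0 < r1" "0 \<le> r2"
  shows "\<exists>n. \<exists>k<1. \<forall>x y. 0 \<le> x \<longrightarrow> 0 \<le> y \<longrightarrow> near_ruin r1 R x y \<longrightarrow> surv_upto r1 r2 n x y \<le> k"
proof (cases "r1 = \<infinity>")
  case True
  obtain n where n: "surv_upto \<infinity> 0 n (max 0 R) 0 < 1"
    using surv_upto_less_1[of \<infinity> "max 0 R" 0 0] by auto
  have "surv_upto r1 r2 n x y \<le> surv_upto \<infinity> 0 n (max 0 R) 0"
    if "0 \<le> x" "0 \<le> y" "near_ruin r1 R x y" for x y
  proof -
    have "surv_upto r1 r2 n x y \<le> surv_upto \<infinity> 0 n x y"
      using that r True by (intro surv_upto_rate_antimono) auto
    also have "\<dots> = surv_upto \<infinity> 0 n x 0" using that(1,2) by (rule surv_upto_inf_0_indep)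
    also have "\<dots> \<le> surv_upto \<infinity> 0 n (max 0 R) 0"
      using that by (intro mono_quadrantD[OF mono_quadrant_surv_upto]) (auto simp: near_ruin_def)
    finally show ?thesis .
  qed
  with n show ?thesis by blast
next
  case False
  obtain n where n: "surv_upto r1 r2 n (max 0 R) (max 0 R) < 1"
    using surv_upto_less_1[OF r(1), of "max 0 R" "max 0 R" r2] by auto
  have "surv_upto r1 r2 n x y \<le> surv_upto r1 r2 n (max 0 R) (max 0 R)"
    if "0 \<le> x" "0 \<le> y" "near_ruin r1 R x y" for x y
    using that r False by (intro mono_quadrantD[OF mono_quadrant_surv_upto]) (auto simp: near_ruin_def)
  with n show ?thesis by blast
qed

lemma step_fixpoint_unique:
  assumes [measurable]: "measurable2 p" and r: "0 < r1" "0 \<le> r2"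
    and fp: "\<And>x y. 0 \<le> x \<Longrightarrow> 0 \<le> y \<Longrightarrow> step r1 r2 p x y = p x y"
    and bounded: "\<And>x y. 0 \<le> x \<Longrightarrow> 0 \<le> y \<Longrightarrow> p x y \<le> B" "B < \<infinity>"
    and far: "\<And>\<epsilon>::real. 0 < \<epsilon> \<Longrightarrow> \<exists>R. \<forall>x y. 0 \<le> x \<longrightarrow> 0 \<le> y \<longrightarrow> \<not> near_ruin r1 R x y \<longrightarrow>
      p x y \<le> surv r1 r2 x y + ennreal \<epsilon> \<and> surv r1 r2 x y \<le> p x y + ennreal \<epsilon>"
    and xy: "0 \<le> x" "0 \<le> y"
  shows "p x y = surv r1 r2 x y"
proof -
  define s where "s = surv r1 r2"
  define e where "e x y = max (p x y - s x y) (s x y - p x y)" for x y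
  have [measurable]: "measurable2 s" unfolding s_def by measurable
  have [measurable]: "measurable2 e" unfolding e_def by measurable
  have s_fp: "step r1 r2 s x y = s x y" for x y unfolding s_def by (rule step_surv)
  have e_le: "e x y \<le> a" if "p x y \<le> s x y + a" "s x y \<le> p x y + a" for x y a
    using that unfolding e_def by (auto simp: ennreal_minus_le_iff s_def)
  have p_le: "p x y \<le> s x y + e x y" and s_le: "s x y \<le> p x y + e x y" for x y
  proof -
    have "p x y \<le> s x y + (p x y - s x y)" "s x y \<le> p x y + (s x y - p x y)"
      by (auto simp: add_diff_self_ennreal)
    then show "p x y \<le> s x y + e x y" "s x y \<le> p x y + e x y"
      unfolding e_def by (auto intro: order_trans add_left_mono)
  qed
  have e_step: "e x y \<le> step r1 r2 e x y" if "0 \<le> x" "0 \<le> y" for x y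
  proof (rule e_le)
    have "p x y \<le> step r1 r2 (\<lambda>x y. s x y + e x y) x y"
      using step_mono[of p "\<lambda>x y. s x y + e x y" x y r1 r2, OF p_le that] by (simp only: fp[OF that])
    then show "p x y \<le> s x y + step r1 r2 e x y" by (subst (asm) step_add) (auto simp: s_fp)
    have "s x y \<le> step r1 r2 (\<lambda>x y. p x y + e x y) x y"
      using step_mono[of s "\<lambda>x y. p x y + e x y" x y r1 r2, OF s_le that] by (simp only: s_fp)
    then show "s x y \<le> p x y + step r1 r2 e x y" by (subst (asm) step_add) (auto simp: fp that)
  qed
  define S where "S = (SUP z\<in>{z. 0 \<le> fst z \<and> 0 \<le> snd z}. e (fst z) (snd z))"
  have e_S: "e x y \<le> S" if "0 \<le> x" "0 \<le> y" for x y
    unfolding S_def using that by (intro SUP_upper2[of "(x, y)"]) auto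
  have "S \<le> B + 1"
    unfolding S_def
  proof (intro SUP_least)
    fix z :: "real \<times> real" assume z: "z \<in> {z. 0 \<le> fst z \<and> 0 \<le> snd z}"
    show "e (fst z) (snd z) \<le> B + 1"
    proof (intro e_le)
      have "B \<le> b + (B + 1)" "1 \<le> b + (B + 1)" for b
        by (rule add_increasing; simp)+
      then have *: "a \<le> b + (B + 1)" if "a \<le> B \<or> a \<le> 1" for a b
        using that order_trans by blast
      show "p (fst z) (snd z) \<le> s (fst z) (snd z) + (B + 1)" "s (fst z) (snd z) \<le> p (fst z) (snd z) + (B + 1)"
        using z bounded(1) surv_le_1 by (auto intro!: * simp: s_def)
    qed
  qed
  then have S_fin: "S < \<infinity>"
    by (rule le_less_trans) (use bounded(2) in \<open>simp add: less_top[symmetric]\<close>)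
  have e_n: "e x y \<le> S * surv_upto r1 r2 n x y" if "0 \<le> x" "0 \<le> y" for x y n
    using that
  proof (induction n arbitrary: x y)
    case 0
    then show ?case by (simp add: surv_upto_0 e_S)
  next
    case (Suc n)
    have "e x y \<le> step r1 r2 e x y" using Suc.prems by (rule e_step)
    also have "\<dots> \<le> step r1 r2 (\<lambda>x y. S * surv_upto r1 r2 n x y) x y"
      using Suc.IH Suc.prems by (rule step_mono)
    also have "\<dots> = S * surv_upto r1 r2 (Suc n) x y"
      by (simp add: step_cmult[OF measurable2_surv_upto] surv_upto_Suc)
    finally show ?case .
  qed
  have S_le: "S \<le> ennreal \<epsilon>" if \<epsilon>: "0 < \<epsilon>" for \<epsilon>
  proof -
    obtain R where R: "\<And>x y. 0 \<le> x \<Longrightarrow> 0 \<le> y \<Longrightarrow> \<not> near_ruin r1 R x y \<Longrightarrow>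
      p x y \<le> s x y + ennreal \<epsilon> \<and> s x y \<le> p x y + ennreal \<epsilon>"
      using far[OF \<epsilon>] unfolding s_def by blast
    obtain n k where k: "k < 1" "\<And>x y. 0 \<le> x \<Longrightarrow> 0 \<le> y \<Longrightarrow> near_ruin r1 R x y \<Longrightarrow> surv_upto r1 r2 n x y \<le> k"
      using near_ruin_contraction[OF r, of R] by blast
    have "S \<le> max (S * k) (ennreal \<epsilon>)"
      unfolding S_def
    proof (intro SUP_least, fold S_def)
      fix z :: "real \<times> real" assume "z \<in> {z. 0 \<le> fst z \<and> 0 \<le> snd z}"
      then have z: "0 \<le> fst z" "0 \<le> snd z" by auto
      show "e (fst z) (snd z) \<le> max (S * k) (ennreal \<epsilon>)"
      proof (cases "near_ruin r1 R (fst z) (snd z)")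
        case True
        have "e (fst z) (snd z) \<le> S * surv_upto r1 r2 n (fst z) (snd z)" using z by (rule e_n)
        also have "\<dots> \<le> S * k" using k(2)[OF z True] by (intro mult_left_mono) auto
        finally show ?thesis by (rule max.coboundedI1)
      next
        case False
        then show ?thesis using e_le[of "fst z" "snd z" "ennreal \<epsilon>"] R[OF z False] by (simp add: le_max_iff_disj)
      qed
    qed
    moreover have "S = 0" if "S \<le> S * k"
    proof (rule ccontr)
      assume "S \<noteq> 0"
      then have "S * k < S * 1"
        using k(1) S_fin by (intro ennreal_mult_strict_left_mono) (auto simp: zero_less_iff_neq_zero)
      then show False using that by simp
    qed
    ultimately show ?thesis by (auto simp: le_max_iff_disj)
  qed
  have "S = 0"
  proof (rule ccontr)
    assume "S \<noteq> 0"
    then have "0 < enn2real S" using S_fin by (simp add: enn2real_positive_iff zero_less_iff_neq_zero)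
    then have "S \<le> ennreal (enn2real S / 2)" by (intro S_le) simp
    then have "enn2real S \<le> enn2real S / 2"
      using \<open>0 < enn2real S\<close> by (intro enn2real_leI) auto
    then show False using \<open>0 < enn2real S\<close> by simp
  qed
  then have "e x y = 0" using e_S[OF xy] by simp
  then show ?thesis using p_le[of x y] s_le[of x y] by (simp add: s_def)
qed

end

context coupled_risk
begin

lemma surv_shift1_le:
  assumes r: "0 \<le> r1" "0 \<le> r2" and x: "0 \<le> x" "0 \<le> y" and s: "0 \<le> s"
  shows "surv r1 r2 (x + c1 * s) y \<le> ennreal (exp (l * s)) * surv r1 r2 x y"
proof -
  have "surv r1 r2 (x + c1 * s) y \<le> surv r1 r2 (x + c1 * s) (y + c2 * s)"
    using x s c_pos by (intro mono_quadrantD[OF mono_quadrant_surv[OF r]]) auto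
  also have "\<dots> = ennreal (exp (l * s)) * (ennreal (exp (- l * s)) * surv r1 r2 (x + c1 * s) (y + c2 * s))"
  proof -
    have "exp (l * s) * exp (- l * s) = 1" by (simp only: mult_minus_left exp_minus_inverse)
    then have "ennreal (exp (l * s)) * ennreal (exp (- l * s)) = 1" by (simp add: ennreal_mult[symmetric])
    then show ?thesis by (simp add: mult.assoc[symmetric])
  qed
  also have "\<dots> \<le> ennreal (exp (l * s)) * surv r1 r2 x y"
    using surv_shift_le[OF s] by (intro mult_left_mono) auto
  finally show ?thesis .
qed

definition axis_cdf :: "ereal \<Rightarrow> ereal \<Rightarrow> real \<Rightarrow> real" where
  "axis_cdf r1 r2 x = (if x < 0 then 0 else enn2real (surv r1 r2 x 0))"

lemma ennreal_axis_cdf: "0 \<le> x \<Longrightarrow> ennreal (axis_cdf r1 r2 x) = surv r1 r2 x 0"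
  by (simp add: axis_cdf_def ennreal_enn2real)

lemma axis_cdf_nonneg: "0 \<le> axis_cdf r1 r2 x"
  by (simp add: axis_cdf_def)

lemma axis_cdf_mono:
  assumes r: "0 \<le> r1" "0 \<le> r2" and "x \<le> y"
  shows "axis_cdf r1 r2 x \<le> axis_cdf r1 r2 y"
  using assms by (auto simp: axis_cdf_def intro!: enn2real_mono mono_quadrantD[OF mono_quadrant_surv[OF r]])

lemma axis_cdf_shift:
  assumes r: "0 \<le> r1" "0 \<le> r2" and x: "0 \<le> x" "x \<le> y"
  shows "axis_cdf r1 r2 y \<le> exp (l * ((y - x) / c1)) * axis_cdf r1 r2 x"
proof -
  have "surv r1 r2 (x + c1 * ((y - x) / c1)) 0 \<le> ennreal (exp (l * ((y - x) / c1))) * surv r1 r2 x 0"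
    using x c_pos by (intro surv_shift1_le[OF r]) auto
  then have "ennreal (axis_cdf r1 r2 y) \<le> ennreal (exp (l * ((y - x) / c1)) * axis_cdf r1 r2 x)"
    using x c_pos by (simp add: ennreal_axis_cdf ennreal_mult axis_cdf_nonneg)
  then show ?thesis
    by (subst (asm) ennreal_le_iff) (auto simp: axis_cdf_nonneg)
qed

lemma axis_cdf_right_continuous:
  assumes r: "0 \<le> r1" "0 \<le> r2"
  shows "continuous (at_right a) (axis_cdf r1 r2)"
proof (cases "a < 0")
  case True
  have "\<forall>\<^sub>F x in at_right a. axis_cdf r1 r2 x = 0"
    using eventually_at_right_real[OF True] by eventually_elim (simp add: axis_cdf_def)
  then show ?thesis
    using True by (simp add: continuous_within axis_cdf_def[of _ _ a] tendsto_eventually)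
next
  case False
  have "((\<lambda>x. exp (l * ((x - a) / c1)) * axis_cdf r1 r2 a) \<longlongrightarrow> exp (l * ((a - a) / c1)) * axis_cdf r1 r2 a) (at_right a)"
    using c_pos by (intro tendsto_intros) auto
  then have lim: "((\<lambda>x. exp (l * ((x - a) / c1)) * axis_cdf r1 r2 a) \<longlongrightarrow> axis_cdf r1 r2 a) (at_right a)"
    by simp
  have gt: "\<forall>\<^sub>F x in at_right a. a < x"
    by (simp add: eventually_at_right_less)
  show ?thesis
    unfolding continuous_within
  proof (rule tendsto_sandwich[OF _ _ tendsto_const lim])
    show "\<forall>\<^sub>F x in at_right a. axis_cdf r1 r2 a \<le> axis_cdf r1 r2 x"
      using gt by eventually_elim (auto intro: axis_cdf_mono[OF r])
    show "\<forall>\<^sub>F x in at_right a. axis_cdf r1 r2 x \<le> exp (l * ((x - a) / c1)) * axis_cdf r1 r2 a"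
      using gt by eventually_elim (rule axis_cdf_shift[OF r]; use False in simp)
  qed
qed

lemma nonneg_measure_of_axis:
  assumes r: "0 \<le> r1" "0 \<le> r2" and lim: "((\<lambda>x. surv r1 r2 x 0) \<longlongrightarrow> 1) at_top"
  shows "\<exists>N. nonneg_measure N \<and> (\<forall>x\<ge>0. emeasure N {..x} = surv r1 r2 x 0)"
proof (intro exI conjI allI impI)
  let ?F = "axis_cdf r1 r2" and ?N = "interval_measure (axis_cdf r1 r2)"
  note mono = axis_cdf_mono[OF r] and cont = axis_cdf_right_continuous[OF r]
  have bot: "(?F \<longlongrightarrow> 0) at_bot"
    by (rule tendsto_eventually) (auto simp: axis_cdf_def eventually_at_bot_linorder intro!: exI[of _ "-1"])
  have "((\<lambda>x. enn2real (surv r1 r2 x 0)) \<longlongrightarrow> 1) at_top"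
    by (rule tendsto_enn2real) (simp_all add: lim)
  moreover have "\<forall>\<^sub>F x in at_top. enn2real (surv r1 r2 x 0) = ?F x"
    using eventually_ge_at_top[of 0] by eventually_elim (simp add: axis_cdf_def)
  ultimately have top: "(?F \<longlongrightarrow> 1) at_top"
    using tendsto_cong by fastforce
  interpret real_distribution ?N
    by (rule real_distribution_interval_measure[OF mono cont bot top])
  have cdf: "emeasure ?N {..x} = ennreal (?F x)" for x
    using cdf_interval_measure[OF mono cont bot]
    by (simp add: emeasure_eq_measure cdf_def fun_eq_iff)
  show "emeasure ?N {..x} = surv r1 r2 x 0" if "0 \<le> x" for x
    using that by (simp add: cdf ennreal_axis_cdf)
  have "AE u in ?N. \<not> u \<le> - 1 / real (Suc n)" for n
  proof -
    have "AE u in ?N. u \<notin> {..- 1 / real (Suc n)}"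
      by (rule AE_not_in) (simp add: null_sets_def cdf axis_cdf_def)
    then show ?thesis by simp
  qed
  then have "AE u in ?N. \<forall>n. \<not> u \<le> - 1 / real (Suc n)"
    by (simp add: AE_all_countable)
  then have "AE u in ?N. 0 \<le> u"
  proof eventually_elim
    case (elim u)
    show ?case
    proof (rule ccontr)
      assume "\<not> 0 \<le> u"
      then obtain n where "1 / real (Suc n) < - u"
        using reals_Archimedean[of "- u"] by (auto simp: inverse_eq_divide)
      then have "u \<le> - 1 / real (Suc n)" by simp
      with elim show False by blast
    qed
  qed
  then show "nonneg_measure ?N"
    by unfold_locales auto
qed

lemma axis_measure_atomless:
  assumes "nonneg_measure N" and r: "0 \<le> r1" "0 \<le> r2"
    and cdf: "\<And>x. 0 \<le> x \<Longrightarrow> emeasure N {..x} = surv r1 r2 x 0" and u: "0 < u"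
  shows "emeasure N {u} = 0"
proof -
  interpret nonneg_measure N by fact
  have F: "measure N {..x} = axis_cdf r1 r2 x" if "0 \<le> x" for x
    using cdf[OF that] that by (simp add: measure_def axis_cdf_def)
  have le: "measure N {u} \<le> exp (l * ((u - x) / c1)) * axis_cdf r1 r2 x - axis_cdf r1 r2 x"
    if x: "0 \<le> x" "x < u" for x
  proof -
    have "measure N {u} \<le> measure N ({..u} - {..x})"
      using x by (intro finite_measure_mono) auto
    also have "\<dots> = measure N {..u} - measure N {..x}"
      using x by (intro finite_measure_Diff) auto
    finally show ?thesis
      using F x u axis_cdf_shift[OF r x(1), of u] by simp
  qed
  have "measure N {u} \<le> exp (l * ((u - x) / c1)) - 1" if x: "0 \<le> x" "x < u" for x
  proof -
    have "axis_cdf r1 r2 x \<le> 1"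
      using surv_le_1[of r1 r2 x 0] x by (simp add: axis_cdf_def enn2real_leI)
    moreover have "1 \<le> exp (l * ((u - x) / c1))"
      using x c_pos l_pos by simp
    ultimately have "(exp (l * ((u - x) / c1)) - 1) * axis_cdf r1 r2 x \<le> (exp (l * ((u - x) / c1)) - 1) * 1"
      by (intro mult_left_mono) auto
    then show ?thesis using le[OF x] by (simp add: algebra_simps)
  qed
  then have "\<forall>\<^sub>F x in at_left u. measure N {u} \<le> exp (l * ((u - x) / c1)) - 1"
    using u eventually_at_left_real[OF u] by (auto elim!: eventually_mono)
  moreover have "((\<lambda>x. exp (l * ((u - x) / c1)) - 1) \<longlongrightarrow> exp (l * ((u - u) / c1)) - 1) (at_left u)"
    using c_pos by (intro tendsto_intros) auto
  ultimately have "measure N {u} \<le> exp (l * ((u - u) / c1)) - 1"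
    by (intro tendsto_lowerbound[where F="at_left u"]) (auto simp: trivial_limit_at_left_real)
  then have "measure N {u} = 0" by (simp add: measure_le_0_iff)
  then show ?thesis by (simp add: emeasure_eq_measure)
qed

definition mixture :: "real measure \<Rightarrow> real measure \<Rightarrow> ereal \<Rightarrow> ereal \<Rightarrow> real \<Rightarrow> real \<Rightarrow> ennreal" where
  "mixture N K r1 r2 x y = conv1 N (surv 0 r2) x y + conv2 K (surv r1 0) x y
     - emeasure N {..x} * emeasure K {..y}"

lemma conv1_surv_bounds:
  assumes "nonneg_measure N" and r: "0 \<le> r1" "0 \<le> r2" and x: "0 \<le> x" "0 \<le> y"
  shows "emeasure N {..x} * surv r1 r2 0 y \<le> conv1 N (surv r1 r2) x y"
    and "conv1 N (surv r1 r2) x y \<le> emeasure N {..x}"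
    and "0 \<le> R \<Longrightarrow> 2 * R \<le> x \<Longrightarrow> emeasure N {..R} * surv r1 r2 R 0 \<le> conv1 N (surv r1 r2) x y"
proof -
  interpret nonneg_measure N by fact
  note mono = mono_quadrantD[OF mono_quadrant_surv[OF r]]
  have "emeasure N {..x} * surv r1 r2 0 y = (\<integral>\<^sup>+u. surv r1 r2 0 y * indicator {..x} u \<partial>N)"
    by (subst nn_integral_cmult_indicator) (auto simp: mult.commute)
  also have "\<dots> \<le> conv1 N (surv r1 r2) x y"
    unfolding conv1_def using x by (intro nn_integral_mono) (auto simp: indicator_def intro!: mono)
  finally show "emeasure N {..x} * surv r1 r2 0 y \<le> conv1 N (surv r1 r2) x y" .
  have "conv1 N (surv r1 r2) x y \<le> (\<integral>\<^sup>+u. indicator {..x} u \<partial>N)"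
    unfolding conv1_def by (intro nn_integral_mono) (auto simp: indicator_def surv_le_1)
  then show "conv1 N (surv r1 r2) x y \<le> emeasure N {..x}" by simp
  assume R: "0 \<le> R" "2 * R \<le> x"
  have "emeasure N {..R} * surv r1 r2 R 0 = (\<integral>\<^sup>+u. surv r1 r2 R 0 * indicator {..R} u \<partial>N)"
    by (subst nn_integral_cmult_indicator) (auto simp: mult.commute)
  also have "\<dots> \<le> conv1 N (surv r1 r2) x y"
    unfolding conv1_def using x R by (intro nn_integral_mono) (auto simp: indicator_def intro!: mono)
  finally show "emeasure N {..R} * surv r1 r2 R 0 \<le> conv1 N (surv r1 r2) x y" .
qed

end

context coupled_risk
begin

lemma conv2_surv_bounds:
  assumes N: "nonneg_measure N" and r: "0 \<le> r1" "0 \<le> r2" and x: "0 \<le> x" "0 \<le> y"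
  shows "surv r1 r2 x 0 * emeasure N {..y} \<le> conv2 N (surv r1 r2) x y"
    and "conv2 N (surv r1 r2) x y \<le> emeasure N {..y}"
proof -
  have s: "swapped.surv r2 r1 = (\<lambda>x y. surv r1 r2 y x)" by (intro ext swapped_surv)
  show "surv r1 r2 x 0 * emeasure N {..y} \<le> conv2 N (surv r1 r2) x y"
    and "conv2 N (surv r1 r2) x y \<le> emeasure N {..y}"
    using swapped.conv1_surv_bounds(1,2)[OF N r(2,1) x(2,1)] by (simp_all add: s conv2_def mult.commute)
qed

lemma mixture_far:
  assumes N: "nonneg_measure N" and K: "nonneg_measure K" and r: "0 \<le> r1" "0 \<le> r2"
    and cdfN: "\<And>x. 0 \<le> x \<Longrightarrow> emeasure N {..x} = surv r1 0 x 0"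
    and cdfK: "\<And>y. 0 \<le> y \<Longrightarrow> emeasure K {..y} = surv 0 r2 0 y"
    and R: "0 \<le> R" "ennreal (1 - \<epsilon>) \<le> surv r1 r2 R 0" and \<epsilon>: "0 < \<epsilon>" "\<epsilon> < 1"
    and x: "2 * R \<le> x" "0 \<le> x" "0 \<le> y"
  shows "mixture N K r1 r2 x y \<le> surv r1 r2 x y + ennreal (2 * \<epsilon>)"
    and "surv r1 r2 x y \<le> mixture N K r1 r2 x y + ennreal (2 * \<epsilon>)"
proof -
  interpret N: nonneg_measure N by fact
  interpret K: nonneg_measure K by fact
  let ?A = "conv1 N (surv 0 r2) x y" and ?B = "conv2 K (surv r1 0) x y"
  let ?m = "emeasure N {..x} * emeasure K {..y}" and ?p = "mixture N K r1 r2 x y"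
  have m_A: "?m \<le> ?A" and m_B: "?m \<le> ?B"
    using conv1_surv_bounds(1)[OF N order_refl r(2) x(2,3)] conv2_surv_bounds(1)[OF K r(1) order_refl x(2,3)]
    by (simp_all add: cdfN cdfK x)
  have p_m: "?p + ?m = ?A + ?B"
    unfolding mixture_def using m_A by (intro diff_add_cancel_ennreal) (simp add: add_increasing2)
  have m_fin: "?m \<noteq> \<top>" by (simp add: ennreal_mult_eq_top_iff)
  have A_p: "?A \<le> ?p"
  proof -
    have "?m + ?A \<le> ?m + ?p" using p_m m_B by (metis add.commute add_left_mono)
    then show ?thesis using m_fin by (simp only: ennreal_add_left_cancel_le) auto
  qed
  have near1: "ennreal (1 - \<epsilon>) \<le> surv r1' r2' z w"
    if "0 \<le> r1'" "r1' \<le> r1" "0 \<le> r2'" "r2' \<le> r2" "R \<le> z" "0 \<le> w" for r1' r2' z w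
  proof -
    have "ennreal (1 - \<epsilon>) \<le> surv r1 r2 R 0" by fact
    also have "\<dots> \<le> surv r1' r2' R 0" using that R by (intro surv_rate_antimono) auto
    also have "\<dots> \<le> surv r1' r2' z w"
      using that R by (intro mono_quadrantD[OF mono_quadrant_surv]) auto
    finally show ?thesis .
  qed
  have N_x: "ennreal (1 - \<epsilon>) \<le> emeasure N {..z}" if "R \<le> z" for z
    using near1[of r1 0 z 0] that R r by (simp add: cdfN)
  have "ennreal (1 - \<epsilon>) * ennreal (1 - \<epsilon>) \<le> emeasure N {..R} * surv 0 r2 R 0"
    using near1[of 0 r2 R 0] N_x[of R] r by (intro mult_mono) auto
  also have "\<dots> \<le> ?A" using x R r by (intro conv1_surv_bounds(3)[OF N]) auto
  finally have "ennreal ((1 - \<epsilon>) * (1 - \<epsilon>)) \<le> ?p"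
    using A_p \<epsilon> by (simp add: ennreal_mult)
  moreover have "1 \<le> (1 - \<epsilon>) * (1 - \<epsilon>) + 2 * \<epsilon>" by (simp add: algebra_simps)
  then have "1 \<le> ennreal ((1 - \<epsilon>) * (1 - \<epsilon>)) + ennreal (2 * \<epsilon>)"
    using ennreal_leI[of 1] \<epsilon> by fastforce
  ultimately have "1 \<le> ?p + ennreal (2 * \<epsilon>)"
    by (meson add_right_mono order_trans)
  then show "surv r1 r2 x y \<le> ?p + ennreal (2 * \<epsilon>)"
    using surv_le_1 order_trans by blast
  have K1: "emeasure K {..y} \<le> 1" using x by (simp add: cdfK surv_le_1)
  have "?p + ennreal (1 - \<epsilon>) * emeasure K {..y} \<le> ?p + ?m"
    using N_x[of x] x R by (intro add_left_mono mult_right_mono) auto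
  also have "\<dots> \<le> 1 + emeasure K {..y}"
    unfolding p_m using conv1_surv_bounds(2)[OF N order_refl r(2) x(2,3)] conv2_surv_bounds(2)[OF K r(1) order_refl x(2,3)] x
    by (intro add_mono) (auto simp: cdfN intro: order_trans surv_le_1)
  also have "\<dots> = 1 + (ennreal \<epsilon> * emeasure K {..y} + ennreal (1 - \<epsilon>) * emeasure K {..y})"
    using \<epsilon> by (subst distrib_right[symmetric], subst ennreal_plus[symmetric]) auto
  finally have "ennreal (1 - \<epsilon>) * emeasure K {..y} + ?p
      \<le> ennreal (1 - \<epsilon>) * emeasure K {..y} + (1 + ennreal \<epsilon> * emeasure K {..y})"
    by (simp only: ac_simps)
  moreover have "ennreal (1 - \<epsilon>) * emeasure K {..y} \<noteq> \<top>" by (simp add: ennreal_mult_eq_top_iff)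
  ultimately have "?p \<le> 1 + ennreal \<epsilon> * emeasure K {..y}"
    by (simp only: ennreal_add_left_cancel_le) auto
  also have "\<dots> \<le> 1 + ennreal \<epsilon> * 1" by (intro add_left_mono mult_left_mono K1) auto
  also have "\<dots> = ennreal (1 - \<epsilon>) + ennreal (2 * \<epsilon>)"
  proof -
    have "1 + ennreal \<epsilon> * 1 = ennreal (1 + \<epsilon>)" using \<epsilon> by simp
    also have "1 + \<epsilon> = (1 - \<epsilon>) + 2 * \<epsilon>" by simp
    also have "ennreal \<dots> = ennreal (1 - \<epsilon>) + ennreal (2 * \<epsilon>)" using \<epsilon> by (intro ennreal_plus) auto
    finally show ?thesis .
  qed
  also have "\<dots> \<le> surv r1 r2 x y + ennreal (2 * \<epsilon>)"
    using near1[of r1 r2 x y] x R r by (intro add_right_mono) auto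
  finally show "?p \<le> surv r1 r2 x y + ennreal (2 * \<epsilon>)" .
qed

lemma mixture_swap: "swapped.mixture K N r2 r1 y x = mixture N K r1 r2 x y"
proof -
  have "swapped.surv r2 r1 = (\<lambda>x y. surv r1 r2 y x)" for r1 r2 by (intro ext swapped_surv)
  then show ?thesis
    unfolding mixture_def swapped.mixture_def by (simp add: conv2_def add.commute mult.commute)
qed

end

context coupled_risk
begin

theorem surv_eq_mixture:
  assumes N: "nonneg_measure N" and K: "nonneg_measure K" and r: "0 < r1" "0 < r2"
    and cdfN: "\<And>x. 0 \<le> x \<Longrightarrow> emeasure N {..x} = surv r1 0 x 0"
    and cdfK: "\<And>y. 0 \<le> y \<Longrightarrow> emeasure K {..y} = surv 0 r2 0 y"
    and lim1: "((\<lambda>x. surv r1 r2 x 0) \<longlongrightarrow> 1) at_top"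
    and lim2: "r1 = \<infinity> \<or> ((\<lambda>y. surv r1 r2 0 y) \<longlongrightarrow> 1) at_top"
    and xy: "0 \<le> x" "0 \<le> y"
  shows "surv r1 r2 x y = mixture N K r1 r2 x y"
proof (rule step_fixpoint_unique[symmetric])
  interpret N: nonneg_measure N by fact
  interpret K: nonneg_measure K by fact
  have r0: "0 \<le> r1" "0 \<le> r2" using r by auto
  let ?P = "\<lambda>x y. conv1 N (surv 0 r2) x y + conv2 K (surv r1 0) x y"
  let ?m = "\<lambda>x y. emeasure N {..x} * emeasure K {..y}"
  have ms[measurable]: "measurable2 (surv 0 r2)" "measurable2 (surv r1 0)" by measurable
  show mp[measurable]: "measurable2 (mixture N K r1 r2)"
    unfolding mixture_def by measurable
  have mm[measurable]: "measurable2 ?m" by measurable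
  have p_m: "mixture N K r1 r2 x y + ?m x y = ?P x y" if "0 \<le> x" "0 \<le> y" for x y
  proof -
    have "?m x y \<le> ?P x y"
      using conv1_surv_bounds(1)[OF N order_refl r0(2) that] that by (simp add: cdfK add_increasing2)
    then show ?thesis unfolding mixture_def by (rule diff_add_cancel_ennreal)
  qed
  have P_le: "?P x y \<le> 2" if "0 \<le> x" "0 \<le> y" for x y
  proof -
    have "?P x y \<le> 1 + 1"
      using conv1_surv_bounds(2)[OF N order_refl r0(2) that] conv2_surv_bounds(2)[OF K r0(1) order_refl that] that
      by (intro add_mono) (auto simp: cdfN cdfK intro: order_trans surv_le_1)
    then show ?thesis by simp
  qed
  show "mixture N K r1 r2 x y \<le> 2" if "0 \<le> x" "0 \<le> y" for x y
    unfolding mixture_def using P_le[OF that] diff_le_self_ennreal order_trans by blast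
  have m_le: "?m x y \<le> 1" if "0 \<le> x" "0 \<le> y" for x y
    using that mult_mono[OF surv_le_1[of r1 0 x 0] surv_le_1[of 0 r2 0 y]] by (simp add: cdfN cdfK)
  show "step r1 r2 (mixture N K r1 r2) x y = mixture N K r1 r2 x y" if xy: "0 \<le> x" "0 \<le> y" for x y
  proof -
    have "step r1 r2 ?P x y = step r1 r2 (\<lambda>x y. mixture N K r1 r2 x y + ?m x y) x y"
      using xy by (intro step_cong) (auto simp: p_m)
    also have "\<dots> = step r1 r2 (mixture N K r1 r2) x y + step r1 r2 ?m x y"
      by (rule step_add[OF mp mm])
    finally have "step r1 r2 (mixture N K r1 r2) x y + step r1 r2 ?m x y + ?m x y
        = mixture N K r1 r2 x y + ?m x y + step r1 r2 ?m x y"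
      using step_conv_sum[OF N K r0 cdfN cdfK axis_measure_atomless[OF N r0(1) order_refl cdfN] xy] p_m[OF xy]
      by simp
    then have "(step r1 r2 ?m x y + ?m x y) + step r1 r2 (mixture N K r1 r2) x y
        = (step r1 r2 ?m x y + ?m x y) + mixture N K r1 r2 x y"
      by (simp only: ac_simps)
    moreover have "step r1 r2 ?m x y \<le> 1"
      using step_mono[of ?m "\<lambda>_ _. 1" x y r1 r2, OF m_le xy] step_1_le order_trans by blast
    then have "step r1 r2 ?m x y + ?m x y \<noteq> \<top>"
      using m_le[OF xy] by (auto simp: top_unique)
    ultimately show ?thesis by (simp only: ennreal_add_left_cancel) auto
  qed
  fix \<epsilon> :: real assume \<epsilon>: "0 < \<epsilon>"
  define \<delta> where "\<delta> = min (\<epsilon> / 2) (1 / 2)"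
  have \<delta>: "0 < \<delta>" "\<delta> < 1" "2 * \<delta> \<le> \<epsilon>" using \<epsilon> by (auto simp: \<delta>_def min_def)
  have ev: "\<exists>R\<ge>0. ennreal (1 - \<delta>) \<le> f R" if "(f \<longlongrightarrow> 1) at_top" for f :: "real \<Rightarrow> ennreal"
  proof -
    have "ennreal (1 - \<delta>) < 1" using \<delta> by (simp add: ennreal_lessI ennreal_1[symmetric] del: ennreal_1)
    then have "\<forall>\<^sub>F x in at_top. ennreal (1 - \<delta>) < f x" by (rule order_tendstoD(1)[OF that])
    then have "\<forall>\<^sub>F x in at_top. ennreal (1 - \<delta>) < f x \<and> 0 \<le> x"
      using eventually_ge_at_top[of "0::real"] by (rule eventually_conj)
    then obtain R where "ennreal (1 - \<delta>) < f R" "0 \<le> R"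
      by (auto simp: eventually_at_top_linorder)
    then show ?thesis by (auto intro: less_imp_le)
  qed
  obtain R1 where R1: "0 \<le> R1" "ennreal (1 - \<delta>) \<le> surv r1 r2 R1 0" using ev[OF lim1] by blast
  obtain R2 where R2: "0 \<le> R2" "r1 = \<infinity> \<or> ennreal (1 - \<delta>) \<le> surv r1 r2 0 R2"
    using lim2 ev[of "\<lambda>y. surv r1 r2 0 y"] by (cases "r1 = \<infinity>") auto
  have eps: "a + ennreal (2 * \<delta>) \<le> a + ennreal \<epsilon>" for a
    using \<delta> by (intro add_left_mono ennreal_leI) auto
  have "mixture N K r1 r2 x y \<le> surv r1 r2 x y + ennreal \<epsilon> \<and> surv r1 r2 x y \<le> mixture N K r1 r2 x y + ennreal \<epsilon>"
    if xy: "0 \<le> x" "0 \<le> y" "\<not> near_ruin r1 (2 * max R1 R2) x y" for x y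
  proof -
    consider "2 * R1 \<le> x" | "r1 \<noteq> \<infinity>" "2 * R2 \<le> y" using xy(3) by (auto simp: near_ruin_def)
    then show ?thesis
    proof cases
      case 1
      then show ?thesis
        using mixture_far[OF N K r0 cdfN cdfK R1 \<delta>(1,2) 1 xy(1,2)] eps order_trans by blast
    next
      case 2
      have cdfK': "emeasure K {..z} = swapped.surv r2 0 z 0" if "0 \<le> z" for z
        using that by (simp add: cdfK swapped_surv)
      have cdfN': "emeasure N {..z} = swapped.surv 0 r1 0 z" if "0 \<le> z" for z
        using that by (simp add: cdfN swapped_surv)
      have R2': "ennreal (1 - \<delta>) \<le> swapped.surv r2 r1 R2 0" using R2 2 by (simp add: swapped_surv)
      show ?thesis
        using swapped.mixture_far[OF K N r0(2,1) cdfK' cdfN' R2(1) R2' \<delta>(1,2) 2(2) xy(2,1)] eps order_trans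
        unfolding mixture_swap swapped_surv by blast
    qed
  qed
  then show "\<exists>R. \<forall>x y. 0 \<le> x \<longrightarrow> 0 \<le> y \<longrightarrow> \<not> near_ruin r1 R x y \<longrightarrow>
      mixture N K r1 r2 x y \<le> surv r1 r2 x y + ennreal \<epsilon> \<and> surv r1 r2 x y \<le> mixture N K r1 r2 x y + ennreal \<epsilon>"
    by blast
qed (use r xy in \<open>auto simp: less_imp_le\<close>)

lemma mixture_axis1:
  assumes "nonneg_measure N" "nonneg_measure K" and x: "0 \<le> x"
    and cdfN: "\<And>x. 0 \<le> x \<Longrightarrow> emeasure N {..x} = surv r1 0 x 0"
  shows "mixture N K r1 r2 x 0 = conv1 N (surv 0 r2) x 0"
proof -
  interpret N: nonneg_measure N by fact
  interpret K: nonneg_measure K by fact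
  have "conv2 K (surv r1 0) x 0 = emeasure N {..x} * emeasure K {..0}"
    using x by (simp add: conv2_def K.conv1_0 cdfN mult.commute)
  then show ?thesis
    unfolding mixture_def by (simp add: ennreal_mult_eq_top_iff)
qed

end

section \<open>Survival from large capitals\<close>

lemma expint_id:
  assumes l: "0 < l"
  shows "expint l (\<lambda>t. ennreal t) = ennreal (1 / l\<^sup>2)"
proof -
  have "ennreal (1 / l) = (\<integral>\<^sup>+t. ennreal (erlang_density 0 l t * t ^ 1) \<partial>lborel)"
    using nn_integral_erlang_ith_moment[OF l, of 0 1] by simp
  also have "\<dots> = (\<integral>\<^sup>+t. ennreal l * (ennreal (exp (- l * t)) * ennreal t * indicator {0..} t) \<partial>lborel)"
    using l by (intro nn_integral_cong)
      (auto simp: exponential_density_def indicator_def ennreal_mult[symmetric] mult.assoc mult.left_commute)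
  also have "\<dots> = ennreal l * expint l (\<lambda>t. ennreal t)"
    unfolding expint_def by (rule nn_integral_cmult) measurable
  finally have "ennreal (1 / l) * ennreal (1 / l) = ennreal (1 / l) * (ennreal l * expint l (\<lambda>t. ennreal t))"
    by simp
  also have "\<dots> = (ennreal (1 / l) * ennreal l) * expint l (\<lambda>t. ennreal t)"
    by (simp only: mult.assoc)
  also have "ennreal (1 / l) * ennreal l = 1"
    using l by (simp add: ennreal_mult[symmetric])
  finally show ?thesis
    using l by (simp add: ennreal_mult[symmetric] power2_eq_square)
qed

lemma expint_LIMSEQ:
  assumes [measurable]: "\<And>n. f n \<in> borel_measurable borel" "g \<in> borel_measurable borel"
    and inc: "\<And>n t. f n t \<le> f (Suc n) t" and lim: "\<And>t. (\<lambda>n. f n t) \<longlonglongrightarrow> g t"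
  shows "(\<lambda>n. expint l (f n)) \<longlonglongrightarrow> expint l g"
  unfolding expint_def
proof (rule nn_integral_LIMSEQ)
  show "incseq (\<lambda>n t. ennreal (exp (- l * t)) * f n t * indicator {0..} t)"
    by (intro incseq_SucI le_funI mult_left_mono mult_right_mono inc) auto
  show "(\<lambda>n. ennreal (exp (- l * t)) * f n t * indicator {0..} t)
      \<longlonglongrightarrow> ennreal (exp (- l * t)) * g t * indicator {0..} t" for t
    using ennreal_tendsto_cmult[OF _ lim, of "ennreal (exp (- l * t))" t] by (auto simp: indicator_def)
qed measurable

context coupled_risk
begin

definition increment :: "(real \<Rightarrow> ennreal) \<Rightarrow> ennreal" where
  "increment f = expint l (\<lambda>t. ennreal l1 * (\<integral>\<^sup>+j. f (c1 * t - j) \<partial>D1) + ennreal l2 * f (c1 * t))"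

definition surv1_upto :: "nat \<Rightarrow> real \<Rightarrow> ennreal" where
  "surv1_upto n x = (if x < 0 then 0 else surv_upto \<infinity> 0 n x 0)"

lemma surv1_upto_measurable[measurable (raw)]:
  assumes [measurable]: "f \<in> borel_measurable M"
  shows "(\<lambda>w. surv1_upto n (f w)) \<in> borel_measurable M"
  unfolding surv1_upto_def by measurable

lemma surv1_upto_le_1: "surv1_upto n x \<le> 1"
  by (simp add: surv1_upto_def surv_upto_le_1)

lemma surv1_upto_Suc_le: "surv1_upto (Suc n) x \<le> surv1_upto n x"
  by (simp add: surv1_upto_def surv_upto_antimono)

lemma increment_add:
  assumes [measurable]: "f \<in> borel_measurable borel" "g \<in> borel_measurable borel"
  shows "increment (\<lambda>z. f z + g z) = increment f + increment g"
  unfolding increment_def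
  by (subst expint_add[symmetric]) (auto intro!: expint_cong simp: nn_integral_add distrib_left ac_simps)

lemma increment_const: "increment (\<lambda>_. a) = a"
proof -
  have "increment (\<lambda>_. a) = expint l (\<lambda>t. (a * ennreal l) * 1)"
    unfolding increment_def using l_pos
    by (intro expint_cong) (simp add: D1.emeasure_space_1 distrib_left mult.commute)
  also have "\<dots> = a * (ennreal l * expint l (\<lambda>_. 1))"
    by (subst expint_cmult) (simp_all only: mult.assoc borel_measurable_const)
  finally show ?thesis using expint_one[OF lam_pos] by simp
qed

lemma increment_fubini:
  assumes [measurable]: "(\<lambda>(a, z). f a z) \<in> borel_measurable (borel \<Otimes>\<^sub>M borel)"
  shows "(\<integral>\<^sup>+a. increment (f a) \<partial>lborel) = increment (\<lambda>z. \<integral>\<^sup>+a. f a z \<partial>lborel)"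
proof -
  interpret p: pair_sigma_finite lborel D1 ..
  have "(\<integral>\<^sup>+a. increment (f a) \<partial>lborel)
      = expint l (\<lambda>t. \<integral>\<^sup>+a. (ennreal l1 * (\<integral>\<^sup>+j. f a (c1 * t - j) \<partial>D1) + ennreal l2 * f a (c1 * t)) \<partial>lborel)"
    unfolding increment_def by (rule expint_fubini[symmetric]) (auto intro: lborel.sigma_finite_measure_axioms)
  also have "\<dots> = increment (\<lambda>z. \<integral>\<^sup>+a. f a z \<partial>lborel)"
    unfolding increment_def
  proof (intro expint_cong)
    fix t
    have "(\<integral>\<^sup>+a. \<integral>\<^sup>+j. f a (c1 * t - j) \<partial>D1 \<partial>lborel) = (\<integral>\<^sup>+j. \<integral>\<^sup>+a. f a (c1 * t - j) \<partial>lborel \<partial>D1)"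
      by (rule p.Fubini'[symmetric]) measurable
    then show "(\<integral>\<^sup>+a. (ennreal l1 * (\<integral>\<^sup>+j. f a (c1 * t - j) \<partial>D1) + ennreal l2 * f a (c1 * t)) \<partial>lborel)
      = ennreal l1 * (\<integral>\<^sup>+j. \<integral>\<^sup>+a. f a (c1 * t - j) \<partial>lborel \<partial>D1) + ennreal l2 * (\<integral>\<^sup>+a. f a (c1 * t) \<partial>lborel)"
      by (simp add: nn_integral_add nn_integral_cmult)
  qed
  finally show ?thesis .
qed

lemma surv1_upto_Suc:
  assumes x: "0 \<le> x"
  shows "surv1_upto (Suc n) x = increment (\<lambda>z. surv1_upto n (x + z))"
proof -
  have "surv1_upto (Suc n) x = expint l (\<lambda>t. jump \<infinity> 0 (surv_upto \<infinity> 0 n) (x + c1 * t) (0 + c2 * t))"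
    using x by (simp add: surv1_upto_def surv_upto_Suc step_def ray_def)
  also have "\<dots> = increment (\<lambda>z. surv1_upto n (x + z))"
    unfolding increment_def
  proof (intro expint_cong)
    fix t :: real assume t: "0 \<le> t"
    have xt: "0 \<le> x + c1 * t" "0 \<le> 0 + c2 * t" using x t c_pos by auto
    have "claim2 0 (surv_upto \<infinity> 0 n) (x + c1 * t) (0 + c2 * t) = surv_upto \<infinity> 0 n (x + c1 * t) 0"
      by (rule claim2_zero_rate) (rule surv_upto_inf_0_indep[OF xt(1)], assumption, rule xt(1))
    moreover have "claim1 \<infinity> (surv_upto \<infinity> 0 n) (x + c1 * t) (0 + c2 * t) = (\<integral>\<^sup>+j. surv1_upto n (x + (c1 * t - j)) \<partial>D1)"
      unfolding claim1_def
    proof (intro nn_integral_cong)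
      fix j
      show "after_claim \<infinity> (surv_upto \<infinity> 0 n) (x + c1 * t - j) (0 + c2 * t) = surv1_upto n (x + (c1 * t - j))"
        using surv_upto_inf_0_indep[OF _ xt(2), of "x + c1 * t - j" n]
        by (auto simp: after_claim_def surv1_upto_def add_diff_eq)
    qed
    ultimately show "jump \<infinity> 0 (surv_upto \<infinity> 0 n) (x + c1 * t) (0 + c2 * t)
      = ennreal l1 * (\<integral>\<^sup>+j. surv1_upto n (x + (c1 * t - j)) \<partial>D1) + ennreal l2 * surv1_upto n (x + c1 * t)"
      using xt by (simp add: jump_def surv1_upto_def)
  qed
  finally show ?thesis .
qed

lemma increment_LIMSEQ:
  assumes [measurable]: "\<And>n. f n \<in> borel_measurable borel" "g \<in> borel_measurable borel"
    and inc: "\<And>n z. f n z \<le> f (Suc n) z" and lim: "\<And>z. (\<lambda>n. f n z) \<longlonglongrightarrow> g z"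
  shows "(\<lambda>n. increment (f n)) \<longlonglongrightarrow> increment g"
  unfolding increment_def
proof (rule expint_LIMSEQ)
  fix n t
  show "ennreal l1 * (\<integral>\<^sup>+j. f n (c1 * t - j) \<partial>D1) + ennreal l2 * f n (c1 * t)
    \<le> ennreal l1 * (\<integral>\<^sup>+j. f (Suc n) (c1 * t - j) \<partial>D1) + ennreal l2 * f (Suc n) (c1 * t)"
    by (intro add_mono mult_left_mono nn_integral_mono inc) auto
next
  fix t
  have "(\<lambda>n. \<integral>\<^sup>+j. f n (c1 * t - j) \<partial>D1) \<longlonglongrightarrow> (\<integral>\<^sup>+j. g (c1 * t - j) \<partial>D1)"
    by (rule nn_integral_LIMSEQ) (auto intro!: incseq_SucI le_funI inc lim)
  then show "(\<lambda>n. ennreal l1 * (\<integral>\<^sup>+j. f n (c1 * t - j) \<partial>D1) + ennreal l2 * f n (c1 * t))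
    \<longlonglongrightarrow> ennreal l1 * (\<integral>\<^sup>+j. g (c1 * t - j) \<partial>D1) + ennreal l2 * g (c1 * t)"
    by (intro tendsto_add ennreal_tendsto_cmult lim) auto
qed measurable

text \<open>Positive drift and certain ruin are incompatible: the integral of the ruin probability over the initial
  capital cannot decrease in the horizon, although the positive part of an increment outweighs the negative one.\<close>

lemma surv1_positive:
  assumes m: "(\<integral>\<^sup>+j. ennreal j \<partial>D1) = ennreal m" "0 \<le> m" and drift: "l1 * m < c1"
  shows "\<exists>x\<ge>0. 0 < surv \<infinity> 0 x 0"
proof (rule ccontr)
  assume "\<not> ?thesis"
  then have zero: "surv \<infinity> 0 x 0 = 0" if "0 \<le> x" for x using that by (auto simp: zero_less_iff_neq_zero)
  define ub where "ub n x = 1 - surv1_upto n x" for n x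
  have [measurable]: "\<And>n. ub n \<in> borel_measurable borel" unfolding ub_def[abs_def] by measurable
  have ub_surv: "ub n x + surv1_upto n x = 1" for n x
    unfolding ub_def by (rule diff_add_cancel_ennreal[OF surv1_upto_le_1])
  have ub_inc: "ub n x \<le> ub (Suc n) x" for n x
    unfolding ub_def by (rule ennreal_minus_mono) (auto simp: surv1_upto_Suc_le)
  have ub_neg: "ub n x = 1" if "x < 0" for n x using that by (simp add: ub_def surv1_upto_def)
  have ub_lim: "(\<lambda>n. ub n x) \<longlonglongrightarrow> 1" if "0 \<le> x" for x
  proof -
    have "(\<lambda>n. 1 - surv_upto \<infinity> 0 n x 0) \<longlonglongrightarrow> 1 - surv \<infinity> 0 x 0"
      by (intro tendsto_diff_ennreal surv_upto_LIMSEQ tendsto_const) auto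
    then show ?thesis using that by (simp add: ub_def surv1_upto_def zero)
  qed
  have ub_Suc: "ub (Suc n) x = increment (\<lambda>z. ub n (x + z))" if "0 \<le> x" for n x
  proof -
    have "increment (\<lambda>z. ub n (x + z)) + surv1_upto (Suc n) x = increment (\<lambda>z. ub n (x + z) + surv1_upto n (x + z))"
      using that by (simp add: surv1_upto_Suc increment_add)
    also have "\<dots> = 1" by (simp add: ub_surv increment_const)
    also have "\<dots> = ub (Suc n) x + surv1_upto (Suc n) x" by (simp add: ub_surv)
    finally have "surv1_upto (Suc n) x + increment (\<lambda>z. ub n (x + z)) = surv1_upto (Suc n) x + ub (Suc n) x"
      by (simp only: add.commute)
    moreover have "surv1_upto (Suc n) x \<noteq> \<top>" using surv1_upto_le_1[of "Suc n" x] by (auto simp: top_unique)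
    ultimately show ?thesis by (simp only: ennreal_add_left_cancel) auto
  qed
  define M where "M n = (\<integral>\<^sup>+x. ub n x * indicator {0..} x \<partial>lborel)" for n
  define A where "A n z = (\<integral>\<^sup>+y. ub n y * indicator {0..<z} y \<partial>lborel)" for n and z :: real
  define neg where "neg z = ennreal (max 0 (- z))" for z :: real
  define pos where "pos z = ennreal (max 0 z)" for z :: real
  have A_def': "A n z = (\<integral>\<^sup>+y. ub n y * (indicator {0..} y * indicator {..<z} y) \<partial>lborel)" for n z
    unfolding A_def by (intro nn_integral_cong) (auto simp: indicator_def)
  have [measurable]: "A n \<in> borel_measurable borel" for n
    unfolding A_def'[abs_def] by measurable
  have [measurable]: "neg \<in> borel_measurable borel" "pos \<in> borel_measurable borel"
    unfolding neg_def[abs_def] pos_def[abs_def] by measurable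
  define I where "I n z = (\<integral>\<^sup>+a. ub n (a + z) * indicator {0..} a \<partial>lborel)" for n z
  have [measurable]: "I n \<in> borel_measurable borel" for n
    unfolding I_def[abs_def] by measurable
  have I_A: "I n z + A n z = M n + neg z" for n z
  proof -
    have I: "I n z = (\<integral>\<^sup>+y. ub n y * indicator {z..} y \<partial>lborel)"
      unfolding I_def
      by (subst (2) nn_integral_real_affine[where c=1 and t=z])
         (auto intro!: nn_integral_cong simp: indicator_def add.commute)
    show ?thesis
    proof (cases "0 \<le> z")
      case True
      have "I n z + A n z = (\<integral>\<^sup>+y. ub n y * indicator {z..} y + ub n y * indicator {0..<z} y \<partial>lborel)"
        unfolding I A_def by (rule nn_integral_add[symmetric]) measurable
      also have "\<dots> = M n"
        unfolding M_def using True by (intro nn_integral_cong) (auto simp: indicator_def)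
      finally show ?thesis using True by (simp add: neg_def)
    next
      case False
      have "I n z = (\<integral>\<^sup>+y. ub n y * indicator {0..} y + indicator {z..<0} y \<partial>lborel)"
        unfolding I using False by (intro nn_integral_cong) (auto simp: indicator_def ub_neg)
      also have "\<dots> = M n + neg z"
        unfolding M_def neg_def using False by (subst nn_integral_add) (auto simp: max_def)
      finally show ?thesis using False by (simp add: A_def)
    qed
  qed
  have M_Suc: "M (Suc n) = increment (I n)" for n
  proof -
    have "M (Suc n) = (\<integral>\<^sup>+a. increment (\<lambda>z. ub n (a + z) * indicator {0..} a) \<partial>lborel)"
      unfolding M_def by (intro nn_integral_cong) (auto simp: indicator_def ub_Suc increment_const)
    also have "\<dots> = increment (I n)"
      unfolding I_def[abs_def] by (rule increment_fubini) measurable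
    finally show ?thesis .
  qed
  have M_rec: "M (Suc n) + increment (A n) = M n + increment neg" for n
  proof -
    have "M (Suc n) + increment (A n) = increment (\<lambda>z. M n + neg z)"
      unfolding M_Suc I_A[symmetric] by (rule increment_add[symmetric]) measurable
    then show ?thesis by (simp add: increment_add increment_const)
  qed
  have expint_m: "expint l (\<lambda>_. ennreal (l1 * m)) = ennreal (l1 * m / l)"
  proof -
    have "expint l (\<lambda>_. ennreal (l1 * m / l) * (ennreal l * 1)) = ennreal (l1 * m / l) * (ennreal l * expint l (\<lambda>_. 1))"
      by (subst expint_cmult, simp, subst expint_cmult) auto
    moreover have "ennreal (l1 * m / l) * (ennreal l * 1) = ennreal (l1 * m)"
      using l_pos m(2) lam_pos by (simp add: ennreal_mult[symmetric] del: ennreal_plus)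
    ultimately show ?thesis using expint_one[OF lam_pos] by simp
  qed
  have balance: "increment pos + ennreal (l1 * m / l) = ennreal (c1 / l) + increment neg"
  proof -
    have "expint l (\<lambda>t. ennreal l * ennreal (c1 * t)) = expint l (\<lambda>t. (ennreal l * ennreal c1) * ennreal t)"
      using c_pos by (intro expint_cong) (simp add: ennreal_mult mult.assoc)
    also have "\<dots> = ennreal (c1 / l)"
      using c_pos lam_pos by (subst expint_cmult)
        (auto simp: expint_id ennreal_mult[symmetric] power2_eq_square simp del: ennreal_plus)
    finally have e1: "ennreal (c1 / l) = expint l (\<lambda>t. ennreal l * ennreal (c1 * t))" ..
    have "increment pos + expint l (\<lambda>_. ennreal (l1 * m))
        = expint l (\<lambda>t. ennreal l1 * (\<integral>\<^sup>+j. pos (c1 * t - j) \<partial>D1) + ennreal l2 * pos (c1 * t) + ennreal (l1 * m))"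
      unfolding increment_def by (rule expint_add[symmetric]) measurable
    also have "\<dots> = expint l (\<lambda>t. ennreal l * ennreal (c1 * t)
        + (ennreal l1 * (\<integral>\<^sup>+j. neg (c1 * t - j) \<partial>D1) + ennreal l2 * neg (c1 * t)))"
    proof (intro expint_cong)
      fix t :: real assume "0 \<le> t"
      then have t: "0 \<le> c1 * t" using c_pos by simp
      have "(\<integral>\<^sup>+j. pos (c1 * t - j) \<partial>D1) + ennreal m = (\<integral>\<^sup>+j. pos (c1 * t - j) + ennreal j \<partial>D1)"
        by (subst nn_integral_add) (auto simp: m)
      also have "\<dots> = (\<integral>\<^sup>+j. ennreal (c1 * t) + neg (c1 * t - j) \<partial>D1)"
        using D1_pos t by (intro nn_integral_cong_AE)
          (auto simp: pos_def neg_def max_def ennreal_plus[symmetric] simp del: ennreal_plus elim!: eventually_mono)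
      also have "\<dots> = ennreal (c1 * t) + (\<integral>\<^sup>+j. neg (c1 * t - j) \<partial>D1)"
        by (subst nn_integral_add) (auto simp: D1.emeasure_space_1)
      finally have *: "ennreal l1 * (\<integral>\<^sup>+j. pos (c1 * t - j) \<partial>D1) + ennreal (l1 * m)
          = ennreal l1 * ennreal (c1 * t) + ennreal l1 * (\<integral>\<^sup>+j. neg (c1 * t - j) \<partial>D1)"
        using l_pos m(2) by (simp add: ennreal_mult distrib_left[symmetric])
      have "pos (c1 * t) = ennreal (c1 * t)" "neg (c1 * t) = 0" using t by (auto simp: pos_def neg_def max_def)
      then show "ennreal l1 * (\<integral>\<^sup>+j. pos (c1 * t - j) \<partial>D1) + ennreal l2 * pos (c1 * t) + ennreal (l1 * m)
        = ennreal l * ennreal (c1 * t) + (ennreal l1 * (\<integral>\<^sup>+j. neg (c1 * t - j) \<partial>D1) + ennreal l2 * neg (c1 * t))"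
        using l_pos * by (simp add: distrib_right)
    qed
    also have "\<dots> = ennreal (c1 / l) + increment neg"
      unfolding increment_def e1 by (rule expint_add) measurable
    finally show ?thesis by (simp add: expint_m)
  qed
  have neg_fin: "increment neg < \<infinity>"
  proof -
    have "increment neg \<le> expint l (\<lambda>_. ennreal (l1 * m))"
      unfolding increment_def
    proof (rule expint_mono)
      fix t :: real assume "0 \<le> t"
      then have t: "0 \<le> c1 * t" using c_pos by simp
      have "(\<integral>\<^sup>+j. neg (c1 * t - j) \<partial>D1) \<le> (\<integral>\<^sup>+j. ennreal j \<partial>D1)"
        using D1_pos t by (intro nn_integral_mono_AE) (auto simp: neg_def intro!: ennreal_leI elim!: eventually_mono)
      then have "ennreal l1 * (\<integral>\<^sup>+j. neg (c1 * t - j) \<partial>D1) \<le> ennreal l1 * ennreal m"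
        by (intro mult_left_mono) (auto simp: m)
      then show "ennreal l1 * (\<integral>\<^sup>+j. neg (c1 * t - j) \<partial>D1) + ennreal l2 * neg (c1 * t) \<le> ennreal (l1 * m)"
      proof -
        have "neg (c1 * t) = 0" using t by (auto simp: neg_def max_def)
        moreover have "ennreal (l1 * m) = ennreal l1 * ennreal m" using l_pos m(2) by (simp add: ennreal_mult)
        ultimately show ?thesis using \<open>ennreal l1 * (\<integral>\<^sup>+j. neg (c1 * t - j) \<partial>D1) \<le> ennreal l1 * ennreal m\<close> by simp
      qed
    qed
    then show ?thesis unfolding expint_m by (rule le_less_trans) simp
  qed
  have M_fin: "M n < \<infinity>" for n
  proof (induction n)
    case 0
    have "M 0 = (\<integral>\<^sup>+x. 0 \<partial>(lborel :: real measure))"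
      unfolding M_def by (intro nn_integral_cong) (auto simp: ub_def surv1_upto_def surv_upto_0 indicator_def)
    then show ?case by simp
  next
    case (Suc n)
    have "M (Suc n) \<le> M n + increment neg"
      unfolding M_rec[symmetric] by (simp add: add_increasing2)
    also have "\<dots> < \<infinity>" using Suc neg_fin by simp
    finally show ?case .
  qed
  have A_le: "increment (A n) \<le> increment neg" for n
  proof -
    have "M n + increment (A n) \<le> M (Suc n) + increment (A n)"
      unfolding M_def by (intro add_right_mono nn_integral_mono mult_right_mono ub_inc) auto
    then have "M n + increment (A n) \<le> M n + increment neg" by (simp only: M_rec)
    then show ?thesis using M_fin[of n] by (simp only: ennreal_add_left_cancel_le) auto
  qed
  have "(\<lambda>n. increment (A n)) \<longlonglongrightarrow> increment pos"
  proof (rule increment_LIMSEQ)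
    show "A n z \<le> A (Suc n) z" for n z
      unfolding A_def by (intro nn_integral_mono mult_right_mono ub_inc) auto
    fix z
    have "(\<lambda>n. A n z) \<longlonglongrightarrow> (\<integral>\<^sup>+y. indicator {0..<z} y \<partial>lborel)"
      unfolding A_def
    proof (rule nn_integral_LIMSEQ)
      show "incseq (\<lambda>n y. ub n y * indicator {0..<z} y)"
        by (intro incseq_SucI le_funI mult_right_mono ub_inc) auto
      show "(\<lambda>n. ub n y * indicator {0..<z} y) \<longlonglongrightarrow> indicator {0..<z} y" for y
        using ub_lim[of y] by (auto simp: indicator_def)
    qed measurable
    also have "(\<integral>\<^sup>+y. indicator {0..<z} y \<partial>lborel) = pos z"
      by (cases "0 \<le> z") (auto simp: pos_def max_def)
    finally show "(\<lambda>n. A n z) \<longlonglongrightarrow> pos z" .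
  qed measurable
  then have "increment pos \<le> increment neg"
    by (rule LIMSEQ_le_const2) (auto intro: A_le)
  then have "increment neg + ennreal (c1 / l) \<le> increment neg + ennreal (l1 * m / l)"
    using balance by (metis add.commute add_right_mono)
  then have "ennreal (c1 / l) \<le> ennreal (l1 * m / l)"
    using neg_fin by (simp only: ennreal_add_left_cancel_le) auto
  then have "c1 / l \<le> l1 * m / l"
    using l_pos m(2) by (subst (asm) ennreal_le_iff) auto
  then show False using drift lam_pos by (simp add: divide_le_cancel)
qed

lemma surv_le_bound_mult:
  assumes bound: "\<And>x y. 0 \<le> x \<Longrightarrow> 0 \<le> y \<Longrightarrow> surv r1 r2 x y \<le> b" and x: "0 \<le> x" "0 \<le> y"
  shows "surv r1 r2 x y \<le> b * surv r1 r2 x y"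
proof -
  have "surv r1 r2 x y \<le> b * surv_upto r1 r2 n x y" for n
    using x
  proof (induction n arbitrary: x y)
    case 0
    then show ?case by (simp add: surv_upto_0 bound)
  next
    case (Suc n)
    have "surv r1 r2 x y = step r1 r2 (surv r1 r2) x y" by (rule step_surv[symmetric])
    also have "\<dots> \<le> step r1 r2 (\<lambda>x y. b * surv_upto r1 r2 n x y) x y"
      using Suc.IH Suc.prems by (rule step_mono)
    also have "\<dots> = b * surv_upto r1 r2 (Suc n) x y"
      by (simp add: step_cmult[OF measurable2_surv_upto] surv_upto_Suc)
    finally show ?case .
  qed
  moreover have "(\<lambda>n. b * surv_upto r1 r2 n x y) \<longlonglongrightarrow> b * surv r1 r2 x y" if "b < \<top>"
    by (rule ennreal_tendsto_cmult[OF that surv_upto_LIMSEQ])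
  ultimately show ?thesis
  proof (cases "b < \<top>")
    case True
    show ?thesis
      by (rule LIMSEQ_le_const[OF ennreal_tendsto_cmult[OF True surv_upto_LIMSEQ]])
         (auto intro: \<open>\<And>n. surv r1 r2 x y \<le> b * surv_upto r1 r2 n x y\<close>)
  next
    case False
    then have "b = \<top>" by (simp add: not_less top_unique)
    then show ?thesis by (cases "surv r1 r2 x y = 0") (auto simp: ennreal_top_mult)
  qed
qed

lemma tendsto_1_at_topI:
  fixes f :: "real \<Rightarrow> ennreal"
  assumes le: "\<And>x. f x \<le> 1" and mono: "\<And>x y. 0 \<le> x \<Longrightarrow> x \<le> y \<Longrightarrow> f x \<le> f y"
    and ex: "\<And>a. a < 1 \<Longrightarrow> \<exists>x\<ge>0. a < f x"
  shows "(f \<longlongrightarrow> 1) at_top"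
proof (rule order_tendstoI)
  fix a :: ennreal assume "a < 1"
  then obtain x where x: "0 \<le> x" "a < f x" using ex by blast
  show "\<forall>\<^sub>F y in at_top. a < f y"
    using eventually_ge_at_top[of x] by eventually_elim (use x mono in \<open>auto intro: less_le_trans\<close>)
next
  fix a :: ennreal assume "1 < a"
  then have "f y < a" for y by (rule le_less_trans[OF le])
  then show "\<forall>\<^sub>F y in at_top. f y < a" by simp
qed

lemma surv_inf_0_tendsto_1:
  assumes m: "(\<integral>\<^sup>+j. ennreal j \<partial>D1) = ennreal m" "0 \<le> m" and drift: "l1 * m < c1"
  shows "((\<lambda>x. surv \<infinity> 0 x 0) \<longlongrightarrow> 1) at_top"
proof (rule tendsto_1_at_topI)
  show "surv \<infinity> 0 x 0 \<le> surv \<infinity> 0 y 0" if "0 \<le> x" "x \<le> y" for x y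
    using that by (intro mono_quadrantD[OF mono_quadrant_surv]) auto
  fix a :: ennreal assume a: "a < 1"
  show "\<exists>x\<ge>0. a < surv \<infinity> 0 x 0"
  proof (rule ccontr)
    assume "\<not> ?thesis"
    then have axis: "surv \<infinity> 0 x 0 \<le> a" if "0 \<le> x" for x using that by (auto simp: not_less)
    have le: "surv \<infinity> 0 x y \<le> a * surv \<infinity> 0 x y" if "0 \<le> x" "0 \<le> y" for x y
    proof (rule surv_le_bound_mult[OF _ that])
      show "surv \<infinity> 0 x y \<le> a" if "0 \<le> x" "0 \<le> y" for x y
        by (subst surv_inf_0_indep[OF that]) (rule axis[OF that(1)])
    qed
    obtain x where x: "0 \<le> x" "0 < surv \<infinity> 0 x 0" using surv1_positive[OF m drift] by blast
    then have "a * surv \<infinity> 0 x 0 < 1 * surv \<infinity> 0 x 0"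
      using a by (intro ennreal_mult_strict_right_mono) auto
    with le[OF x(1), of 0] show False by simp
  qed
qed (rule surv_le_1)

lemma surv_swap_tendsto_1:
  assumes r: "0 \<le> r1" "r1 \<noteq> \<infinity>" "0 \<le> r2" and lim: "((\<lambda>x. surv r1 r2 x 0) \<longlongrightarrow> 1) at_top"
  shows "((\<lambda>y. surv r1 r2 0 y) \<longlongrightarrow> 1) at_top"
proof (rule tendsto_1_at_topI)
  note mono_surv = mono_quadrant_surv[OF r(1,3)]
  note mono = mono_quadrantD[OF mono_surv]
  note claim_mono = after_claim_mono[OF mono_surv] after_claim_mono[OF mono_quadrant_swap[OF mono_surv]]
  show "surv r1 r2 0 x \<le> surv r1 r2 0 y" if "0 \<le> x" "x \<le> y" for x y
    using that by (intro mono) auto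
  fix a :: ennreal assume a: "a < 1"
  show "\<exists>y\<ge>0. a < surv r1 r2 0 y"
  proof (rule ccontr)
    assume "\<not> ?thesis"
    then have le_a: "surv r1 r2 0 y \<le> a" if "0 \<le> y" for y using that by (auto simp: not_less)
    define b where "b = (SUP n::nat. surv r1 r2 0 (real n))"
    have "b \<le> a" unfolding b_def using le_a by (intro SUP_least) auto
    then have b: "b < 1" using a by simp
    then have "\<forall>\<^sub>F x in at_top. b < surv r1 r2 x 0" by (rule order_tendstoD(1)[OF lim])
    then have "\<forall>\<^sub>F x in at_top. b < surv r1 r2 x 0 \<and> 0 \<le> x"
      using eventually_ge_at_top[of "0::real"] by (rule eventually_conj)
    then obtain X where X: "b < surv r1 r2 X 0" "0 \<le> X"
      by (auto simp: eventually_at_top_linorder)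
    define T where "T = X / c1"
    define v where "v = surv r1 r2 X 0"
    have T: "0 \<le> T" using X c_pos by (simp add: T_def)
    let ?h = "\<lambda>n t. jump r1 r2 (surv r1 r2) (c1 * t) (real n + c2 * t)"
    let ?g = "\<lambda>t. ennreal l1 * b + ennreal l2 * (b + (v - b) * indicator {T..} t)"
    have b_lim: "(\<lambda>n. surv r1 r2 0 (real n)) \<longlonglongrightarrow> b"
      unfolding b_def by (rule LIMSEQ_SUP) (auto simp: incseq_def intro!: mono)
    have h_ge: "?g t \<le> (SUP n. ?h n t)" if t: "0 \<le> t" for t
    proof -
      have t': "0 \<le> c1 * t" "0 \<le> c2 * t" using t c_pos by auto
      have sup_ge: "b \<le> (SUP n. f n)" if "\<And>n. \<exists>k. surv r1 r2 0 (real n) \<le> f k" for f :: "nat \<Rightarrow> ennreal"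
        unfolding b_def using that by (intro SUP_mono) auto
      have 1: "b \<le> (SUP n. claim1 r1 (surv r1 r2) (c1 * t) (real n + c2 * t))"
      proof -
        have "b = (\<integral>\<^sup>+j. b \<partial>D1)" by (simp add: D1.emeasure_space_1)
        also have "\<dots> \<le> (\<integral>\<^sup>+j. (SUP n. after_claim r1 (surv r1 r2) (c1 * t - j) (real n + c2 * t)) \<partial>D1)"
        proof (intro nn_integral_mono sup_ge)
          fix j n
          define k where "k = nat \<lceil>real n + \<bar>real_of_ereal r1 * (c1 * t - j)\<bar>\<rceil>"
          have k: "real n + \<bar>real_of_ereal r1 * (c1 * t - j)\<bar> \<le> real k" unfolding k_def by linarith
          have "surv r1 r2 0 (real n) \<le> after_claim r1 (surv r1 r2) (c1 * t - j) (real k + c2 * t)"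
          proof (cases "0 \<le> c1 * t - j")
            case True
            then show ?thesis using k t' by (auto simp: after_claim_def intro!: mono)
          next
            case False
            have "real n \<le> real k + c2 * t + real_of_ereal r1 * (c1 * t - j)" using k t' by linarith
            then show ?thesis using False r by (auto simp: after_claim_def intro!: mono)
          qed
          then show "\<exists>k. surv r1 r2 0 (real n) \<le> after_claim r1 (surv r1 r2) (c1 * t - j) (real k + c2 * t)" ..
        qed
        also have "\<dots> = (SUP n. claim1 r1 (surv r1 r2) (c1 * t) (real n + c2 * t))"
          unfolding claim1_def
        proof (rule nn_integral_monotone_convergence_SUP)
          show "incseq (\<lambda>n j. after_claim r1 (surv r1 r2) (c1 * t - j) (real n + c2 * t))"
            by (intro incseq_SucI le_funI claim_mono) (use t' r in auto)
        qed measurable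
        finally show ?thesis .
      qed
      have 2: "b + (v - b) * indicator {T..} t \<le> (SUP n. claim2 r2 (surv r1 r2) (c1 * t) (real n + c2 * t))"
      proof -
        have "b + (v - b) * indicator {T..} t = (\<integral>\<^sup>+j. b + (v - b) * indicator {T..} t \<partial>D2)"
          by (simp add: D2.emeasure_space_1)
        also have "\<dots> \<le> (\<integral>\<^sup>+j. (SUP n. after_claim r2 (\<lambda>x y. surv r1 r2 y x) (real n + c2 * t - j) (c1 * t)) \<partial>D2)"
        proof (intro nn_integral_mono)
          fix j
          let ?f = "\<lambda>n. after_claim r2 (\<lambda>x y. surv r1 r2 y x) (real n + c2 * t - j) (c1 * t)"
          have ge: "\<exists>k. surv r1 r2 (c1 * t) (real n) \<le> ?f k" for n
          proof -
            define k where "k = nat \<lceil>real n + \<bar>j\<bar>\<rceil>"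
            have k: "real n + \<bar>j\<bar> \<le> real k" unfolding k_def by linarith
            then have *: "real n \<le> real k + c2 * t - j" using t' by linarith
            then have "\<not> real k + c2 * t - j < 0" by linarith
            then have "?f k = surv r1 r2 (c1 * t) (real k + c2 * t - j)"
              by (simp add: after_claim_def)
            moreover have "surv r1 r2 (c1 * t) (real n) \<le> surv r1 r2 (c1 * t) (real k + c2 * t - j)"
              using t' * by (intro mono) auto
            ultimately have "surv r1 r2 (c1 * t) (real n) \<le> ?f k" by simp
            then show ?thesis ..
          qed
          show "b + (v - b) * indicator {T..} t \<le> (SUP n. ?f n)"
          proof (cases "T \<le> t")
            case True
            then have "X \<le> c1 * t" using c_pos by (simp add: T_def field_simps)
            then have "v \<le> surv r1 r2 (c1 * t) (real 0)" unfolding v_def using X by (intro mono) auto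
            also obtain k where "surv r1 r2 (c1 * t) (real 0) \<le> ?f k" using ge[of 0] by blast
            also have "?f k \<le> (SUP n. ?f n)" by (rule SUP_upper) simp
            finally have "v \<le> (SUP n. ?f n)" .
            then show ?thesis using True less_imp_le[OF X(1)] by (simp add: v_def add_diff_self_ennreal)
          next
            case False
            have "b \<le> (SUP n. ?f n)"
            proof (rule sup_ge)
              fix n
              obtain k where "surv r1 r2 (c1 * t) (real n) \<le> ?f k" using ge[of n] by blast
              moreover have "surv r1 r2 0 (real n) \<le> surv r1 r2 (c1 * t) (real n)" using t' by (intro mono) auto
              ultimately show "\<exists>k. surv r1 r2 0 (real n) \<le> ?f k" using order_trans by blast
            qed
            then show ?thesis using False by simp
          qed
        qed
        also have "\<dots> = (SUP n. claim2 r2 (surv r1 r2) (c1 * t) (real n + c2 * t))"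
          unfolding claim2_def
        proof (rule nn_integral_monotone_convergence_SUP)
          show "incseq (\<lambda>n j. after_claim r2 (\<lambda>x y. surv r1 r2 y x) (real n + c2 * t - j) (c1 * t))"
            by (intro incseq_SucI le_funI claim_mono) (use t' r in auto)
        qed measurable
        finally show ?thesis .
      qed
      have "?g t \<le> ennreal l1 * (SUP n. claim1 r1 (surv r1 r2) (c1 * t) (real n + c2 * t))
          + ennreal l2 * (SUP n. claim2 r2 (surv r1 r2) (c1 * t) (real n + c2 * t))"
        by (intro add_mono mult_left_mono 1 2) auto
      also have "\<dots> = (SUP n. ?h n t)"
        unfolding jump_def SUP_mult_left_ennreal
      proof (rule ennreal_SUP_add[symmetric])
        show "incseq (\<lambda>n. ennreal l1 * claim1 r1 (surv r1 r2) (c1 * t) (real n + c2 * t))"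
          unfolding claim1_def
          by (intro incseq_SucI mult_left_mono nn_integral_mono claim_mono) (use t' r c_pos in auto)
        show "incseq (\<lambda>n. ennreal l2 * claim2 r2 (surv r1 r2) (c1 * t) (real n + c2 * t))"
          unfolding claim2_def
          by (intro incseq_SucI mult_left_mono nn_integral_mono claim_mono)
             (use t' r c_pos in auto)
      qed
      finally show ?thesis .
    qed
    have "expint l ?g \<le> expint l (\<lambda>t. SUP n. ?h n t)"
      using h_ge by (rule expint_mono)
    also have "\<dots> = (SUP n. expint l (?h n))"
    proof -
      have inc: "?h n t \<le> ?h (Suc n) t" if "0 \<le> t" for n t
        unfolding jump_def claim1_def claim2_def using that r c_pos
        by (intro add_mono mult_left_mono nn_integral_mono claim_mono) auto
      have "expint l (\<lambda>t. SUP n. ?h n t)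
          = (\<integral>\<^sup>+t. (SUP n. ennreal (exp (- l * t)) * ?h n t * indicator {0..} t) \<partial>lborel)"
        unfolding expint_def by (intro nn_integral_cong) (simp add: SUP_mult_left_ennreal SUP_mult_right_ennreal)
      also have "\<dots> = (SUP n. expint l (?h n))"
        unfolding expint_def
      proof (rule nn_integral_monotone_convergence_SUP)
        show "incseq (\<lambda>n t. ennreal (exp (- l * t)) * ?h n t * indicator {0..} t)"
        proof (intro incseq_SucI le_funI)
          fix n t
          show "ennreal (exp (- l * t)) * ?h n t * indicator {0..} t \<le> ennreal (exp (- l * t)) * ?h (Suc n) t * indicator {0..} t"
            using inc[of t n] by (cases "0 \<le> t") (auto intro: mult_left_mono)
        qed
      qed measurable
      finally show ?thesis .
    qed
    also have "\<dots> \<le> b"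
    proof (rule SUP_least)
      fix n
      have "expint l (?h n) = surv r1 r2 0 (real n)"
        using surv_eq_ray[of r1 r2 0 "real n"] by (simp add: ray_def)
      then show "expint l (?h n) \<le> b" unfolding b_def by (auto intro: SUP_upper)
    qed
    finally have *: "expint l ?g \<le> b" .
    have "expint l ?g = expint l (\<lambda>t. (b * ennreal l) * 1 + (ennreal l2 * (v - b)) * (1 * indicator {T..} t))"
    proof (intro expint_cong)
      fix t
      have "ennreal l = ennreal l1 + ennreal l2" using l_pos by simp
      then show "?g t = (b * ennreal l) * 1 + (ennreal l2 * (v - b)) * (1 * indicator {T..} t)"
        by (simp only: distrib_left mult_1_right mult_1_left ac_simps)
    qed
    also have "\<dots> = b * (ennreal l * expint l (\<lambda>_. 1)) + (ennreal l2 * (v - b)) * expint l (\<lambda>t. 1 * indicator {T..} t)"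
      by (subst expint_add, measurable, subst expint_cmult, simp, subst expint_cmult) (simp_all add: mult.assoc)
    also have "expint l (\<lambda>t. 1 * indicator {T..} t) = ennreal (exp (- l * T)) * expint l (\<lambda>_. 1)"
      using T by (subst expint_shift) auto
    also have "ennreal l * expint l (\<lambda>_. 1) = 1" by (rule expint_one[OF lam_pos])
    finally have "expint l ?g = b + ennreal l2 * (v - b) * (ennreal (exp (- l * T)) * expint l (\<lambda>_. 1))" by simp
    with * have "b + ennreal l2 * (v - b) * (ennreal (exp (- l * T)) * expint l (\<lambda>_. 1)) \<le> b + 0" by simp
    then have "ennreal l2 * (v - b) * (ennreal (exp (- l * T)) * expint l (\<lambda>_. 1)) = 0"
      using b by (simp only: ennreal_add_left_cancel_le) auto
    moreover have "v - b \<noteq> 0" using X by (auto simp: v_def diff_eq_0_iff_ennreal)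
    moreover have "expint l (\<lambda>_. 1) \<noteq> 0" using expint_one[OF lam_pos] by auto
    ultimately show False using l_pos by auto
  qed
qed (rule surv_le_1)

text \<open>Company 1 gives up premium at rate \<kappa>, which company 2 receives at rate \<kappa> / \<rho>. If both
  companies then survive on their own, the coupled model survives; the inequality is inclusion-exclusion for
  these two events.\<close>

lemma surv_upto_inf_lower_bound:
  fixes \<rho> \<kappa> :: real
  assumes A: "coupled_risk (c1 - \<kappa>) c2 l1 l2 D1 D2" and B: "coupled_risk (c2 + \<kappa> / \<rho>) c1 l2 l1 D2 D1"
    and \<rho>: "0 < \<rho>" and \<kappa>: "0 \<le> \<kappa>"
    and "0 \<le> a" "0 \<le> b" "a \<le> x" "0 \<le> y" "a + \<rho> * b \<le> x + \<rho> * y"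
  shows "coupled_risk.surv1_upto (c1 - \<kappa>) c2 l1 l2 D1 D2 n a
      + coupled_risk.surv1_upto (c2 + \<kappa> / \<rho>) c1 l2 l1 D2 D1 n b \<le> surv_upto \<infinity> (ereal \<rho>) n x y + 1"
  using assms(5-)
proof (induction n arbitrary: a b x y)
  case 0
  interpret A: coupled_risk "c1 - \<kappa>" c2 l1 l2 D1 D2 by (rule A)
  interpret B: coupled_risk "c2 + \<kappa> / \<rho>" c1 l2 l1 D2 D1 by (rule B)
  show ?case
    unfolding surv_upto_0 by (intro add_mono A.surv1_upto_le_1 B.surv1_upto_le_1)
next
  case (Suc n)
  interpret A: coupled_risk "c1 - \<kappa>" c2 l1 l2 D1 D2 by (rule A)
  interpret B: coupled_risk "c2 + \<kappa> / \<rho>" c1 l2 l1 D2 D1 by (rule B)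
  let ?q = "A.surv1_upto n" and ?p = "B.surv1_upto n" and ?s = "surv_upto \<infinity> (ereal \<rho>) n"
  have le1: "?q z \<le> 1" "?p z \<le> 1" for z by (rule A.surv1_upto_le_1, rule B.surv1_upto_le_1)
  have "A.surv1_upto (Suc n) a + B.surv1_upto (Suc n) b
    = expint l (\<lambda>t. (ennreal l1 * (\<integral>\<^sup>+j. ?q (a + ((c1 - \<kappa>) * t - j)) \<partial>D1) + ennreal l2 * ?q (a + (c1 - \<kappa>) * t))
        + (ennreal l2 * (\<integral>\<^sup>+j. ?p (b + ((c2 + \<kappa> / \<rho>) * t - j)) \<partial>D2) + ennreal l1 * ?p (b + (c2 + \<kappa> / \<rho>) * t)))"
    unfolding A.surv1_upto_Suc[OF Suc.prems(1)] B.surv1_upto_Suc[OF Suc.prems(2)] A.increment_def B.increment_def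
    by (subst add.commute[of l2 l1], rule expint_add[symmetric]) measurable
  also have "\<dots> \<le> expint l (\<lambda>t. jump \<infinity> (ereal \<rho>) ?s (x + c1 * t) (y + c2 * t) + ennreal l * 1)"
  proof (rule expint_mono)
    fix t :: real assume t: "0 \<le> t"
    define a' b' x' y' where "a' = a + (c1 - \<kappa>) * t" and "b' = b + (c2 + \<kappa> / \<rho>) * t"
      and "x' = x + c1 * t" and "y' = y + c2 * t"
    have kt: "0 \<le> \<kappa> * t" using \<kappa> t by simp
    have a': "0 \<le> a'" using Suc.prems t A.c_pos by (simp add: a'_def)
    have b': "0 \<le> b'" using Suc.prems t B.c_pos by (simp add: b'_def)
    have x': "a' \<le> x'" using Suc.prems kt by (simp add: a'_def x'_def algebra_simps)
    have y': "0 \<le> y'" using Suc.prems t c_pos by (simp add: y'_def)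
    have "\<rho> * (\<kappa> / \<rho> * t) = \<kappa> * t" using \<rho> by simp
    then have s': "a' + \<rho> * b' \<le> x' + \<rho> * y'"
      using Suc.prems by (simp add: a'_def b'_def x'_def y'_def algebra_simps)
    have 1: "(\<integral>\<^sup>+j. ?q (a' - j) \<partial>D1) + ?p b' \<le> claim1 \<infinity> ?s x' y' + 1"
    proof -
      have "(\<integral>\<^sup>+j. ?q (a' - j) \<partial>D1) + ?p b' = (\<integral>\<^sup>+j. ?q (a' - j) + ?p b' \<partial>D1)"
        by (subst nn_integral_add) (auto simp: D1.emeasure_space_1)
      also have "\<dots> \<le> (\<integral>\<^sup>+j. after_claim \<infinity> ?s (x' - j) y' + 1 \<partial>D1)"
      proof (intro nn_integral_mono)
        fix j
        show "?q (a' - j) + ?p b' \<le> after_claim \<infinity> ?s (x' - j) y' + 1"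
        proof (cases "0 \<le> a' - j")
          case True
          then have "?q (a' - j) + ?p b' \<le> ?s (x' - j) y' + 1"
            using x' b' y' s' by (intro Suc.IH) auto
          then show ?thesis using True x' by (simp add: after_claim_def)
        next
          case False
          then have "?q (a' - j) = 0" by (simp add: A.surv1_upto_def)
          then show ?thesis using le1(2)[of b'] by (simp add: add_increasing)
        qed
      qed
      also have "\<dots> = claim1 \<infinity> ?s x' y' + 1"
        unfolding claim1_def by (subst nn_integral_add) (auto simp: D1.emeasure_space_1 measurable2_surv_upto)
      finally show ?thesis .
    qed
    have 2: "?q a' + (\<integral>\<^sup>+j. ?p (b' - j) \<partial>D2) \<le> claim2 (ereal \<rho>) ?s x' y' + 1"
    proof -
      have ms: "measurable2 (\<lambda>x y. ?s y x)" by (rule measurable2_swap[OF measurable2_surv_upto])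
      have "?q a' + (\<integral>\<^sup>+j. ?p (b' - j) \<partial>D2) = (\<integral>\<^sup>+j. ?q a' + ?p (b' - j) \<partial>D2)"
        by (subst nn_integral_add) (auto simp: D2.emeasure_space_1)
      also have "\<dots> \<le> (\<integral>\<^sup>+j. after_claim (ereal \<rho>) (\<lambda>x y. ?s y x) (y' - j) x' + 1 \<partial>D2)"
      proof (rule nn_integral_mono_AE, use D2_pos in eventually_elim)
        fix j :: real assume j: "0 < j"
        show "?q a' + ?p (b' - j) \<le> after_claim (ereal \<rho>) (\<lambda>x y. ?s y x) (y' - j) x' + 1"
        proof (cases "0 \<le> b' - j")
          case True
          have s'': "a' + \<rho> * (b' - j) \<le> x' + \<rho> * (y' - j)" using s' by (simp add: algebra_simps)
          show ?thesis
          proof (cases "0 \<le> y' - j")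
            case y: True
            have "?q a' + ?p (b' - j) \<le> ?s x' (y' - j) + 1"
              using a' True x' y s'' by (intro Suc.IH) auto
            then show ?thesis using y by (simp add: after_claim_def)
          next
            case False
            have *: "a' \<le> x' + \<rho> * (y' - j)" using s'' True \<rho> mult_nonneg_nonneg[of \<rho> "b' - j"] by linarith
            have "?q a' + ?p (b' - j) \<le> ?s (x' + \<rho> * (y' - j)) 0 + 1"
              using a' True * s'' by (intro Suc.IH) auto
            moreover have "\<not> x' + \<rho> * (y' - j) < 0" using * a' by linarith
            ultimately show ?thesis using False unfolding after_claim_def by simp
          qed
        next
          case False
          then have "?p (b' - j) = 0" by (simp add: B.surv1_upto_def)
          then show ?thesis using le1(1)[of a'] by (simp add: add_increasing)
        qed
      qed
      also have "\<dots> = claim2 (ereal \<rho>) ?s x' y' + 1"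
        unfolding claim2_def using ms by (subst nn_integral_add) (auto simp: D2.emeasure_space_1)
      finally show ?thesis .
    qed
    have "ennreal l1 * (\<integral>\<^sup>+j. ?q (a' - j) \<partial>D1) + ennreal l2 * ?q a'
        + (ennreal l2 * (\<integral>\<^sup>+j. ?p (b' - j) \<partial>D2) + ennreal l1 * ?p b')
        = ennreal l1 * ((\<integral>\<^sup>+j. ?q (a' - j) \<partial>D1) + ?p b') + ennreal l2 * (?q a' + (\<integral>\<^sup>+j. ?p (b' - j) \<partial>D2))"
      by (simp only: distrib_left ac_simps)
    also have "\<dots> \<le> ennreal l1 * (claim1 \<infinity> ?s x' y' + 1) + ennreal l2 * (claim2 (ereal \<rho>) ?s x' y' + 1)"
      by (intro add_mono mult_left_mono 1 2) auto
    also have "\<dots> = jump \<infinity> (ereal \<rho>) ?s x' y' + ennreal l * 1"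
    proof -
      have "ennreal l = ennreal l1 + ennreal l2" using l_pos by simp
      then show ?thesis unfolding jump_def by (simp only: distrib_left mult_1_right ac_simps)
    qed
    finally show "ennreal l1 * (\<integral>\<^sup>+j. ?q (a + ((c1 - \<kappa>) * t - j)) \<partial>D1) + ennreal l2 * ?q (a + (c1 - \<kappa>) * t)
        + (ennreal l2 * (\<integral>\<^sup>+j. ?p (b + ((c2 + \<kappa> / \<rho>) * t - j)) \<partial>D2) + ennreal l1 * ?p (b + (c2 + \<kappa> / \<rho>) * t))
      \<le> jump \<infinity> (ereal \<rho>) ?s (x + c1 * t) (y + c2 * t) + ennreal l * 1"
      unfolding a'_def b'_def x'_def y'_def by (simp only: add_diff_eq)
  qed
  also have "\<dots> = surv_upto \<infinity> (ereal \<rho>) (Suc n) x y + ennreal l * expint l (\<lambda>_. 1)"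
    unfolding surv_upto_Suc step_def ray_def
    by (subst expint_add) (auto simp: expint_cmult measurable2_surv_upto simp del: mult_1_right)
  finally show ?case using expint_one[OF lam_pos] by simp
qed

lemma surv_inf_tendsto_1:
  fixes \<rho> :: real
  assumes m1: "(\<integral>\<^sup>+j. ennreal j \<partial>D1) = ennreal m1" "0 \<le> m1" and m2: "(\<integral>\<^sup>+j. ennreal j \<partial>D2) = ennreal m2" "0 \<le> m2"
    and \<rho>: "0 < \<rho>" and drift: "l1 * m1 < c1" "\<rho> * (l2 * m2 - c2) < c1 - l1 * m1"
  shows "((\<lambda>x. surv \<infinity> (ereal \<rho>) x 0) \<longlongrightarrow> 1) at_top"
proof (rule tendsto_1_at_topI)
  define \<kappa> where "\<kappa> = (max 0 (\<rho> * (l2 * m2 - c2)) + (c1 - l1 * m1)) / 2"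
  have \<kappa>: "0 < \<kappa>" "\<rho> * (l2 * m2 - c2) < \<kappa>" "\<kappa> < c1 - l1 * m1"
    using drift by (auto simp: \<kappa>_def max_def field_simps)
  have "0 \<le> l1 * m1" using l_pos m1 by simp
  then have c1': "0 < c1 - \<kappa>" using \<kappa> by linarith
  have c2': "0 < c2 + \<kappa> / \<rho>" using c_pos \<kappa> \<rho> by (simp add: add_pos_pos)
  have A: "coupled_risk (c1 - \<kappa>) c2 l1 l2 D1 D2"
    by unfold_locales (use c1' c_pos l_pos D1_pos D2_pos in auto)
  have B: "coupled_risk (c2 + \<kappa> / \<rho>) c1 l2 l1 D2 D1"
    by unfold_locales (use c2' c_pos l_pos D1_pos D2_pos in auto)
  interpret A: coupled_risk "c1 - \<kappa>" c2 l1 l2 D1 D2 by (rule A)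
  interpret B: coupled_risk "c2 + \<kappa> / \<rho>" c1 l2 l1 D2 D1 by (rule B)
  have bound: "A.surv \<infinity> 0 (x / 2) 0 + B.surv \<infinity> 0 (x / (2 * \<rho>)) 0 \<le> surv \<infinity> (ereal \<rho>) x 0 + 1" if x: "0 \<le> x" for x
  proof (rule LIMSEQ_le_const)
    show "(\<lambda>n. surv_upto \<infinity> (ereal \<rho>) n x 0 + 1) \<longlonglongrightarrow> surv \<infinity> (ereal \<rho>) x 0 + 1"
      by (intro tendsto_add surv_upto_LIMSEQ tendsto_const)
    have "A.surv \<infinity> 0 (x / 2) 0 + B.surv \<infinity> 0 (x / (2 * \<rho>)) 0 \<le> surv_upto \<infinity> (ereal \<rho>) n x 0 + 1" for n
    proof -
      have "A.surv \<infinity> 0 (x / 2) 0 + B.surv \<infinity> 0 (x / (2 * \<rho>)) 0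
          \<le> A.surv1_upto n (x / 2) + B.surv1_upto n (x / (2 * \<rho>))"
        using x \<rho> by (intro add_mono)
          (auto simp: A.surv1_upto_def B.surv1_upto_def A.surv_le_surv_upto B.surv_le_surv_upto not_less divide_less_0_iff)
      also have "\<dots> \<le> surv_upto \<infinity> (ereal \<rho>) n x 0 + 1"
        using x \<rho> \<kappa> by (intro surv_upto_inf_lower_bound[OF A B]) auto
      finally show ?thesis .
    qed
    then show "\<exists>N. \<forall>n\<ge>N. A.surv \<infinity> 0 (x / 2) 0 + B.surv \<infinity> 0 (x / (2 * \<rho>)) 0 \<le> surv_upto \<infinity> (ereal \<rho>) n x 0 + 1"
      by blast
  qed
  have div: "LIM x at_top. x / k :> at_top" if "0 < k" for k :: real
    unfolding filterlim_at_top
  proof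
    fix Z
    show "\<forall>\<^sub>F x in at_top. Z \<le> x / k"
      using eventually_ge_at_top[of "Z * k"] by eventually_elim (use that in \<open>simp add: field_simps\<close>)
  qed
  have limA: "((\<lambda>x. A.surv \<infinity> 0 (x / 2) 0) \<longlongrightarrow> 1) at_top"
    using \<kappa> by (intro filterlim_compose[OF A.surv_inf_0_tendsto_1[OF m1]]) (auto intro!: div)
  have limB: "((\<lambda>x. B.surv \<infinity> 0 (x / (2 * \<rho>)) 0) \<longlongrightarrow> 1) at_top"
  proof (rule filterlim_compose[OF B.surv_inf_0_tendsto_1[OF m2]])
    show "l2 * m2 < c2 + \<kappa> / \<rho>" using \<kappa>(2) \<rho> by (simp add: field_simps)
    show "LIM x at_top. x / (2 * \<rho>) :> at_top" using \<rho> by (intro div) auto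
  qed
  show "surv \<infinity> (ereal \<rho>) x 0 \<le> surv \<infinity> (ereal \<rho>) y 0" if "0 \<le> x" "x \<le> y" for x y
    using that \<rho> by (intro mono_quadrantD[OF mono_quadrant_surv]) auto
  fix a :: ennreal assume a: "a < 1"
  show "\<exists>x\<ge>0. a < surv \<infinity> (ereal \<rho>) x 0"
  proof (rule ccontr)
    assume "\<not> ?thesis"
    then have le: "surv \<infinity> (ereal \<rho>) x 0 \<le> a" if "0 \<le> x" for x using that by (auto simp: not_less)
    have "1 + 1 \<le> a + 1"
    proof (rule tendsto_upperbound[OF tendsto_add[OF limA limB]])
      show "\<forall>\<^sub>F x in at_top. A.surv \<infinity> 0 (x / 2) 0 + B.surv \<infinity> 0 (x / (2 * \<rho>)) 0 \<le> a + 1"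
        using eventually_ge_at_top[of 0]
        by eventually_elim (use bound le add_right_mono order_trans in blast)
    qed simp
    then have "1 + 1 \<le> 1 + a" by (simp only: add.commute)
    then show False using a by (simp only: ennreal_add_left_cancel_le) auto
  qed
qed (rule surv_le_1)

end

context coupled_risk
begin

lemma surv_tendsto_1_rate:
  assumes "((\<lambda>x. surv r1' r2' x 0) \<longlongrightarrow> 1) at_top" "0 \<le> r1" "r1 \<le> r1'" "0 \<le> r2" "r2 \<le> r2'"
  shows "((\<lambda>x. surv r1 r2 x 0) \<longlongrightarrow> 1) at_top"
proof (rule tendsto_sandwich[OF _ _ assms(1) tendsto_const])
  show "\<forall>\<^sub>F x in at_top. surv r1' r2' x 0 \<le> surv r1 r2 x 0"
    using eventually_ge_at_top[of 0] by eventually_elim (use assms in \<open>auto intro: surv_rate_antimono\<close>)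
qed (simp add: surv_le_1)

lemma surv_axis_formulas:
  assumes N: "nonneg_measure N" and r: "0 < r1" "0 < r2"
    and cdfN: "\<And>x. 0 \<le> x \<Longrightarrow> emeasure N {..x} = surv r1 0 x 0"
    and lim1: "((\<lambda>x. surv r1 r2 x 0) \<longlongrightarrow> 1) at_top"
  shows "0 \<le> x \<Longrightarrow> surv r1 r2 x 0 = conv1 N (surv 0 r2) x 0"
    and "r1 = \<infinity> \<Longrightarrow> 0 \<le> y \<Longrightarrow> surv r1 r2 0 y = surv r1 0 0 0 * surv 0 r2 0 y"
proof -
  interpret N: nonneg_measure N by fact
  have "((\<lambda>y. surv 0 r2 0 y) \<longlongrightarrow> 1) at_top"
    using r by (intro surv_swap_tendsto_1 surv_tendsto_1_rate[OF lim1]) auto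
  then have "((\<lambda>y. swapped.surv r2 0 y 0) \<longlongrightarrow> 1) at_top" by (simp add: swapped_surv)
  from swapped.nonneg_measure_of_axis[OF less_imp_le[OF r(2)] order_refl this]
  obtain K where K: "nonneg_measure K" and cdfK: "\<And>y. 0 \<le> y \<Longrightarrow> emeasure K {..y} = surv 0 r2 0 y"
    by (auto simp: swapped_surv)
  interpret K: nonneg_measure K by fact
  have lim2: "r1 = \<infinity> \<or> ((\<lambda>y. surv r1 r2 0 y) \<longlongrightarrow> 1) at_top"
    using surv_swap_tendsto_1[OF less_imp_le[OF r(1)] _ less_imp_le[OF r(2)] lim1] by auto
  have main: "surv r1 r2 x y = mixture N K r1 r2 x y" if "0 \<le> x" "0 \<le> y" for x y
    using that by (intro surv_eq_mixture[OF N K r _ _ lim1 lim2] cdfN cdfK)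
  show "surv r1 r2 x 0 = conv1 N (surv 0 r2) x 0" if "0 \<le> x"
    using main[OF that order_refl] mixture_axis1[OF N K that cdfN] by simp
  assume r1: "r1 = \<infinity>" and y: "0 \<le> y"
  have "conv1 N (surv 0 r2) 0 y = emeasure N {..0} * emeasure K {..y}"
    using y by (simp add: N.conv1_0 cdfK)
  moreover have "conv2 K (surv r1 0) 0 y = surv r1 0 0 0 * emeasure K {..y}"
  proof -
    have "conv2 K (surv r1 0) 0 y = (\<integral>\<^sup>+v. surv r1 0 0 0 * indicator {..y} v \<partial>K)"
      unfolding conv2_def conv1_def
    proof (intro nn_integral_cong)
      fix v
      show "surv r1 0 0 (y - v) * indicator {..y} v = surv r1 0 0 0 * indicator {..y} v"
        using surv_inf_0_indep[of 0 "y - v"] by (auto simp: r1 indicator_def)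
    qed
    then show ?thesis by (simp add: nn_integral_cmult_indicator)
  qed
  ultimately have "surv r1 r2 0 y = emeasure N {..0} * emeasure K {..y} + surv r1 0 0 0 * emeasure K {..y}
      - emeasure N {..0} * emeasure K {..y}"
    using main[OF order_refl y] unfolding mixture_def by (simp only:)
  also have "\<dots> = surv r1 0 0 0 * emeasure K {..y}"
    by (rule ennreal_add_diff_cancel_left) (simp add: ennreal_mult_eq_top_iff)
  finally show "surv r1 r2 0 y = surv r1 0 0 0 * surv 0 r2 0 y"
    using cdfK[OF y] by (simp only:)
qed

lemma surv_inf_0_origin_pos:
  assumes "((\<lambda>x. surv \<infinity> 0 x 0) \<longlongrightarrow> 1) at_top"
  shows "0 < surv \<infinity> 0 0 0"
proof -
  have "\<forall>\<^sub>F x in at_top. 0 < surv \<infinity> 0 x 0" using assms by (rule order_tendstoD) simp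
  then have "\<forall>\<^sub>F x in at_top. 0 < surv \<infinity> 0 x 0 \<and> 0 \<le> x"
    using eventually_ge_at_top[of "0::real"] by (rule eventually_conj)
  then obtain x where x: "0 < surv \<infinity> 0 x 0" "0 \<le> x"
    by (auto simp: eventually_at_top_linorder)
  define s where "s = x / c1"
  have s: "0 \<le> s" "c1 * s = x" using x c_pos by (auto simp: s_def)
  have "surv \<infinity> 0 x (c2 * s) = surv \<infinity> 0 x 0"
    using x s c_pos by (intro surv_inf_0_indep) auto
  then have "0 < ennreal (exp (- l * s)) * surv \<infinity> 0 (0 + c1 * s) (0 + c2 * s)"
    using x s by (simp add: ennreal_zero_less_mult_iff)
  also have "\<dots> \<le> surv \<infinity> 0 0 0" by (rule surv_shift_le[OF s(1)])
  finally show ?thesis .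
qed

end

context coupled_risk
begin

lemma surv_tendsto_1:
  fixes \<rho>1 \<rho>2 :: real
  assumes m1: "(\<integral>\<^sup>+j. ennreal j \<partial>D1) = ennreal m1" "0 \<le> m1" and m2: "(\<integral>\<^sup>+j. ennreal j \<partial>D2) = ennreal m2" "0 \<le> m2"
    and \<rho>: "0 < \<rho>1" "0 < \<rho>2"
    and safe: "l1 * m1 < c1 \<and> \<rho>2 * (l2 * m2 - c2) < c1 - l1 * m1
      \<or> l2 * m2 < c2 \<and> \<rho>1 * (l1 * m1 - c1) < c2 - l2 * m2"
  shows "((\<lambda>x. surv (ereal \<rho>1) (ereal \<rho>2) x 0) \<longlongrightarrow> 1) at_top"
  using safe
proof
  assume "l1 * m1 < c1 \<and> \<rho>2 * (l2 * m2 - c2) < c1 - l1 * m1"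
  then show ?thesis
    using surv_inf_tendsto_1[OF m1 m2 \<rho>(2)] \<rho> by (auto intro: surv_tendsto_1_rate)
next
  assume "l2 * m2 < c2 \<and> \<rho>1 * (l1 * m1 - c1) < c2 - l2 * m2"
  then have "((\<lambda>y. swapped.surv \<infinity> (ereal \<rho>1) y 0) \<longlongrightarrow> 1) at_top"
    using swapped.surv_inf_tendsto_1[OF m2 m1 \<rho>(1)] by auto
  then have "((\<lambda>y. swapped.surv (ereal \<rho>2) (ereal \<rho>1) y 0) \<longlongrightarrow> 1) at_top"
    using \<rho> by (auto intro: swapped.surv_tendsto_1_rate)
  then have "((\<lambda>x. swapped.surv (ereal \<rho>2) (ereal \<rho>1) 0 x) \<longlongrightarrow> 1) at_top"
    using \<rho> by (intro swapped.surv_swap_tendsto_1) auto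
  then show ?thesis by (simp add: swapped_surv)
qed

lemma surv_no_help_2:
  fixes \<rho>1 :: real
  assumes m1: "(\<integral>\<^sup>+j. ennreal j \<partial>D1) = ennreal m1" "0 \<le> m1" and m2: "(\<integral>\<^sup>+j. ennreal j \<partial>D2) = ennreal m2" "0 \<le> m2"
    and \<rho>: "0 < \<rho>1" and safe: "l2 * m2 < c2" "\<rho>1 * (l1 * m1 - c1) < c2 - l2 * m2"
  shows "0 \<le> x \<Longrightarrow> surv (ereal \<rho>1) \<infinity> x 0 = surv 0 \<infinity> 0 0 * surv (ereal \<rho>1) 0 x 0"
    and "0 < surv 0 \<infinity> 0 0"
proof -
  have lim: "((\<lambda>y. swapped.surv \<infinity> (ereal \<rho>1) y 0) \<longlongrightarrow> 1) at_top"
    using swapped.surv_inf_tendsto_1[OF m2 m1 \<rho> safe] by auto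
  then have lim0: "((\<lambda>y. swapped.surv \<infinity> 0 y 0) \<longlongrightarrow> 1) at_top"
    using \<rho> by (auto intro: swapped.surv_tendsto_1_rate)
  obtain N where "nonneg_measure N" "\<And>y. 0 \<le> y \<Longrightarrow> emeasure N {..y} = swapped.surv \<infinity> 0 y 0"
    using swapped.nonneg_measure_of_axis[OF _ _ lim0] by auto
  from swapped.surv_axis_formulas(2)[OF this(1) _ _ this(2) lim refl] \<rho>
  show "surv (ereal \<rho>1) \<infinity> x 0 = surv 0 \<infinity> 0 0 * surv (ereal \<rho>1) 0 x 0" if "0 \<le> x"
    using that by (simp add: swapped_surv)
  show "0 < surv 0 \<infinity> 0 0"
    using swapped.surv_inf_0_origin_pos[OF lim0] by (simp add: swapped_surv)
qed

end

section \<open>From claim sequences to the first-claim operator\<close>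

definition age :: "real \<Rightarrow> (nat \<Rightarrow> real \<times> real) \<Rightarrow> nat \<Rightarrow> real \<times> real" where
  "age s e = e(0 := (fst (e 0) - s, snd (e 0)))"

primrec alive :: "real \<Rightarrow> real \<Rightarrow> ereal \<Rightarrow> ereal \<Rightarrow> nat \<Rightarrow> (nat \<Rightarrow> real \<times> real) \<Rightarrow> (nat \<Rightarrow> real \<times> real)
    \<Rightarrow> real \<Rightarrow> real \<Rightarrow> ennreal" where
  "alive c1 c2 r1 r2 0 e1 e2 = (\<lambda>_ _. 1)"
| "alive c1 c2 r1 r2 (Suc n) e1 e2 = (\<lambda>x1 x2.
     if fst (e1 0) \<le> fst (e2 0)
     then after_claim r1 (alive c1 c2 r1 r2 n (e1 \<circ> Suc) (age (fst (e1 0)) e2))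
            (x1 + c1 * fst (e1 0) - snd (e1 0)) (x2 + c2 * fst (e1 0))
     else after_claim r2 (\<lambda>x y. alive c1 c2 r1 r2 n (age (fst (e2 0)) e1) (e2 \<circ> Suc) y x)
            (x2 + c2 * fst (e2 0) - snd (e2 0)) (x1 + c1 * fst (e2 0)))"

lemma alive_01: "alive c1 c2 r1 r2 n e1 e2 x1 x2 = 0 \<or> alive c1 c2 r1 r2 n e1 e2 x1 x2 = 1"
  by (induction n arbitrary: e1 e2 x1 x2) (auto simp: after_claim_def)

lemma age_case_nat: "age s (case_nat (t, j) e) = case_nat (t - s, j) e"
  by (auto simp: age_def fun_eq_iff split: nat.split)

lemma case_nat_comp_Suc: "case_nat a e \<circ> Suc = e"
  by (auto simp: fun_eq_iff)

abbreviation marks :: "(nat \<Rightarrow> real \<times> real) measure" where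
  "marks \<equiv> \<Pi>\<^sub>M k\<in>UNIV. borel \<Otimes>\<^sub>M borel"

lemma space_marks[simp]: "space marks = UNIV"
  by (simp add: space_PiM space_pair_measure)

lemma measurable_age[measurable (raw)]:
  assumes [measurable]: "f \<in> borel_measurable N" "g \<in> measurable N marks"
  shows "(\<lambda>w. age (f w) (g w)) \<in> measurable N marks"
proof -
  have [measurable]: "(\<lambda>w. g w k) \<in> measurable N (borel \<Otimes>\<^sub>M borel)" for k
    using measurable_compose[OF assms(2) measurable_component_singleton[of k]] by simp
  have "(\<lambda>w. age (f w) (g w) k) \<in> measurable N (borel \<Otimes>\<^sub>M borel)" for k
    by (cases k) (simp_all add: age_def)
  then show ?thesis
    by (intro measurable_PiM_single') (auto simp: space_pair_measure)
qed

lemma measurable_marks_Suc[measurable (raw)]: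
  assumes [measurable]: "g \<in> measurable N marks"
  shows "(\<lambda>w. g w \<circ> Suc) \<in> measurable N marks"
proof -
  have "(\<lambda>w. g w (Suc k)) \<in> measurable N (borel \<Otimes>\<^sub>M borel)" for k
    using measurable_compose[OF assms measurable_component_singleton[of "Suc k"]] by simp
  then show ?thesis
    by (intro measurable_PiM_single') (auto simp: space_pair_measure)
qed

lemma after_claim_param_measurable:
  assumes h: "(\<lambda>(p, x, y). h p x y) \<in> borel_measurable (P \<Otimes>\<^sub>M borel \<Otimes>\<^sub>M borel)"
    and [measurable]: "k \<in> measurable N P" "f \<in> borel_measurable N" "g \<in> borel_measurable N"
  shows "(\<lambda>w. after_claim r (h (k w)) (f w) (g w)) \<in> borel_measurable N"
proof -
  have [measurable]: "(\<lambda>w. h (k w) (a w) (b w)) \<in> borel_measurable N"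
    if [measurable]: "a \<in> borel_measurable N" "b \<in> borel_measurable N" for a b
    using measurable_compose[OF _ h, of "\<lambda>w. (k w, a w, b w)" N] by simp
  show ?thesis unfolding after_claim_def by measurable
qed

lemma alive_measurable_aux:
  "(\<lambda>((e1, e2), x, y). alive c1 c2 r1 r2 n e1 e2 x y) \<in> borel_measurable ((marks \<Otimes>\<^sub>M marks) \<Otimes>\<^sub>M borel \<Otimes>\<^sub>M borel)"
proof (induction n)
  case (Suc n)
  let ?N = "(marks \<Otimes>\<^sub>M marks) \<Otimes>\<^sub>M borel \<Otimes>\<^sub>M (borel :: real measure)"
  define h where "h p x y = alive c1 c2 r1 r2 n (fst p) (snd p) x y" for p x y
  have h: "(\<lambda>(p, x, y). h p x y) \<in> borel_measurable ?N"
    using Suc.IH unfolding h_def by (simp add: split_beta')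
  have h': "(\<lambda>(p, x, y). h p y x) \<in> borel_measurable ?N"
    using measurable_compose[OF _ h, of "\<lambda>(p, x, y). (p, y, x)" ?N] by (simp add: split_beta')
  define e1 e2 where "e1 = (\<lambda>w::((nat \<Rightarrow> real \<times> real) \<times> (nat \<Rightarrow> real \<times> real)) \<times> real \<times> real. fst (fst w))"
    and "e2 = (\<lambda>w::((nat \<Rightarrow> real \<times> real) \<times> (nat \<Rightarrow> real \<times> real)) \<times> real \<times> real. snd (fst w))"
  have [measurable]: "e1 \<in> measurable ?N marks" "e2 \<in> measurable ?N marks"
    unfolding e1_def e2_def by measurable
  have [measurable]: "(\<lambda>w. e1 w 0) \<in> measurable ?N (borel \<Otimes>\<^sub>M borel)" "(\<lambda>w. e2 w 0) \<in> measurable ?N (borel \<Otimes>\<^sub>M borel)"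
    using measurable_compose[OF _ measurable_component_singleton[of "0::nat" UNIV "\<lambda>_. borel \<Otimes>\<^sub>M (borel :: real measure)"]]
    by (auto intro: \<open>e1 \<in> measurable ?N marks\<close> \<open>e2 \<in> measurable ?N marks\<close>)
  have "(\<lambda>w. if fst (e1 w 0) \<le> fst (e2 w 0)
      then after_claim r1 (h (e1 w \<circ> Suc, age (fst (e1 w 0)) (e2 w)))
        (fst (snd w) + c1 * fst (e1 w 0) - snd (e1 w 0)) (snd (snd w) + c2 * fst (e1 w 0))
      else after_claim r2 (\<lambda>x y. h (age (fst (e2 w 0)) (e1 w), e2 w \<circ> Suc) y x)
        (snd (snd w) + c2 * fst (e2 w 0) - snd (e2 w 0)) (fst (snd w) + c1 * fst (e2 w 0))) \<in> borel_measurable ?N"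
  proof (rule measurable_If)
    show "(\<lambda>w. after_claim r1 (h (e1 w \<circ> Suc, age (fst (e1 w 0)) (e2 w)))
        (fst (snd w) + c1 * fst (e1 w 0) - snd (e1 w 0)) (snd (snd w) + c2 * fst (e1 w 0))) \<in> borel_measurable ?N"
      by (rule after_claim_param_measurable[OF h]) measurable
    show "(\<lambda>w. after_claim r2 (\<lambda>x y. h (age (fst (e2 w 0)) (e1 w), e2 w \<circ> Suc) y x)
        (snd (snd w) + c2 * fst (e2 w 0) - snd (e2 w 0)) (fst (snd w) + c1 * fst (e2 w 0))) \<in> borel_measurable ?N"
      by (rule after_claim_param_measurable[OF h']) measurable
  qed measurable
  then show ?case
    unfolding h_def e1_def e2_def by (simp add: split_beta' cong: if_cong)
qed simp

lemma alive_measurable[measurable (raw)]: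
  assumes [measurable]: "f \<in> measurable N marks" "g \<in> measurable N marks" "a \<in> borel_measurable N" "b \<in> borel_measurable N"
  shows "(\<lambda>w. alive c1 c2 r1 r2 n (f w) (g w) (a w) (b w)) \<in> borel_measurable N"
  using measurable_compose[OF _ alive_measurable_aux, of "\<lambda>w. ((f w, g w), a w, b w)" N] by simp

lemma after_claim_alive_measurable[measurable (raw)]:
  assumes [measurable]: "f \<in> measurable N marks" "g \<in> measurable N marks" "a \<in> borel_measurable N" "b \<in> borel_measurable N"
  shows "(\<lambda>w. after_claim r (alive c1 c2 r1 r2 n (f w) (g w)) (a w) (b w)) \<in> borel_measurable N"
    and "(\<lambda>w. after_claim r (\<lambda>x y. alive c1 c2 r1 r2 n (f w) (g w) y x) (a w) (b w)) \<in> borel_measurable N"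
  unfolding after_claim_def by measurable

lemma measurable_marks_component[measurable (raw)]:
  assumes "f \<in> measurable N marks"
  shows "(\<lambda>w. f w k) \<in> measurable N (borel \<Otimes>\<^sub>M borel)"
  using measurable_compose[OF assms measurable_component_singleton[of k]] by simp

abbreviation exp_law :: "real \<Rightarrow> real measure" where
  "exp_law q \<equiv> density lborel (\<lambda>t. ennreal (exponential_density q t))"

lemma nn_integral_exp_law:
  assumes [measurable]: "g \<in> borel_measurable borel" and q: "0 < q"
  shows "(\<integral>\<^sup>+t. g t \<partial>exp_law q) = ennreal q * expint q g"
proof -
  have "(\<integral>\<^sup>+t. g t \<partial>exp_law q) = (\<integral>\<^sup>+t. ennreal (exponential_density q t) * g t \<partial>lborel)"
    by (subst nn_integral_density) auto
  also have "\<dots> = (\<integral>\<^sup>+t. ennreal q * (ennreal (exp (- q * t)) * g t * indicator {0..} t) \<partial>lborel)"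
    using q by (intro nn_integral_cong)
      (auto simp: exponential_density_def indicator_def ennreal_mult mult.assoc algebra_simps)
  also have "\<dots> = ennreal q * expint q g"
    unfolding expint_def by (rule nn_integral_cmult) measurable
  finally show ?thesis .
qed

lemma exp_law_memoryless:
  assumes [measurable]: "g \<in> borel_measurable borel" and q: "0 < q" and s: "0 \<le> s"
  shows "(\<integral>\<^sup>+t. g (t - s) * indicator {s..} t \<partial>exp_law q) = ennreal (exp (- q * s)) * (\<integral>\<^sup>+t. g t \<partial>exp_law q)"
    and "(\<integral>\<^sup>+t. g (t - s) * indicator {s<..} t \<partial>exp_law q) = ennreal (exp (- q * s)) * (\<integral>\<^sup>+t. g t \<partial>exp_law q)"
proof -
  have "(\<integral>\<^sup>+t. g (t - s) * indicator {s..} t \<partial>exp_law q) = ennreal q * (ennreal (exp (- q * s)) * expint q (\<lambda>t. g (s + t - s)))"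
    using s q by (subst nn_integral_exp_law) (auto simp: expint_shift)
  then show *: "(\<integral>\<^sup>+t. g (t - s) * indicator {s..} t \<partial>exp_law q) = ennreal (exp (- q * s)) * (\<integral>\<^sup>+t. g t \<partial>exp_law q)"
    using q by (simp add: nn_integral_exp_law mult.left_commute)
  have "AE t in lborel. t \<noteq> s" by (rule AE_lborel_singleton)
  then have "AE t in exp_law q. t \<noteq> s"
    by (subst AE_density) (auto elim: eventually_mono)
  then have "(\<integral>\<^sup>+t. g (t - s) * indicator {s<..} t \<partial>exp_law q) = (\<integral>\<^sup>+t. g (t - s) * indicator {s..} t \<partial>exp_law q)"
    by (intro nn_integral_cong_AE) (auto simp: indicator_def elim!: eventually_mono)
  with * show "(\<integral>\<^sup>+t. g (t - s) * indicator {s<..} t \<partial>exp_law q) = ennreal (exp (- q * s)) * (\<integral>\<^sup>+t. g t \<partial>exp_law q)"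
    by simp
qed

lemma nn_integral_PiM_case_nat:
  fixes \<mu> :: "'b measure"
  assumes \<mu>: "prob_space \<mu>" and [measurable]: "f \<in> borel_measurable (\<Pi>\<^sub>M k\<in>(UNIV :: nat set). \<mu>)"
  shows "(\<integral>\<^sup>+e. f e \<partial>(\<Pi>\<^sub>M k\<in>UNIV. \<mu>)) = (\<integral>\<^sup>+m. \<integral>\<^sup>+e. f (case_nat m e) \<partial>(\<Pi>\<^sub>M k\<in>UNIV. \<mu>) \<partial>\<mu>)"
proof -
  interpret prob_space \<mu> by fact
  interpret S: sequence_space \<mu> ..
  have "(\<integral>\<^sup>+e. f e \<partial>(\<Pi>\<^sub>M k\<in>UNIV. \<mu>)) = (\<integral>\<^sup>+e. f e \<partial>distr (\<mu> \<Otimes>\<^sub>M S.S) S.S (\<lambda>(s, \<omega>). case_nat s \<omega>))"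
    by (simp add: S.PiM_iter)
  also have "\<dots> = (\<integral>\<^sup>+p. f (case_nat (fst p) (snd p)) \<partial>(\<mu> \<Otimes>\<^sub>M S.S))"
    by (subst nn_integral_distr) (auto simp: split_beta')
  also have "\<dots> = (\<integral>\<^sup>+m. \<integral>\<^sup>+e. f (case_nat m e) \<partial>S.S \<partial>\<mu>)"
    by (subst S.P.nn_integral_fst[symmetric]) auto
  finally show ?thesis .
qed

context coupled_risk
begin

definition mark1 :: "(real \<times> real) measure" where "mark1 = exp_law l1 \<Otimes>\<^sub>M D1"
definition mark2 :: "(real \<times> real) measure" where "mark2 = exp_law l2 \<Otimes>\<^sub>M D2"
definition path1 :: "(nat \<Rightarrow> real \<times> real) measure" where "path1 = (\<Pi>\<^sub>M k\<in>UNIV. mark1)"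
definition path2 :: "(nat \<Rightarrow> real \<times> real) measure" where "path2 = (\<Pi>\<^sub>M k\<in>UNIV. mark2)"

lemma sets_mark[measurable_cong]: "sets mark1 = sets (borel \<Otimes>\<^sub>M borel)" "sets mark2 = sets (borel \<Otimes>\<^sub>M borel)"
  unfolding mark1_def mark2_def by (auto intro!: sets_pair_measure_cong)

lemma sets_path[measurable_cong]: "sets path1 = sets marks" "sets path2 = sets marks"
  unfolding path1_def path2_def by (auto intro!: sets_PiM_cong simp: sets_mark)

sublocale E1: prob_space "exp_law l1" using l_pos(1) by (rule prob_space_exponential_density)
sublocale E2: prob_space "exp_law l2" using l_pos(2) by (rule prob_space_exponential_density)
sublocale P1: pair_prob_space "exp_law l1" D1 ..
sublocale P2: pair_prob_space "exp_law l2" D2 ..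

lemma prob_space_mark: "prob_space mark1" "prob_space mark2"
  unfolding mark1_def mark2_def by (rule P1.prob_space_axioms, rule P2.prob_space_axioms)

lemma prob_space_path: "prob_space path1" "prob_space path2"
  unfolding path1_def path2_def by (auto intro!: prob_space_PiM prob_space_mark)

sublocale m1: prob_space mark1 by (rule prob_space_mark)
sublocale m2: prob_space mark2 by (rule prob_space_mark)
sublocale p1: prob_space path1 by (rule prob_space_path)
sublocale p2: prob_space path2 by (rule prob_space_path)

lemma nn_integral_path1:
  assumes [measurable]: "f \<in> borel_measurable marks"
  shows "(\<integral>\<^sup>+e. f e \<partial>path1) = (\<integral>\<^sup>+s. \<integral>\<^sup>+j. \<integral>\<^sup>+e. f (case_nat (s, j) e) \<partial>path1 \<partial>D1 \<partial>exp_law l1)"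
proof -
  have [measurable]: "f \<in> borel_measurable path1" by measurable
  have "(\<integral>\<^sup>+e. f e \<partial>path1) = (\<integral>\<^sup>+m. \<integral>\<^sup>+e. f (case_nat m e) \<partial>path1 \<partial>mark1)"
    using nn_integral_PiM_case_nat[OF prob_space_mark(1), of f] unfolding path1_def[symmetric] by simp
  also have "\<dots> = (\<integral>\<^sup>+s. \<integral>\<^sup>+j. \<integral>\<^sup>+e. f (case_nat (s, j) e) \<partial>path1 \<partial>D1 \<partial>exp_law l1)"
    unfolding mark1_def by (subst D1.nn_integral_fst[symmetric]) auto
  finally show ?thesis .
qed

lemma nn_integral_path2:
  assumes [measurable]: "f \<in> borel_measurable marks"
  shows "(\<integral>\<^sup>+e. f e \<partial>path2) = (\<integral>\<^sup>+s. \<integral>\<^sup>+j. \<integral>\<^sup>+e. f (case_nat (s, j) e) \<partial>path2 \<partial>D2 \<partial>exp_law l2)"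
proof -
  have [measurable]: "f \<in> borel_measurable path2" by measurable
  have "(\<integral>\<^sup>+e. f e \<partial>path2) = (\<integral>\<^sup>+m. \<integral>\<^sup>+e. f (case_nat m e) \<partial>path2 \<partial>mark2)"
    using nn_integral_PiM_case_nat[OF prob_space_mark(2), of f] unfolding path2_def[symmetric] by simp
  also have "\<dots> = (\<integral>\<^sup>+s. \<integral>\<^sup>+j. \<integral>\<^sup>+e. f (case_nat (s, j) e) \<partial>path2 \<partial>D2 \<partial>exp_law l2)"
    unfolding mark2_def by (subst D2.nn_integral_fst[symmetric]) auto
  finally show ?thesis .
qed

lemma expint_absorb_exp:
  "expint p (\<lambda>t. ennreal (exp (- q * t)) * h t) = expint (p + q) h"
  unfolding expint_def
proof (intro nn_integral_cong)
  fix t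
  have "ennreal (exp (- p * t)) * ennreal (exp (- q * t)) = ennreal (exp (- (p + q) * t))"
    by (simp add: ennreal_mult[symmetric] exp_add[symmetric] algebra_simps)
  then show "ennreal (exp (- p * t)) * (ennreal (exp (- q * t)) * h t) * indicator {0..} t
      = ennreal (exp (- (p + q) * t)) * h t * indicator {0..} t"
    by (simp only: mult.assoc[symmetric])
qed

lemma residual_clock:
  assumes h: "\<And>u v. (\<lambda>(e1, e2). h e1 e2 u v) \<in> borel_measurable (marks \<Otimes>\<^sub>M marks)"
    and I: "I = atLeast \<or> I = greaterThan" and s: "0 \<le> s"
  shows "(\<integral>\<^sup>+e1. \<integral>\<^sup>+t. \<integral>\<^sup>+j. \<integral>\<^sup>+e2. after_claim r (h e1 (case_nat (t - s, j) e2)) y z * indicator (I s) t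
      \<partial>path2 \<partial>D2 \<partial>exp_law l2 \<partial>path1)
    = ennreal (exp (- l2 * s)) * after_claim r (\<lambda>u v. \<integral>\<^sup>+e1. \<integral>\<^sup>+e2. h e1 e2 u v \<partial>path2 \<partial>path1) y z"
proof -
  have hm[measurable (raw)]: "(\<lambda>w. h (f w) (g w) u v) \<in> borel_measurable N"
    if [measurable]: "f \<in> measurable N marks" "g \<in> measurable N marks" for f g N u v
    using measurable_compose[OF _ h[of u v], of "\<lambda>w. (f w, g w)" N] by simp
  have [measurable]: "I s \<in> sets borel" using I by auto
  interpret pq: pair_sigma_finite path1 "exp_law l2" ..
  define g where "g u v t = (\<integral>\<^sup>+e1. \<integral>\<^sup>+j. \<integral>\<^sup>+e2. h e1 (case_nat (t, j) e2) u v \<partial>path2 \<partial>D2 \<partial>path1)" for u v t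
  have [measurable]: "g u v \<in> borel_measurable borel" for u v
    unfolding g_def[abs_def] by measurable
  have "(\<integral>\<^sup>+e1. \<integral>\<^sup>+t. \<integral>\<^sup>+j. \<integral>\<^sup>+e2. h e1 (case_nat (t - s, j) e2) u v * indicator (I s) t
      \<partial>path2 \<partial>D2 \<partial>exp_law l2 \<partial>path1)
    = ennreal (exp (- l2 * s)) * (\<integral>\<^sup>+e1. \<integral>\<^sup>+e2. h e1 e2 u v \<partial>path2 \<partial>path1)" for u v
  proof -
    have "(\<integral>\<^sup>+e1. \<integral>\<^sup>+t. \<integral>\<^sup>+j. \<integral>\<^sup>+e2. h e1 (case_nat (t - s, j) e2) u v * indicator (I s) t
        \<partial>path2 \<partial>D2 \<partial>exp_law l2 \<partial>path1)
      = (\<integral>\<^sup>+t. \<integral>\<^sup>+e1. \<integral>\<^sup>+j. \<integral>\<^sup>+e2. h e1 (case_nat (t - s, j) e2) u v * indicator (I s) t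
        \<partial>path2 \<partial>D2 \<partial>path1 \<partial>exp_law l2)"
      by (rule pq.Fubini'[symmetric]) measurable
    also have "\<dots> = (\<integral>\<^sup>+t. g u v (t - s) * indicator (I s) t \<partial>exp_law l2)"
      unfolding g_def by (intro nn_integral_cong) (auto simp: indicator_def)
    also have "\<dots> = ennreal (exp (- l2 * s)) * (\<integral>\<^sup>+t. g u v t \<partial>exp_law l2)"
      using I exp_law_memoryless[OF _ l_pos(2) s, of "g u v"] by auto
    also have "(\<integral>\<^sup>+t. g u v t \<partial>exp_law l2)
        = (\<integral>\<^sup>+e1. \<integral>\<^sup>+t. \<integral>\<^sup>+j. \<integral>\<^sup>+e2. h e1 (case_nat (t, j) e2) u v \<partial>path2 \<partial>D2 \<partial>exp_law l2 \<partial>path1)"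
      unfolding g_def by (rule pq.Fubini') measurable
    also have "\<dots> = (\<integral>\<^sup>+e1. \<integral>\<^sup>+e2. h e1 e2 u v \<partial>path2 \<partial>path1)"
      by (intro nn_integral_cong nn_integral_path2[symmetric]) (auto intro!: hm simp: sets_eq_imp_space_eq[OF sets_path(1)])
    finally show ?thesis .
  qed
  moreover have "(\<integral>\<^sup>+e1. \<integral>\<^sup>+t. \<integral>\<^sup>+j. \<integral>\<^sup>+e2. after_claim r (h e1 (case_nat (t - s, j) e2)) y z * indicator (I s) t
      \<partial>path2 \<partial>D2 \<partial>exp_law l2 \<partial>path1)
    = after_claim r (\<lambda>u v. \<integral>\<^sup>+e1. \<integral>\<^sup>+t. \<integral>\<^sup>+j. \<integral>\<^sup>+e2. h e1 (case_nat (t - s, j) e2) u v * indicator (I s) t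
      \<partial>path2 \<partial>D2 \<partial>exp_law l2 \<partial>path1) y z"
    by (auto simp: after_claim_def)
  ultimately show ?thesis
    by (simp add: after_claim_cmult)
qed

lemma first_claim_by_1:
  assumes h: "(\<lambda>((e1, e2), u, v). h e1 e2 u v) \<in> borel_measurable ((marks \<Otimes>\<^sub>M marks) \<Otimes>\<^sub>M borel \<Otimes>\<^sub>M borel)"
    and I: "I = atLeast \<or> I = greaterThan"
  shows "(\<integral>\<^sup>+e1. \<integral>\<^sup>+e2. after_claim r (h (e1 \<circ> Suc) (age (fst (e1 0)) e2))
        (x + c1 * fst (e1 0) - snd (e1 0)) (y + c2 * fst (e1 0)) * indicator (I (fst (e1 0))) (fst (e2 0)) \<partial>path2 \<partial>path1)
    = expint l (\<lambda>s. ennreal l1 * claim1 r (\<lambda>u v. \<integral>\<^sup>+e1. \<integral>\<^sup>+e2. h e1 e2 u v \<partial>path2 \<partial>path1) (x + c1 * s) (y + c2 * s))"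
proof -
  define H where "H = (\<lambda>u v. \<integral>\<^sup>+e1. \<integral>\<^sup>+e2. h e1 e2 u v \<partial>path2 \<partial>path1)"
  have hm[measurable (raw)]: "(\<lambda>w. h (f w) (g w) (a w) (b w)) \<in> borel_measurable N"
    if [measurable]: "f \<in> measurable N marks" "g \<in> measurable N marks" "a \<in> borel_measurable N" "b \<in> borel_measurable N" for f g a b N
    using measurable_compose[OF _ h, of "\<lambda>w. ((f w, g w), a w, b w)" N] by simp
  have acm[measurable (raw)]: "(\<lambda>w. after_claim r (h (f w) (g w)) (a w) (b w)) \<in> borel_measurable N"
    if [measurable]: "f \<in> measurable N marks" "g \<in> measurable N marks" "a \<in> borel_measurable N" "b \<in> borel_measurable N" for f g a b N
    unfolding after_claim_def by measurable
  have [measurable]: "measurable2 H" unfolding H_def by measurable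
  have I_meas[measurable (raw)]: "(\<lambda>w. indicator (I (a w)) (b w) :: ennreal) \<in> borel_measurable N"
    if [measurable]: "a \<in> borel_measurable N" "b \<in> borel_measurable N" for a b and N :: "'z measure"
    using I by (elim disjE) simp_all
  let ?A = "\<lambda>e1 e2. after_claim r (h (e1 \<circ> Suc) (age (fst (e1 0)) e2))
        (x + c1 * fst (e1 0) - snd (e1 0)) (y + c2 * fst (e1 0)) * indicator (I (fst (e1 0))) (fst (e2 0))"
  have "(\<integral>\<^sup>+e1. \<integral>\<^sup>+e2. ?A e1 e2 \<partial>path2 \<partial>path1)
      = (\<integral>\<^sup>+s. \<integral>\<^sup>+j1. \<integral>\<^sup>+e1. \<integral>\<^sup>+e2. ?A (case_nat (s, j1) e1) e2 \<partial>path2 \<partial>path1 \<partial>D1 \<partial>exp_law l1)"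
    by (rule nn_integral_path1) measurable
  also have "\<dots> = (\<integral>\<^sup>+s. \<integral>\<^sup>+j1. \<integral>\<^sup>+e1. \<integral>\<^sup>+t. \<integral>\<^sup>+j2. \<integral>\<^sup>+e2. ?A (case_nat (s, j1) e1) (case_nat (t, j2) e2)
      \<partial>path2 \<partial>D2 \<partial>exp_law l2 \<partial>path1 \<partial>D1 \<partial>exp_law l1)"
    by (intro nn_integral_cong nn_integral_path2) measurable
  also have "\<dots> = (\<integral>\<^sup>+s. \<integral>\<^sup>+j1. \<integral>\<^sup>+e1. \<integral>\<^sup>+t. \<integral>\<^sup>+j2. \<integral>\<^sup>+e2.
      after_claim r (h e1 (case_nat (t - s, j2) e2)) (x + c1 * s - j1) (y + c2 * s) * indicator (I s) t
      \<partial>path2 \<partial>D2 \<partial>exp_law l2 \<partial>path1 \<partial>D1 \<partial>exp_law l1)"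
    by (simp add: age_case_nat case_nat_comp_Suc)
  also have "\<dots> = ennreal l1 * expint l1 (\<lambda>s. \<integral>\<^sup>+j1. \<integral>\<^sup>+e1. \<integral>\<^sup>+t. \<integral>\<^sup>+j2. \<integral>\<^sup>+e2.
      after_claim r (h e1 (case_nat (t - s, j2) e2)) (x + c1 * s - j1) (y + c2 * s) * indicator (I s) t
      \<partial>path2 \<partial>D2 \<partial>exp_law l2 \<partial>path1 \<partial>D1)"
    by (rule nn_integral_exp_law[OF _ l_pos(1)]) measurable
  also have "\<dots> = ennreal l1 * expint l1 (\<lambda>s. ennreal (exp (- l2 * s)) * claim1 r H (x + c1 * s) (y + c2 * s))"
  proof (intro arg_cong[where f="\<lambda>z. ennreal l1 * z"] expint_cong)
    fix s :: real assume s: "0 \<le> s"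
    have "(\<integral>\<^sup>+j1. \<integral>\<^sup>+e1. \<integral>\<^sup>+t. \<integral>\<^sup>+j2. \<integral>\<^sup>+e2.
      after_claim r (h e1 (case_nat (t - s, j2) e2)) (x + c1 * s - j1) (y + c2 * s) * indicator (I s) t
      \<partial>path2 \<partial>D2 \<partial>exp_law l2 \<partial>path1 \<partial>D1)
      = (\<integral>\<^sup>+j1. ennreal (exp (- l2 * s)) * after_claim r H (x + c1 * s - j1) (y + c2 * s) \<partial>D1)"
      unfolding H_def by (intro nn_integral_cong residual_clock[OF _ I s]) measurable
    also have "\<dots> = ennreal (exp (- l2 * s)) * claim1 r H (x + c1 * s) (y + c2 * s)"
      unfolding claim1_def by (rule nn_integral_cmult) measurable
    finally show "(\<integral>\<^sup>+j1. \<integral>\<^sup>+e1. \<integral>\<^sup>+t. \<integral>\<^sup>+j2. \<integral>\<^sup>+e2.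
      after_claim r (h e1 (case_nat (t - s, j2) e2)) (x + c1 * s - j1) (y + c2 * s) * indicator (I s) t
      \<partial>path2 \<partial>D2 \<partial>exp_law l2 \<partial>path1 \<partial>D1)
      = ennreal (exp (- l2 * s)) * claim1 r H (x + c1 * s) (y + c2 * s)" .
  qed
  also have "\<dots> = expint l (\<lambda>s. ennreal l1 * claim1 r H (x + c1 * s) (y + c2 * s))"
    unfolding expint_absorb_exp by (rule expint_cmult[symmetric]) measurable
  finally show ?thesis unfolding H_def .
qed

end

context coupled_risk
begin

theorem nn_integral_alive:
  "(\<integral>\<^sup>+e1. \<integral>\<^sup>+e2. alive c1 c2 r1 r2 n e1 e2 x y \<partial>path2 \<partial>path1) = surv_upto r1 r2 n x y"
proof (induction n arbitrary: x y)
  case 0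
  show ?case by (simp add: surv_upto_0 p1.emeasure_space_1 p2.emeasure_space_1)
next
  case (Suc n)
  interpret pp: pair_sigma_finite path1 path2 ..
  let ?a = "alive c1 c2 r1 r2 n"
  let ?A = "\<lambda>e1 e2. after_claim r1 (?a (e1 \<circ> Suc) (age (fst (e1 0)) e2))
        (x + c1 * fst (e1 0) - snd (e1 0)) (y + c2 * fst (e1 0)) * indicator {fst (e1 0)..} (fst (e2 0))"
  let ?B = "\<lambda>e1 e2. after_claim r2 (\<lambda>u v. ?a (age (fst (e2 0)) e1) (e2 \<circ> Suc) v u)
        (y + c2 * fst (e2 0) - snd (e2 0)) (x + c1 * fst (e2 0)) * indicator {fst (e2 0)<..} (fst (e1 0))"
  have mA[measurable]: "(\<lambda>(e1, e2). ?A e1 e2) \<in> borel_measurable (marks \<Otimes>\<^sub>M marks)"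
    unfolding after_claim_def by measurable
  have mB[measurable]: "(\<lambda>(e1, e2). ?B e1 e2) \<in> borel_measurable (marks \<Otimes>\<^sub>M marks)"
    unfolding after_claim_def by measurable
  have "(\<integral>\<^sup>+e1. \<integral>\<^sup>+e2. alive c1 c2 r1 r2 (Suc n) e1 e2 x y \<partial>path2 \<partial>path1)
      = (\<integral>\<^sup>+e1. \<integral>\<^sup>+e2. ?A e1 e2 + ?B e1 e2 \<partial>path2 \<partial>path1)"
    by (intro nn_integral_cong) (auto simp: indicator_def)
  also have "\<dots> = (\<integral>\<^sup>+e1. \<integral>\<^sup>+e2. ?A e1 e2 \<partial>path2 \<partial>path1) + (\<integral>\<^sup>+e1. \<integral>\<^sup>+e2. ?B e1 e2 \<partial>path2 \<partial>path1)"
  proof -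
    have "(\<integral>\<^sup>+e1. \<integral>\<^sup>+e2. ?A e1 e2 + ?B e1 e2 \<partial>path2 \<partial>path1)
        = (\<integral>\<^sup>+e1. (\<integral>\<^sup>+e2. ?A e1 e2 \<partial>path2) + (\<integral>\<^sup>+e2. ?B e1 e2 \<partial>path2) \<partial>path1)"
      by (intro nn_integral_cong nn_integral_add) measurable
    also have "\<dots> = (\<integral>\<^sup>+e1. \<integral>\<^sup>+e2. ?A e1 e2 \<partial>path2 \<partial>path1) + (\<integral>\<^sup>+e1. \<integral>\<^sup>+e2. ?B e1 e2 \<partial>path2 \<partial>path1)"
      by (rule nn_integral_add) measurable
    finally show ?thesis .
  qed
  also have "(\<integral>\<^sup>+e1. \<integral>\<^sup>+e2. ?A e1 e2 \<partial>path2 \<partial>path1)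
      = expint l (\<lambda>s. ennreal l1 * claim1 r1 (surv_upto r1 r2 n) (x + c1 * s) (y + c2 * s))"
  proof -
    have "(\<lambda>u v. \<integral>\<^sup>+e1. \<integral>\<^sup>+e2. ?a e1 e2 u v \<partial>path2 \<partial>path1) = surv_upto r1 r2 n"
      by (intro ext Suc.IH)
    then show ?thesis
      using first_claim_by_1[of ?a atLeast r1 x y, OF alive_measurable_aux] by simp
  qed
  also have "(\<integral>\<^sup>+e1. \<integral>\<^sup>+e2. ?B e1 e2 \<partial>path2 \<partial>path1) = (\<integral>\<^sup>+e2. \<integral>\<^sup>+e1. ?B e1 e2 \<partial>path1 \<partial>path2)"
    by (rule pp.Fubini'[symmetric]) measurable
  also have "\<dots> = expint l (\<lambda>s. ennreal l2 * claim2 r2 (surv_upto r1 r2 n) (x + c1 * s) (y + c2 * s))"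
  proof -
    have "(\<integral>\<^sup>+e2. \<integral>\<^sup>+e1. ?a e1 e2 v u \<partial>path1 \<partial>path2) = (\<integral>\<^sup>+e1. \<integral>\<^sup>+e2. ?a e1 e2 v u \<partial>path2 \<partial>path1)" for u v
      by (rule pp.Fubini') measurable
    then have IH': "(\<lambda>u v. \<integral>\<^sup>+e2. \<integral>\<^sup>+e1. ?a e1 e2 v u \<partial>path1 \<partial>path2) = (\<lambda>u v. surv_upto r1 r2 n v u)"
      by (intro ext) (simp add: Suc.IH)
    have paths: "swapped.path1 = path2" "swapped.path2 = path1"
      by (simp_all add: swapped.path1_def swapped.path2_def path1_def path2_def
          swapped.mark1_def swapped.mark2_def mark1_def mark2_def)
    have m: "(\<lambda>((e2, e1), u, v). ?a e1 e2 v u) \<in> borel_measurable ((marks \<Otimes>\<^sub>M marks) \<Otimes>\<^sub>M borel \<Otimes>\<^sub>M borel)"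
      unfolding split_beta' by measurable
    show ?thesis
      using swapped.first_claim_by_1[of "\<lambda>e2 e1 u v. ?a e1 e2 v u" greaterThan r2 y x, OF m]
      unfolding paths IH' claim2_swap by (simp add: add.commute)
  qed
  also have "expint l (\<lambda>s. ennreal l1 * claim1 r1 (surv_upto r1 r2 n) (x + c1 * s) (y + c2 * s))
      + expint l (\<lambda>s. ennreal l2 * claim2 r2 (surv_upto r1 r2 n) (x + c1 * s) (y + c2 * s))
      = surv_upto r1 r2 (Suc n) x y"
    unfolding surv_upto_Suc step_def ray_def jump_def
    using measurable2_surv_upto[measurable] by (subst expint_add) auto
  finally show ?case .
qed

end

definition env :: "(nat \<Rightarrow> nat \<Rightarrow> 'a \<Rightarrow> real) \<Rightarrow> (nat \<Rightarrow> nat \<Rightarrow> 'a \<Rightarrow> real) \<Rightarrow> nat \<Rightarrow> 'a \<Rightarrow> nat \<Rightarrow> real \<times> real" where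
  "env W J i \<omega> = (\<lambda>k. (W i k \<omega>, J i k \<omega>))"

definition env_from :: "(nat \<Rightarrow> nat \<Rightarrow> 'a \<Rightarrow> real) \<Rightarrow> (nat \<Rightarrow> nat \<Rightarrow> 'a \<Rightarrow> real) \<Rightarrow> nat \<Rightarrow> 'a \<Rightarrow> real \<Rightarrow> nat \<Rightarrow> nat \<Rightarrow> real \<times> real" where
  "env_from W J i \<omega> \<tau> k = (\<lambda>m. if m = 0 then (arr W i k \<omega> - \<tau>, J i k \<omega>) else (W i (k + m) \<omega>, J i (k + m) \<omega>))"

lemma env_from_0: "env_from W J i \<omega> 0 0 = env W J i \<omega>"
  by (auto simp: env_from_def env_def arr_def)

lemma env_from_Suc: "env_from W J i \<omega> \<tau> k \<circ> Suc = env_from W J i \<omega> (arr W i k \<omega>) (Suc k)"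
  by (auto simp: env_from_def arr_def fun_eq_iff)

lemma age_env_from: "age (t - \<tau>) (env_from W J i \<omega> \<tau> k) = env_from W J i \<omega> t k"
  by (auto simp: env_from_def age_def fun_eq_iff)

lemma env_from_first: "env_from W J i \<omega> \<tau> k 0 = (arr W i k \<omega> - \<tau>, J i k \<omega>)"
  by (simp add: env_from_def)

lemma cstep_None: "(cstep c W J r1 r2 \<omega> ^^ n) None = None"
proof (induction n)
  case (Suc n)
  then show ?case by (simp only: funpow.simps comp_def) (simp add: cstep_def)
qed simp

lemma cstep_iff_alive:
  "(cstep c W J r1 r2 \<omega> ^^ n) (Some (x1, x2, \<tau>, k1, k2)) \<noteq> None \<longleftrightarrow>
    alive (c 1) (c 2) r1 r2 n (env_from W J 1 \<omega> \<tau> k1) (env_from W J 2 \<omega> \<tau> k2) x1 x2 = 1"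
proof (induction n arbitrary: x1 x2 \<tau> k1 k2)
  case (Suc n)
  let ?c = "cstep c W J r1 r2 \<omega>" and ?a = "alive (c 1) (c 2) r1 r2 n"
  define t1 t2 where "t1 = arr W 1 k1 \<omega>" and "t2 = arr W 2 k2 \<omega>"
  show ?case
  proof (cases "t1 \<le> t2")
    case True
    define y1 y2 where "y1 = x1 + c 1 * (t1 - \<tau>) - J 1 k1 \<omega>" and "y2 = x2 + c 2 * (t1 - \<tau>)"
    let ?e1 = "env_from W J 1 \<omega> t1 (Suc k1)" and ?e2 = "env_from W J 2 \<omega> t1 k2"
    have step: "?c (Some (x1, x2, \<tau>, k1, k2)) = (if 0 \<le> y1 then Some (y1, y2, t1, Suc k1, k2)
      else if r1 = \<infinity> then None else if y2 + real_of_ereal r1 * y1 < 0 then None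
      else Some (0, y2 + real_of_ereal r1 * y1, t1, Suc k1, k2))"
      using True by (simp add: cstep_def t1_def t2_def y1_def y2_def Let_def)
    have "alive (c 1) (c 2) r1 r2 (Suc n) (env_from W J 1 \<omega> \<tau> k1) (env_from W J 2 \<omega> \<tau> k2) x1 x2
        = after_claim r1 (?a ?e1 ?e2) y1 y2"
      using True by (simp add: env_from_first env_from_Suc age_env_from t1_def t2_def y1_def y2_def)
    then show ?thesis
      unfolding funpow_Suc_right comp_def step
      using Suc.IH[of y1 y2 t1 "Suc k1" k2] Suc.IH[of 0 "y2 + real_of_ereal r1 * y1" t1 "Suc k1" k2]
      by (simp add: after_claim_def cstep_None)
  next
    case False
    define y1 y2 where "y1 = x1 + c 1 * (t2 - \<tau>)" and "y2 = x2 + c 2 * (t2 - \<tau>) - J 2 k2 \<omega>"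
    let ?e1 = "env_from W J 1 \<omega> t2 k1" and ?e2 = "env_from W J 2 \<omega> t2 (Suc k2)"
    have step: "?c (Some (x1, x2, \<tau>, k1, k2)) = (if 0 \<le> y2 then Some (y1, y2, t2, k1, Suc k2)
      else if r2 = \<infinity> then None else if y1 + real_of_ereal r2 * y2 < 0 then None
      else Some (y1 + real_of_ereal r2 * y2, 0, t2, k1, Suc k2))"
      using False by (simp add: cstep_def t1_def t2_def y1_def y2_def Let_def)
    have "alive (c 1) (c 2) r1 r2 (Suc n) (env_from W J 1 \<omega> \<tau> k1) (env_from W J 2 \<omega> \<tau> k2) x1 x2
        = after_claim r2 (\<lambda>x y. ?a ?e1 ?e2 y x) y2 y1"
      using False by (simp add: env_from_first env_from_Suc age_env_from t1_def t2_def y1_def y2_def)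
    then show ?thesis
      unfolding funpow_Suc_right comp_def step
      using Suc.IH[of y1 y2 t2 k1 "Suc k2"] Suc.IH[of "y1 + real_of_ereal r2 * y2" 0 t2 k1 "Suc k2"]
      by (simp add: after_claim_def cstep_None)
  qed
qed simp

lemma survives_iff_alive:
  "survives c W J r1 r2 \<omega> x1 x2 \<longleftrightarrow> (\<forall>n. alive (c 1) (c 2) r1 r2 n (env W J 1 \<omega>) (env W J 2 \<omega>) x1 x2 = 1)"
  by (simp only: survives_def cstep_iff_alive env_from_0)

lemma alive_Suc_le:
  fixes c :: "nat \<Rightarrow> real"
  assumes "alive (c 1) (c 2) r1 r2 (Suc n) (env W J 1 \<omega>) (env W J 2 \<omega>) x1 x2 = 1"
  shows "alive (c 1) (c 2) r1 r2 n (env W J 1 \<omega>) (env W J 2 \<omega>) x1 x2 = 1"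
proof -
  have "(cstep c W J r1 r2 \<omega> ^^ Suc n) (Some (x1, x2, 0, 0, 0)) \<noteq> None"
    using assms by (simp only: cstep_iff_alive env_from_0 simp_thms)
  then have "(cstep c W J r1 r2 \<omega> ^^ n) (Some (x1, x2, 0, 0, 0)) \<noteq> None"
  proof (rule contrapos_nn)
    assume "(cstep c W J r1 r2 \<omega> ^^ n) (Some (x1, x2, 0, 0, 0)) = None"
    then show "(cstep c W J r1 r2 \<omega> ^^ Suc n) (Some (x1, x2, 0, 0, 0)) = None"
      using cstep_None[where n=1] by simp
  qed
  then show ?thesis by (simp only: cstep_iff_alive env_from_0)
qed

lemma alive_mono:
  assumes r: "0 \<le> r1" "r1 \<le> r1'" "0 \<le> r2" "r2 \<le> r2'" and xy: "x \<le> x'" "y \<le> y'"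
  shows "alive c1 c2 r1' r2' n e1 e2 x y \<le> alive c1 c2 r1 r2 n e1 e2 x' y'"
  using xy
proof (induction n arbitrary: e1 e2 x y x' y')
  case (Suc n)
  have ac: "after_claim r' h u v \<le> after_claim r k u' v'"
    if hk: "\<And>x y x' y'. x \<le> x' \<Longrightarrow> y \<le> y' \<Longrightarrow> h x y \<le> k x' y'"
      and uv: "u \<le> u'" "v \<le> v'" and rr: "0 \<le> r" "r \<le> r'" for r r' h k u v u' v'
  proof (cases "0 \<le> u")
    case True
    then show ?thesis using uv hk by (simp add: after_claim_def)
  next
    case neg: False
    show ?thesis
    proof (cases "r' = \<infinity> \<or> v + real_of_ereal r' * u < 0")
      case True
      then show ?thesis using neg by (auto simp: after_claim_def)
    next
      case False
      then have fin: "r' \<noteq> \<infinity>" "r \<noteq> \<infinity>" and z: "0 \<le> v + real_of_ereal r' * u" using rr by auto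
      have r0: "0 \<le> real_of_ereal r" "real_of_ereal r \<le> real_of_ereal r'"
        using rr fin by (auto simp: real_of_ereal_pos intro!: real_of_ereal_positive_mono)
      have "real_of_ereal r' * u \<le> real_of_ereal r * u" using r0 neg by (simp add: mult_right_mono_neg)
      also have "\<dots> \<le> real_of_ereal r * u'" using r0 uv by (intro mult_left_mono) auto
      finally have le: "v + real_of_ereal r' * u \<le> v' + real_of_ereal r * u'" using uv by linarith
      have lhs: "after_claim r' h u v = h 0 (v + real_of_ereal r' * u)"
        using neg fin z by (simp add: after_claim_def)
      show ?thesis
      proof (cases "0 \<le> u'")
        case True
        have "real_of_ereal r' * u \<le> 0" using r0 neg by (intro mult_nonneg_nonpos) auto
        then have "v + real_of_ereal r' * u \<le> v'" using uv by linarith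
        then show ?thesis unfolding lhs using hk[OF True] True by (simp add: after_claim_def)
      next
        case False
        have "\<not> v' + real_of_ereal r * u' < 0" using le z by linarith
        then show ?thesis unfolding lhs using hk[OF order_refl le] False fin by (simp add: after_claim_def)
      qed
    qed
  qed
  show ?case
  proof (cases "fst (e1 0) \<le> fst (e2 0)")
    case True
    have "after_claim r1' (alive c1 c2 r1' r2' n (e1 \<circ> Suc) (age (fst (e1 0)) e2))
        (x + c1 * fst (e1 0) - snd (e1 0)) (y + c2 * fst (e1 0))
      \<le> after_claim r1 (alive c1 c2 r1 r2 n (e1 \<circ> Suc) (age (fst (e1 0)) e2))
        (x' + c1 * fst (e1 0) - snd (e1 0)) (y' + c2 * fst (e1 0))"
      by (rule ac) (use Suc.prems r in \<open>auto intro!: Suc.IH\<close>)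
    then show ?thesis using True by simp
  next
    case False
    have "after_claim r2' (\<lambda>x y. alive c1 c2 r1' r2' n (age (fst (e2 0)) e1) (e2 \<circ> Suc) y x)
        (y + c2 * fst (e2 0) - snd (e2 0)) (x + c1 * fst (e2 0))
      \<le> after_claim r2 (\<lambda>x y. alive c1 c2 r1 r2 n (age (fst (e2 0)) e1) (e2 \<circ> Suc) y x)
        (y' + c2 * fst (e2 0) - snd (e2 0)) (x' + c1 * fst (e2 0))"
      by (rule ac) (use Suc.prems r in \<open>auto intro!: Suc.IH\<close>)
    then show ?thesis using False by simp
  qed
qed simp

lemma survives_mono:
  assumes "survives c W J r1' r2' \<omega> x y" and r: "0 \<le> r1" "r1 \<le> r1'" "0 \<le> r2" "r2 \<le> r2'" and xy: "x \<le> x'" "y \<le> y'"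
  shows "survives c W J r1 r2 \<omega> x' y'"
  unfolding survives_iff_alive
proof
  fix n
  have "1 \<le> alive (c 1) (c 2) r1 r2 n (env W J 1 \<omega>) (env W J 2 \<omega>) x' y'"
    using alive_mono[OF r xy, of "c 1" "c 2" n "env W J 1 \<omega>" "env W J 2 \<omega>"] assms(1) by (simp add: survives_iff_alive)
  then show "alive (c 1) (c 2) r1 r2 n (env W J 1 \<omega>) (env W J 2 \<omega>) x' y' = 1"
    using alive_01[of "c 1" "c 2" r1 r2 n "env W J 1 \<omega>" "env W J 2 \<omega>" x' y'] by auto
qed

lemma alive_0_inf_indep:
  assumes nn: "0 \<le> c1" "0 \<le> c2" and x: "0 \<le> x" "0 \<le> x'" "0 \<le> y" and w: "\<And>k. 0 \<le> fst (e1 k)" "\<And>k. 0 \<le> fst (e2 k)"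
  shows "alive c1 c2 0 \<infinity> n e1 e2 x y = alive c1 c2 0 \<infinity> n e1 e2 x' y"
  using x w
proof (induction n arbitrary: e1 e2 x x' y)
  case (Suc n)
  note nonneg = Suc.prems(4,5)
  have shift: "0 \<le> fst ((e \<circ> Suc) k)" if "\<And>k. 0 \<le> fst (e k)" for e :: "nat \<Rightarrow> real \<times> real" and k using that by simp
  have aged: "0 \<le> fst (age s e k)" if "\<And>k. 0 \<le> fst (e k)" "s \<le> fst (e 0)" for e :: "nat \<Rightarrow> real \<times> real" and k s
    using that by (auto simp: age_def)
  show ?case
  proof (cases "fst (e1 0) \<le> fst (e2 0)")
    case True
    have m: "0 \<le> c2 * fst (e1 0)" using nn nonneg by auto
    have IH: "alive c1 c2 0 \<infinity> n (e1 \<circ> Suc) (age (fst (e1 0)) e2) u (y + c2 * fst (e1 0))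
        = alive c1 c2 0 \<infinity> n (e1 \<circ> Suc) (age (fst (e1 0)) e2) u' (y + c2 * fst (e1 0))" if "0 \<le> u" "0 \<le> u'" for u u'
      using that Suc.prems m True by (intro Suc.IH shift aged nonneg) auto
    let ?f = "alive c1 c2 0 \<infinity> n (e1 \<circ> Suc) (age (fst (e1 0)) e2)"
    have "after_claim 0 ?f u (y + c2 * fst (e1 0)) = ?f 0 (y + c2 * fst (e1 0))" for u
      using IH[of u 0] Suc.prems(3) m by (auto simp: after_claim_def)
    then show ?thesis using True by simp
  next
    case False
    have m: "0 \<le> c1 * fst (e2 0)" using nn nonneg by auto
    have IH: "alive c1 c2 0 \<infinity> n (age (fst (e2 0)) e1) (e2 \<circ> Suc) (x + c1 * fst (e2 0)) v
        = alive c1 c2 0 \<infinity> n (age (fst (e2 0)) e1) (e2 \<circ> Suc) (x' + c1 * fst (e2 0)) v" if "0 \<le> v" for v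
      using that Suc.prems m False by (intro Suc.IH shift aged nonneg) auto
    show ?thesis using False IH by (auto simp: after_claim_def)
  qed
qed simp

context prob_space
begin

lemma distr_env_pair:
  fixes W J :: "nat \<Rightarrow> nat \<Rightarrow> 'a \<Rightarrow> real"
  assumes indep: "indep_vars (\<lambda>_. borel) (\<lambda>(i, b, k). if b then W i k else J i k) ({1,2} \<times> UNIV \<times> UNIV)"
    and i: "i \<in> {1, 2}"
  shows "distr M (borel \<Otimes>\<^sub>M borel) (\<lambda>\<omega>. (W i k \<omega>, J i k \<omega>)) = distr M borel (W i k) \<Otimes>\<^sub>M distr M borel (J i k)"
proof -
  let ?X = "\<lambda>(i, b, k). if b then W i k else J i k"
  let ?A = "{(i, True, k)}" and ?B = "{(i, False, k)}"
  have "indep_var (PiM ?A (\<lambda>_. borel)) (\<lambda>\<omega>. restrict (\<lambda>p. ?X p \<omega>) ?A) (PiM ?B (\<lambda>_. borel)) (\<lambda>\<omega>. restrict (\<lambda>p. ?X p \<omega>) ?B)"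
    by (rule indep_var_restrict[OF indep]) (use i in auto)
  then have "indep_var borel ((\<lambda>f. f (i, True, k)) \<circ> (\<lambda>\<omega>. restrict (\<lambda>p. ?X p \<omega>) ?A))
      borel ((\<lambda>f. f (i, False, k)) \<circ> (\<lambda>\<omega>. restrict (\<lambda>p. ?X p \<omega>) ?B))"
    by (rule indep_var_compose) (auto intro!: measurable_component_singleton)
  then have "indep_var borel (W i k) borel (J i k)"
    by (simp add: comp_def)
  then show ?thesis
    by (simp add: indep_var_distribution_eq)
qed

lemma distr_env:
  fixes W J :: "nat \<Rightarrow> nat \<Rightarrow> 'a \<Rightarrow> real"
  assumes indep: "indep_vars (\<lambda>_. borel) (\<lambda>(i, b, k). if b then W i k else J i k) ({1,2} \<times> UNIV \<times> UNIV)"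
    and i: "i \<in> {1, 2}"
    and law: "\<And>k. distr M borel (W i k) \<Otimes>\<^sub>M distr M borel (J i k) = \<mu>"
  shows "distr M marks (env W J i) = (\<Pi>\<^sub>M k\<in>UNIV. \<mu>)"
proof -
  let ?X = "\<lambda>(i, b, k). if b then W i k else J i k"
  let ?K = "\<lambda>k. {(i, True, k), (i, False, k)}"
  have "indep_vars (\<lambda>k. PiM (?K k) (\<lambda>_. borel)) (\<lambda>k \<omega>. restrict (\<lambda>p. ?X p \<omega>) (?K k)) UNIV"
    by (rule indep_vars_restrict[OF indep]) (use i in \<open>auto simp: disjoint_family_on_def\<close>)
  then have "indep_vars (\<lambda>_. borel \<Otimes>\<^sub>M borel)
      (\<lambda>k \<omega>. (\<lambda>f. (f (i, True, k), f (i, False, k))) (restrict (\<lambda>p. ?X p \<omega>) (?K k))) UNIV"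
  proof (rule indep_vars_compose2)
    show "(\<lambda>f. (f (i, True, k), f (i, False, k))) \<in> PiM (?K k) (\<lambda>_. borel) \<rightarrow>\<^sub>M borel \<Otimes>\<^sub>M borel" for k
      by (intro measurable_Pair measurable_component_singleton) auto
  qed
  then have ind: "indep_vars (\<lambda>_. borel \<Otimes>\<^sub>M borel) (\<lambda>k \<omega>. (W i k \<omega>, J i k \<omega>)) UNIV"
    by simp
  have rv: "random_variable (borel \<Otimes>\<^sub>M borel) (\<lambda>\<omega>. (W i k \<omega>, J i k \<omega>))" for k
    using ind by (auto simp: indep_vars_def)
  have "distr M marks (\<lambda>\<omega>. \<lambda>k\<in>UNIV. (W i k \<omega>, J i k \<omega>)) = (\<Pi>\<^sub>M k\<in>UNIV. distr M (borel \<Otimes>\<^sub>M borel) (\<lambda>\<omega>. (W i k \<omega>, J i k \<omega>)))"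
    using ind by (subst (asm) indep_vars_iff_distr_eq_PiM) (auto intro: rv)
  then show ?thesis
    by (simp add: distr_env_pair[OF indep i] law env_def[abs_def] restrict_UNIV)
qed

lemma distr_env_both:
  fixes W J :: "nat \<Rightarrow> nat \<Rightarrow> 'a \<Rightarrow> real"
  assumes indep: "indep_vars (\<lambda>_. borel) (\<lambda>(i, b, k). if b then W i k else J i k) ({1,2} \<times> UNIV \<times> UNIV)"
  shows "random_variable marks (env W J 1)" "random_variable marks (env W J 2)"
    "distr M (marks \<Otimes>\<^sub>M marks) (\<lambda>\<omega>. (env W J 1 \<omega>, env W J 2 \<omega>)) = distr M marks (env W J 1) \<Otimes>\<^sub>M distr M marks (env W J 2)"
proof -
  let ?X = "\<lambda>(i, b, k). if b then W i k else J i k"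
  let ?A = "\<lambda>i::nat. {i} \<times> (UNIV :: bool set) \<times> (UNIV :: nat set)"
  let ?Y = "\<lambda>i f k. (f (i, True, k), f (i, False, k))"
  have Y: "?Y i \<in> PiM (?A i) (\<lambda>_. borel) \<rightarrow>\<^sub>M marks" for i
    by (intro measurable_PiM_single' measurable_Pair measurable_component_singleton) (auto simp: space_pair_measure)
  have "indep_var (PiM (?A 1) (\<lambda>_. borel)) (\<lambda>\<omega>. restrict (\<lambda>p. ?X p \<omega>) (?A 1)) (PiM (?A 2) (\<lambda>_. borel)) (\<lambda>\<omega>. restrict (\<lambda>p. ?X p \<omega>) (?A 2))"
    by (rule indep_var_restrict[OF indep]) auto
  then have "indep_var marks (?Y 1 \<circ> (\<lambda>\<omega>. restrict (\<lambda>p. ?X p \<omega>) (?A 1))) marks (?Y 2 \<circ> (\<lambda>\<omega>. restrict (\<lambda>p. ?X p \<omega>) (?A 2)))"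
    by (rule indep_var_compose[OF _ Y Y])
  then have "indep_var marks (env W J 1) marks (env W J 2)"
    by (simp add: comp_def env_def[abs_def])
  then show "random_variable marks (env W J 1)" "random_variable marks (env W J 2)"
    "distr M (marks \<Otimes>\<^sub>M marks) (\<lambda>\<omega>. (env W J 1 \<omega>, env W J 2 \<omega>)) = distr M marks (env W J 1) \<Otimes>\<^sub>M distr M marks (env W J 2)"
    by (auto simp: indep_var_distribution_eq)
qed

end

section \<open>The law of the minimal initial capital\<close>

locale coupled_risk_paths = prob_space M + coupled_risk "c 1" "c 2" l1 l2 D1 D2
  for M :: "'a measure" and c :: "nat \<Rightarrow> real" and l1 l2 D1 D2 +
  fixes W J :: "nat \<Rightarrow> nat \<Rightarrow> 'a \<Rightarrow> real"
  assumes env_measurable[measurable]: "env W J 1 \<in> measurable M marks" "env W J 2 \<in> measurable M marks"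
    and env_law: "distr M (marks \<Otimes>\<^sub>M marks) (\<lambda>\<omega>. (env W J 1 \<omega>, env W J 2 \<omega>)) = path1 \<Otimes>\<^sub>M path2"
    and W_nonneg: "AE \<omega> in M. \<forall>k. 0 \<le> W 1 k \<omega> \<and> 0 \<le> W 2 k \<omega>"
begin

declare One_nat_def[simp del]

abbreviation "surviving r1 r2 x y \<equiv> {\<omega>\<in>space M. survives c W J r1 r2 \<omega> x y}"

lemma survives_measurable[measurable]: "Measurable.pred M (\<lambda>\<omega>. survives c W J r1 r2 \<omega> x y)"
  unfolding survives_iff_alive by measurable

lemma emeasure_alive:
  "emeasure M {\<omega>\<in>space M. alive (c 1) (c 2) r1 r2 n (env W J 1 \<omega>) (env W J 2 \<omega>) x y = 1} = surv_upto r1 r2 n x y"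
proof -
  let ?a = "\<lambda>e1 e2. alive (c 1) (c 2) r1 r2 n e1 e2 x y"
  have "emeasure M {\<omega>\<in>space M. ?a (env W J 1 \<omega>) (env W J 2 \<omega>) = 1}
      = (\<integral>\<^sup>+\<omega>. indicator {\<omega>\<in>space M. ?a (env W J 1 \<omega>) (env W J 2 \<omega>) = 1} \<omega> \<partial>M)"
    by (rule nn_integral_indicator[symmetric]) measurable
  also have "\<dots> = (\<integral>\<^sup>+\<omega>. ?a (env W J 1 \<omega>) (env W J 2 \<omega>) \<partial>M)"
  proof (intro nn_integral_cong)
    fix \<omega> assume "\<omega> \<in> space M"
    then show "indicator {\<omega>\<in>space M. ?a (env W J 1 \<omega>) (env W J 2 \<omega>) = 1} \<omega> = ?a (env W J 1 \<omega>) (env W J 2 \<omega>)"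
      using alive_01[of "c 1" "c 2" r1 r2 n "env W J 1 \<omega>" "env W J 2 \<omega>" x y] by (auto simp: indicator_def)
  qed
  also have "\<dots> = (\<integral>\<^sup>+\<omega>. ?a (fst (env W J 1 \<omega>, env W J 2 \<omega>)) (snd (env W J 1 \<omega>, env W J 2 \<omega>)) \<partial>M)"
    by (simp only: fst_conv snd_conv)
  also have "\<dots> = (\<integral>\<^sup>+p. ?a (fst p) (snd p) \<partial>distr M (marks \<Otimes>\<^sub>M marks) (\<lambda>\<omega>. (env W J 1 \<omega>, env W J 2 \<omega>)))"
    by (rule nn_integral_distr[symmetric]) measurable
  also have "\<dots> = (\<integral>\<^sup>+e1. \<integral>\<^sup>+e2. ?a (fst (e1, e2)) (snd (e1, e2)) \<partial>path2 \<partial>path1)"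
    unfolding env_law by (rule p2.nn_integral_fst[symmetric]) measurable
  also have "\<dots> = (\<integral>\<^sup>+e1. \<integral>\<^sup>+e2. ?a e1 e2 \<partial>path2 \<partial>path1)"
    by (simp only: fst_conv snd_conv)
  also have "\<dots> = surv_upto r1 r2 n x y" by (rule nn_integral_alive)
  finally show ?thesis .
qed

lemma emeasure_surviving: "emeasure M (surviving r1 r2 x y) = surv r1 r2 x y"
proof -
  define A where "A n = {\<omega>\<in>space M. alive (c 1) (c 2) r1 r2 n (env W J 1 \<omega>) (env W J 2 \<omega>) x y = 1}" for n
  have A[measurable]: "A n \<in> sets M" for n unfolding A_def by measurable
  have "A (Suc n) \<subseteq> A n" for n
  proof
    fix \<omega> assume "\<omega> \<in> A (Suc n)"
    then have \<omega>: "\<omega> \<in> space M" and a: "alive (c 1) (c 2) r1 r2 (Suc n) (env W J 1 \<omega>) (env W J 2 \<omega>) x y = 1"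
      unfolding A_def mem_Collect_eq by blast+
    show "\<omega> \<in> A n" unfolding A_def mem_Collect_eq by (rule conjI[OF \<omega> alive_Suc_le[where c=c, OF a]])
  qed
  then have dec: "decseq A" by (rule decseq_SucI)
  have "surviving r1 r2 x y = (\<Inter>n. A n)"
    unfolding survives_iff_alive A_def by blast
  also have "emeasure M \<dots> = (INF n. emeasure M (A n))"
    by (rule INF_emeasure_decseq[OF _ dec, symmetric]) auto
  finally show ?thesis by (simp only: A_def emeasure_alive surv_def)
qed

lemma Ucap_nonneg: "0 \<le> Ucap c W J r1 r2 \<omega>"
  unfolding Ucap_def by (rule Inf_greatest) auto

lemma Ucap_le: "0 \<le> u \<Longrightarrow> survives c W J r1 r2 \<omega> u 0 \<Longrightarrow> Ucap c W J r1 r2 \<omega> \<le> ereal u"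
  unfolding Ucap_def by (rule Inf_lower) auto

lemma survives_above_Ucap:
  assumes "0 \<le> r1" "0 \<le> r2" "Ucap c W J r1 r2 \<omega> < ereal u"
  shows "survives c W J r1 r2 \<omega> u 0"
  using assms(3) unfolding Ucap_def Inf_less_iff
  by (auto intro: survives_mono[OF _ assms(1) order_refl assms(2) order_refl])

lemma Ucap_less_iff:
  assumes r: "0 \<le> r1" "0 \<le> r2"
  shows "Ucap c W J r1 r2 \<omega> < a \<longleftrightarrow> (\<exists>q\<in>{q. 0 \<le> (of_rat q :: real) \<and> ereal (of_rat q) < a}. survives c W J r1 r2 \<omega> (of_rat q) 0)"
proof
  assume "Ucap c W J r1 r2 \<omega> < a"
  then obtain z where z: "Ucap c W J r1 r2 \<omega> < ereal z" "ereal z < a"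
    using ereal_dense2[of "Ucap c W J r1 r2 \<omega>" a] Ucap_nonneg[of r1 r2 \<omega>] by blast
  then obtain z' where z': "ereal z < ereal z'" "ereal z' < a"
    using ereal_dense2[of "ereal z" a] by blast
  then obtain q where q: "z < of_rat q" "of_rat q < z'" using of_rat_dense[of z z'] by auto
  have "0 < ereal z" using Ucap_nonneg z(1) by (rule le_less_trans)
  then have "0 < z" by simp
  then have q0: "0 \<le> (of_rat q :: real)" using q by linarith
  have "ereal (of_rat q) < a"
    using q(2) by (intro less_trans[OF _ z'(2)]) simp
  moreover have "survives c W J r1 r2 \<omega> (of_rat q) 0"
    using q(1) by (intro survives_above_Ucap[OF r] less_trans[OF z(1)]) simp
  ultimately show "\<exists>q\<in>{q. 0 \<le> (of_rat q :: real) \<and> ereal (of_rat q) < a}. survives c W J r1 r2 \<omega> (of_rat q) 0"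
    using q0 by auto
next
  assume "\<exists>q\<in>{q. 0 \<le> (of_rat q :: real) \<and> ereal (of_rat q) < a}. survives c W J r1 r2 \<omega> (of_rat q) 0"
  then obtain q where q: "0 \<le> (of_rat q :: real)" "ereal (of_rat q) < a" "survives c W J r1 r2 \<omega> (of_rat q) 0"
    by blast
  from Ucap_le[OF q(1,3)] q(2) show "Ucap c W J r1 r2 \<omega> < a" by (rule le_less_trans)
qed

lemma Ucap_measurable:
  assumes "0 \<le> r1" "0 \<le> r2"
  shows "Ucap c W J r1 r2 \<in> borel_measurable M"
proof (rule borel_measurableI_less)
  fix a
  have "{\<omega>\<in>space M. Ucap c W J r1 r2 \<omega> < a}
      = (\<Union>q\<in>{q. 0 \<le> (of_rat q :: real) \<and> ereal (of_rat q) < a}. surviving r1 r2 (of_rat q) 0)"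
    using Ucap_less_iff[OF assms, of _ a] by auto
  also have "\<dots> \<in> sets M" by (rule sets.countable_UN'') auto
  finally show "{\<omega>\<in>space M. Ucap c W J r1 r2 \<omega> < a} \<in> sets M" .
qed

lemma emeasure_Ucap_le:
  assumes r: "0 \<le> r1" "0 \<le> r2" and x: "0 \<le> x"
  shows "emeasure M {\<omega>\<in>space M. Ucap c W J r1 r2 \<omega> \<le> ereal x} = surv r1 r2 x 0"
proof (rule antisym)
  note [measurable] = Ucap_measurable[OF r]
  have "emeasure M (surviving r1 r2 x 0) \<le> emeasure M {\<omega>\<in>space M. Ucap c W J r1 r2 \<omega> \<le> ereal x}"
    using x by (intro emeasure_mono) (auto intro: Ucap_le)
  then show "surv r1 r2 x 0 \<le> emeasure M {\<omega>\<in>space M. Ucap c W J r1 r2 \<omega> \<le> ereal x}"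
    by (simp add: emeasure_surviving)
  have le: "emeasure M {\<omega>\<in>space M. Ucap c W J r1 r2 \<omega> \<le> ereal x} \<le> ennreal (exp (l * s)) * surv r1 r2 x 0"
    if s: "0 < s" for s
  proof -
    have "x < x + c 1 * s" using s c_pos by simp
    then have "emeasure M {\<omega>\<in>space M. Ucap c W J r1 r2 \<omega> \<le> ereal x} \<le> emeasure M (surviving r1 r2 (x + c 1 * s) 0)"
      by (intro emeasure_mono) (auto intro!: survives_above_Ucap[OF r] intro: le_less_trans)
    also have "\<dots> \<le> ennreal (exp (l * s)) * surv r1 r2 x 0"
      unfolding emeasure_surviving using x s by (intro surv_shift1_le[OF r]) auto
    finally show ?thesis .
  qed
  have "((\<lambda>s. ennreal (exp (l * s)) * surv r1 r2 x 0) \<longlongrightarrow> ennreal (exp (l * 0)) * surv r1 r2 x 0) (at_right 0)"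
    by (intro tendsto_mult_ennreal tendsto_ennrealI tendsto_intros) auto
  then have "emeasure M {\<omega>\<in>space M. Ucap c W J r1 r2 \<omega> \<le> ereal x} \<le> ennreal (exp (l * 0)) * surv r1 r2 x 0"
  proof (rule tendsto_lowerbound)
    show "\<forall>\<^sub>F s in at_right 0. emeasure M {\<omega>\<in>space M. Ucap c W J r1 r2 \<omega> \<le> ereal x} \<le> ennreal (exp (l * s)) * surv r1 r2 x 0"
      using eventually_at_right_less[of "0::real"] by eventually_elim (rule le)
  qed simp
  then show "emeasure M {\<omega>\<in>space M. Ucap c W J r1 r2 \<omega> \<le> ereal x} \<le> surv r1 r2 x 0" by simp
qed

lemma AE_Ucap_finite:
  assumes r: "0 \<le> r1" "0 \<le> r2" and lim: "((\<lambda>x. surv r1 r2 x 0) \<longlongrightarrow> 1) at_top"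
  shows "AE \<omega> in M. Ucap c W J r1 r2 \<omega> < \<infinity>"
proof -
  note [measurable] = Ucap_measurable[OF r]
  have "1 \<le> emeasure M {\<omega>\<in>space M. Ucap c W J r1 r2 \<omega> < \<infinity>}"
  proof (rule tendsto_upperbound[OF lim])
    show "\<forall>\<^sub>F x in at_top. surv r1 r2 x 0 \<le> emeasure M {\<omega>\<in>space M. Ucap c W J r1 r2 \<omega> < \<infinity>}"
      using eventually_ge_at_top[of 0]
    proof eventually_elim
      case (elim x)
      have "emeasure M {\<omega>\<in>space M. Ucap c W J r1 r2 \<omega> \<le> ereal x} \<le> emeasure M {\<omega>\<in>space M. Ucap c W J r1 r2 \<omega> < \<infinity>}"
        by (intro emeasure_mono) (auto intro: le_less_trans)
      then show ?case by (simp add: emeasure_Ucap_le[OF r elim])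
    qed
  qed simp
  then have "emeasure M {\<omega>\<in>space M. Ucap c W J r1 r2 \<omega> < \<infinity>} = 1"
    using emeasure_space[of M "{\<omega>\<in>space M. Ucap c W J r1 r2 \<omega> < \<infinity>}"] by (intro antisym) (simp_all add: emeasure_space_1)
  then have "prob {\<omega>\<in>space M. Ucap c W J r1 r2 \<omega> < \<infinity>} = 1"
    by (simp add: measure_def)
  then show ?thesis
    by (subst (asm) prob_Collect_eq_1) auto
qed

end

lemma sets_borel_atMost_ereal: "sets borel = sigma_sets UNIV (range (\<lambda>x::ereal. {..x}))"
proof (rule antisym)
  have "{a<..} \<in> sigma_sets UNIV (range (\<lambda>x::ereal. {..x}))" for a
  proof -
    have "UNIV - {..a} \<in> sigma_sets UNIV (range (\<lambda>x::ereal. {..x}))"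
      by (intro sigma_sets.Compl sigma_sets.Basic) auto
    also have "UNIV - {..a} = {a<..}" by auto
    finally show ?thesis .
  qed
  then show "sets borel \<subseteq> sigma_sets UNIV (range (\<lambda>x::ereal. {..x}))"
    unfolding borel_Ioi by (simp add: sigma_sets_mono image_subset_iff)
  show "sigma_sets UNIV (range (\<lambda>x::ereal. {..x})) \<subseteq> sets borel"
  proof -
    have "range (\<lambda>x::ereal. {..x}) \<subseteq> sets borel" by auto
    from sets.sigma_sets_subset[OF this] show ?thesis by simp
  qed
qed

lemma prob_measure_eqI_ereal:
  fixes P Q :: "ereal measure"
  assumes P: "prob_space P" and Q: "prob_space Q" and sets: "sets P = sets borel" "sets Q = sets borel"
    and eq: "\<And>x::real. 0 \<le> x \<Longrightarrow> emeasure P {..ereal x} = emeasure Q {..ereal x}"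
    and neg: "emeasure P {..<0} = 0" "emeasure Q {..<0} = 0"
  shows "P = Q"
proof (rule measure_eqI_generator_eq[where E="range (\<lambda>x::ereal. {..x})" and \<Omega>=UNIV and A="\<lambda>_. UNIV"])
  interpret P: prob_space P by fact
  interpret Q: prob_space Q by fact
  have sp: "space P = UNIV" "space Q = UNIV"
    using sets_eq_imp_space_eq[OF sets(1)] sets_eq_imp_space_eq[OF sets(2)] by auto
  show "Int_stable (range (\<lambda>x::ereal. {..x}))"
    by (auto simp: Int_stable_def)
  show "sets P = sigma_sets UNIV (range (\<lambda>x::ereal. {..x}))" "sets Q = sigma_sets UNIV (range (\<lambda>x::ereal. {..x}))"
    unfolding sets by (rule sets_borel_atMost_ereal)+
  have "UNIV = {..\<infinity>::ereal}" by auto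
  then show "range (\<lambda>_. UNIV) \<subseteq> range (\<lambda>x::ereal. {..x})" by auto
  show "emeasure P UNIV \<noteq> \<infinity>" using P.emeasure_space_1 sp by simp
  fix X assume "X \<in> range (\<lambda>x::ereal. {..x})"
  then obtain a :: ereal where X: "X = {..a}" by auto
  show "emeasure P X = emeasure Q X"
  proof (cases "a < 0")
    case True
    then have "X \<subseteq> {..<0}" by (auto simp: X)
    then have "emeasure P X \<le> emeasure P {..<0}" "emeasure Q X \<le> emeasure Q {..<0}"
      by (auto intro!: emeasure_mono simp: sets)
    then show ?thesis by (simp add: neg)
  next
    case False
    then show ?thesis
      using eq P.emeasure_space_1 Q.emeasure_space_1 sp \<open>UNIV = {..\<infinity>::ereal}\<close>
      by (cases a) (auto simp: X)
  qed
qed auto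

context coupled_risk_paths
begin

lemma survives_0_inf_indep:
  assumes w: "\<forall>k. 0 \<le> W 1 k \<omega> \<and> 0 \<le> W 2 k \<omega>" and u: "0 \<le> u" and s: "survives c W J 0 \<infinity> \<omega> u 0"
  shows "survives c W J 0 \<infinity> \<omega> 0 0"
  unfolding survives_iff_alive
proof
  fix n
  have "alive (c 1) (c 2) 0 \<infinity> n (env W J 1 \<omega>) (env W J 2 \<omega>) 0 0 = alive (c 1) (c 2) 0 \<infinity> n (env W J 1 \<omega>) (env W J 2 \<omega>) u 0"
    using w u c_pos by (intro alive_0_inf_indep) (auto simp: env_def)
  then show "alive (c 1) (c 2) 0 \<infinity> n (env W J 1 \<omega>) (env W J 2 \<omega>) 0 0 = 1"
    using s unfolding survives_iff_alive by simp
qed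

lemma Ucap_0_inf_eq_0:
  assumes r: "0 \<le> r1"
  shows "AE \<omega> in M. Ucap c W J r1 \<infinity> \<omega> < \<infinity> \<longrightarrow> Ucap c W J 0 \<infinity> \<omega> = 0"
  using W_nonneg
proof eventually_elim
  case (elim \<omega>)
  show ?case
  proof
    assume "Ucap c W J r1 \<infinity> \<omega> < \<infinity>"
    then obtain u where u: "0 \<le> u" "survives c W J r1 \<infinity> \<omega> u 0"
      unfolding Ucap_def Inf_less_iff by auto
    have "survives c W J 0 \<infinity> \<omega> u 0"
      using u r by (intro survives_mono[OF u(2)]) auto
    then have "survives c W J 0 \<infinity> \<omega> 0 0" by (rule survives_0_inf_indep[OF elim u(1)])
    then have "Ucap c W J 0 \<infinity> \<omega> \<le> ereal 0" by (intro Ucap_le) auto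
    then show "Ucap c W J 0 \<infinity> \<omega> = 0" using Ucap_nonneg[of 0 \<infinity> \<omega>] by (simp add: zero_ereal_def[symmetric])
  qed
qed

lemma emeasure_distr_Ucap:
  assumes r: "0 \<le> r1" "0 \<le> r2" and x: "0 \<le> x"
  shows "emeasure (distr M borel (Ucap c W J r1 r2)) {..ereal x} = surv r1 r2 x 0"
proof -
  note [measurable] = Ucap_measurable[OF r]
  have "emeasure (distr M borel (Ucap c W J r1 r2)) {..ereal x} = emeasure M {\<omega>\<in>space M. Ucap c W J r1 r2 \<omega> \<le> ereal x}"
    by (subst emeasure_distr) (auto intro!: arg_cong[where f="emeasure M"])
  then show ?thesis by (simp add: emeasure_Ucap_le[OF r x])
qed

lemma emeasure_distr_Ucap_neg:
  assumes r: "0 \<le> r1" "0 \<le> r2"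
  shows "emeasure (distr M borel (Ucap c W J r1 r2)) {..<0} = 0"
proof -
  note [measurable] = Ucap_measurable[OF r]
  have "Ucap c W J r1 r2 -` {..<0} \<inter> space M = {}"
    using Ucap_nonneg[of r1 r2] by (auto simp: not_less[symmetric])
  then show ?thesis by (subst emeasure_distr) auto
qed

theorem distr_Ucap_sum:
  assumes r: "0 < r1" "0 < r2" and lim: "((\<lambda>x. surv r1 r2 x 0) \<longlongrightarrow> 1) at_top"
  shows "distr M borel (Ucap c W J r1 r2)
    = distr (distr M borel (Ucap c W J r1 0) \<Otimes>\<^sub>M distr M borel (Ucap c W J 0 r2)) borel (\<lambda>(a, b). a + b)"
proof -
  have r0: "0 \<le> r1" "0 \<le> r2" using r by auto
  note m[measurable] = Ucap_measurable[OF r0] Ucap_measurable[OF r0(1) order_refl] Ucap_measurable[OF order_refl r0(2)]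
  define A where "A = distr M borel (Ucap c W J r1 0)"
  define B where "B = distr M borel (Ucap c W J 0 r2)"
  interpret A: prob_space A unfolding A_def by (rule prob_space_distr) measurable
  interpret B: prob_space B unfolding B_def by (rule prob_space_distr) measurable
  interpret AB: pair_prob_space A B ..
  have sAB[measurable_cong, simp]: "sets A = sets borel" "sets B = sets borel" by (auto simp: A_def B_def)
  have sp[simp]: "space A = UNIV" "space B = UNIV" by (auto simp: A_def B_def)
  define u where "u \<omega> = real_of_ereal (Ucap c W J r1 0 \<omega>)" for \<omega>
  have [measurable]: "u \<in> borel_measurable M" unfolding u_def[abs_def] by measurable
  have "((\<lambda>x. surv r1 0 x 0) \<longlongrightarrow> 1) at_top"
    using r0 by (intro surv_tendsto_1_rate[OF lim]) auto
  then have "AE \<omega> in M. Ucap c W J r1 0 \<omega> < \<infinity>" by (intro AE_Ucap_finite r0) auto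
  then have U_u: "AE \<omega> in M. Ucap c W J r1 0 \<omega> = ereal (u \<omega>)"
  proof eventually_elim
    case (elim \<omega>)
    then show ?case using Ucap_nonneg[of r1 0 \<omega>] by (auto simp: u_def ereal_real)
  qed
  have u_nonneg: "0 \<le> u \<omega>" for \<omega> unfolding u_def by (rule real_of_ereal_pos[OF Ucap_nonneg])
  define N where "N = distr M borel u"
  interpret Np: prob_space N unfolding N_def by (rule prob_space_distr) measurable
  have N: "nonneg_measure N"
  proof
    show "sets N = sets borel" by (simp add: N_def)
    show "AE u in N. 0 \<le> u" unfolding N_def by (subst AE_distr_iff) (auto simp: u_nonneg)
  qed
  have cdfN: "emeasure N {..x} = surv r1 0 x 0" if "0 \<le> x" for x
  proof -
    have "emeasure N {..x} = emeasure M {\<omega>\<in>space M. u \<omega> \<le> x}"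
      unfolding N_def by (subst emeasure_distr) (auto intro!: arg_cong[where f="emeasure M"])
    also have "\<dots> = emeasure M {\<omega>\<in>space M. Ucap c W J r1 0 \<omega> \<le> ereal x}"
      using U_u by (intro emeasure_eq_AE) (auto elim!: eventually_mono)
    also have "\<dots> = surv r1 0 x 0" by (rule emeasure_Ucap_le[OF r0(1) order_refl that])
    finally show ?thesis .
  qed
  have emB: "emeasure B {b. ereal v + b \<le> ereal x} = (if v \<le> x then surv 0 r2 (x - v) 0 else 0)" if "0 \<le> v" for v x
  proof -
    have eq: "{b. ereal v + b \<le> ereal x} = {..ereal (x - v)}"
    proof (rule set_eqI)
      fix b
      show "b \<in> {b. ereal v + b \<le> ereal x} \<longleftrightarrow> b \<in> {..ereal (x - v)}" by (cases b) auto
    qed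
    show ?thesis
    proof (cases "v \<le> x")
      case True
      then show ?thesis unfolding eq B_def by (simp add: emeasure_distr_Ucap[OF order_refl r0(2)])
    next
      case False
      then have "{..ereal (x - v)} \<subseteq> {..<0}" by (auto intro: le_less_trans)
      then have "emeasure B {..ereal (x - v)} \<le> emeasure B {..<0}" by (intro emeasure_mono) auto
      also have "\<dots> = 0" unfolding B_def by (rule emeasure_distr_Ucap_neg[OF order_refl r0(2)])
      finally show ?thesis using False unfolding eq by simp
    qed
  qed
  show ?thesis
    unfolding A_def[symmetric] B_def[symmetric]
  proof (rule prob_measure_eqI_ereal)
    show "prob_space (distr M borel (Ucap c W J r1 r2))" by (rule prob_space_distr) measurable
    show "prob_space (distr (A \<Otimes>\<^sub>M B) borel (\<lambda>(a, b). a + b))" by (rule AB.prob_space_distr) measurable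
    show "emeasure (distr M borel (Ucap c W J r1 r2)) {..<0} = 0" by (rule emeasure_distr_Ucap_neg[OF r0])
    have sum_law: "emeasure (distr (A \<Otimes>\<^sub>M B) borel (\<lambda>(a, b). a + b)) S = (\<integral>\<^sup>+\<omega>. emeasure B {b. ereal (u \<omega>) + b \<in> S} \<partial>M)"
      if S[measurable]: "S \<in> sets borel" for S
    proof -
      let ?X = "{p \<in> space (A \<Otimes>\<^sub>M B). fst p + snd p \<in> S}"
      have "emeasure (distr (A \<Otimes>\<^sub>M B) borel (\<lambda>(a, b). a + b)) S = emeasure (A \<Otimes>\<^sub>M B) ?X"
        by (subst emeasure_distr) (auto intro!: arg_cong[where f="emeasure (A \<Otimes>\<^sub>M B)"])
      also have "\<dots> = (\<integral>\<^sup>+a. emeasure B (Pair a -` ?X) \<partial>A)"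
        by (rule B.emeasure_pair_measure_alt) measurable
      also have "\<dots> = (\<integral>\<^sup>+\<omega>. emeasure B (Pair (Ucap c W J r1 0 \<omega>) -` ?X) \<partial>M)"
        unfolding A_def
      proof (rule nn_integral_distr)
        have "(\<lambda>a. emeasure B (Pair a -` ?X)) \<in> borel_measurable A" by (rule B.measurable_emeasure_Pair) measurable
        then show "(\<lambda>a. emeasure B (Pair a -` {p \<in> space (distr M borel (Ucap c W J r1 0) \<Otimes>\<^sub>M B). fst p + snd p \<in> S})) \<in> borel_measurable (distr M borel (Ucap c W J r1 0))"
          unfolding A_def .
      qed measurable
      also have "\<dots> = (\<integral>\<^sup>+\<omega>. emeasure B {b. ereal (u \<omega>) + b \<in> S} \<partial>M)"
        using U_u by (intro nn_integral_cong_AE) (auto simp: space_pair_measure vimage_def elim!: eventually_mono)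
      finally show ?thesis .
    qed
    have "emeasure B {b. ereal (u \<omega>) + b \<in> {..<0}} = 0" for \<omega>
    proof -
      have "{b. ereal (u \<omega>) + b \<in> {..<0}} \<subseteq> {..<0}"
        using u_nonneg[of \<omega>] by (auto simp: not_le[symmetric] dest: add_nonneg_nonneg[of "ereal (u \<omega>)"])
      then have "emeasure B {b. ereal (u \<omega>) + b \<in> {..<0}} \<le> emeasure B {..<0}" by (intro emeasure_mono) auto
      then show ?thesis unfolding B_def by (simp add: emeasure_distr_Ucap_neg[OF order_refl r0(2)])
    qed
    then show "emeasure (distr (A \<Otimes>\<^sub>M B) borel (\<lambda>(a, b). a + b)) {..<0} = 0"
      by (subst sum_law) auto
    fix x :: real assume x: "0 \<le> x"
    have "emeasure (distr (A \<Otimes>\<^sub>M B) borel (\<lambda>(a, b). a + b)) {..ereal x}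
        = (\<integral>\<^sup>+\<omega>. surv 0 r2 (x - u \<omega>) 0 * indicator {..x} (u \<omega>) \<partial>M)"
      using emB[OF u_nonneg] by (subst sum_law) (auto intro!: nn_integral_cong)
    also have "\<dots> = conv1 N (surv 0 r2) x 0"
      unfolding conv1_def N_def by (subst nn_integral_distr) auto
    also have "\<dots> = surv r1 r2 x 0"
      by (rule surv_axis_formulas(1)[OF N r cdfN lim x, symmetric])
    finally show "emeasure (distr M borel (Ucap c W J r1 r2)) {..ereal x} = emeasure (distr (A \<Otimes>\<^sub>M B) borel (\<lambda>(a, b). a + b)) {..ereal x}"
      by (simp add: emeasure_distr_Ucap[OF r0 x])
  qed simp_all
qed

theorem Ucap_conditional:
  assumes r: "0 \<le> r1" and q: "0 < surv 0 \<infinity> 0 0"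
    and eq: "\<And>x. 0 \<le> x \<Longrightarrow> surv r1 \<infinity> x 0 = surv 0 \<infinity> 0 0 * surv r1 0 x 0" and S: "S \<in> sets borel"
  shows "measure M {\<omega>\<in>space M. Ucap c W J r1 0 \<omega> \<in> S}
    = measure M {\<omega>\<in>space M. Ucap c W J r1 \<infinity> \<omega> \<in> S \<and> Ucap c W J 0 \<infinity> \<omega> = 0} / measure M {\<omega>\<in>space M. Ucap c W J 0 \<infinity> \<omega> = 0}"
proof -
  note m[measurable] = Ucap_measurable[OF r order_refl] Ucap_measurable[of r1 \<infinity>, OF r] Ucap_measurable[of 0 \<infinity>]
  have [measurable]: "Ucap c W J r1 \<infinity> \<in> borel_measurable M" "Ucap c W J 0 \<infinity> \<in> borel_measurable M"
    using m(2,3) by simp_all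
  define C where "C = {\<omega>\<in>space M. Ucap c W J 0 \<infinity> \<omega> = 0}"
  have C[measurable]: "C \<in> sets M" unfolding C_def by measurable
  have "C = {\<omega>\<in>space M. Ucap c W J 0 \<infinity> \<omega> \<le> ereal 0}"
    unfolding C_def using Ucap_nonneg[of 0 \<infinity>] by (auto simp: zero_ereal_def[symmetric] intro: antisym)
  then have emC: "emeasure M C = surv 0 \<infinity> 0 0"
    using emeasure_Ucap_le[of 0 \<infinity> 0] by simp
  have C0: "emeasure M C \<noteq> 0" using q by (simp add: emC)
  define Q where "Q = uniform_measure M C"
  interpret Q: prob_space Q unfolding Q_def by (rule prob_space_uniform_measure) (auto simp: C0)
  have [measurable_cong]: "sets Q = sets M" by (simp add: Q_def)
  have "distr M borel (Ucap c W J r1 0) = distr Q borel (Ucap c W J r1 \<infinity>)"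
  proof (rule prob_measure_eqI_ereal)
    show "prob_space (distr M borel (Ucap c W J r1 0))" by (rule prob_space_distr) measurable
    show "prob_space (distr Q borel (Ucap c W J r1 \<infinity>))" by (rule Q.prob_space_distr) measurable
    show "emeasure (distr M borel (Ucap c W J r1 0)) {..<0} = 0" by (rule emeasure_distr_Ucap_neg[OF r order_refl])
    have "Ucap c W J r1 \<infinity> -` {..<0} \<inter> space Q = {}"
      using Ucap_nonneg[of r1 \<infinity>] by (auto simp: not_less[symmetric])
    then show "emeasure (distr Q borel (Ucap c W J r1 \<infinity>)) {..<0} = 0"
      by (subst emeasure_distr) auto
    fix x :: real assume x: "0 \<le> x"
    let ?D = "{\<omega>\<in>space M. Ucap c W J r1 \<infinity> \<omega> \<le> ereal x}"
    have "Ucap c W J r1 \<infinity> -` {..ereal x} \<inter> space Q = ?D" by (auto simp: Q_def)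
    then have "emeasure (distr Q borel (Ucap c W J r1 \<infinity>)) {..ereal x} = emeasure Q ?D"
      by (subst emeasure_distr) auto
    also have "\<dots> = emeasure M (C \<inter> ?D) / emeasure M C"
      unfolding Q_def by (rule emeasure_uniform_measure) measurable
    also have "emeasure M (C \<inter> ?D) = emeasure M ?D"
    proof (rule emeasure_eq_AE)
      show "AE \<omega> in M. \<omega> \<in> C \<inter> ?D \<longleftrightarrow> \<omega> \<in> ?D"
        using Ucap_0_inf_eq_0[OF r] by eventually_elim (auto simp: C_def intro: le_less_trans)
    qed measurable
    also have "\<dots> = surv 0 \<infinity> 0 0 * surv r1 0 x 0"
      using emeasure_Ucap_le[of r1 \<infinity> x, OF r] x eq[OF x] by simp
    also have "surv 0 \<infinity> 0 0 * surv r1 0 x 0 / emeasure M C = surv r1 0 x 0"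
      unfolding emC using q by (subst mult.commute, intro ennreal_mult_divide_eq) auto
    finally show "emeasure (distr M borel (Ucap c W J r1 0)) {..ereal x} = emeasure (distr Q borel (Ucap c W J r1 \<infinity>)) {..ereal x}"
      by (simp add: emeasure_distr_Ucap[OF r order_refl x])
  qed simp_all
  then have "measure (distr M borel (Ucap c W J r1 0)) S = measure (distr Q borel (Ucap c W J r1 \<infinity>)) S" by simp
  then have "measure M (Ucap c W J r1 0 -` S \<inter> space M) = measure Q (Ucap c W J r1 \<infinity> -` S \<inter> space Q)"
    using S by (subst (asm) (1 2) measure_distr) auto
  also have "\<dots> = measure M (C \<inter> (Ucap c W J r1 \<infinity> -` S \<inter> space M)) / measure M C"
    unfolding Q_def using S by (subst measure_uniform_measure) (auto simp: C0)
  also have "C \<inter> (Ucap c W J r1 \<infinity> -` S \<inter> space M) = {\<omega>\<in>space M. Ucap c W J r1 \<infinity> \<omega> \<in> S \<and> Ucap c W J 0 \<infinity> \<omega> = 0}"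
    by (auto simp: C_def)
  also have "Ucap c W J r1 0 -` S \<inter> space M = {\<omega>\<in>space M. Ucap c W J r1 0 \<omega> \<in> S}" by auto
  finally show ?thesis unfolding C_def .
qed

end

section \<open>The drift\<close>

lemma suminf_erlang_density:
  assumes l: "0 < l"
  shows "(\<Sum>k. ennreal (erlang_density k l x)) = ennreal l * indicator {0..} x"
proof (cases "x < 0")
  case True
  then show ?thesis by (simp add: erlang_density_def)
next
  case False
  have "(\<lambda>k. (l * exp (- l * x)) * ((l * x) ^ k /\<^sub>R fact k)) sums ((l * exp (- l * x)) * exp (l * x))"
    by (intro sums_mult exp_converges)
  moreover have "(l * exp (- l * x)) * ((l * x) ^ k /\<^sub>R fact k) = erlang_density k l x" for k
    using False by (simp add: erlang_density_def field_simps power_mult_distrib)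
  moreover have "(l * exp (- l * x)) * exp (l * x) = l"
    by (simp add: mult.assoc exp_minus_inverse[of "l * x"] exp_add[symmetric])
  ultimately have "(\<lambda>k. erlang_density k l x) sums l" by (simp only:)
  then show ?thesis using False l by (subst suminf_ennreal_eq) auto
qed

context prob_space
begin

lemma suminf_emeasure_arrivals:
  fixes V :: "nat \<Rightarrow> 'a \<Rightarrow> real"
  assumes l: "0 < l" and expo: "\<And>k. distributed M lborel (V k) (exponential_density l)"
    and ind: "indep_vars (\<lambda>_. borel) V UNIV"
  shows "(\<Sum>k. emeasure M {\<omega>\<in>space M. (\<Sum>j\<le>k. V j \<omega>) \<le> 1}) = ennreal l"
proof -
  have "emeasure M {\<omega>\<in>space M. (\<Sum>j\<le>k. V j \<omega>) \<le> 1}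
      = (\<integral>\<^sup>+x. ennreal (erlang_density k l x) * indicator {..1} x \<partial>lborel)" for k
  proof -
    have "distributed M lborel (\<lambda>\<omega>. \<Sum>j\<le>k. V j \<omega>) (erlang_density (card {..k} - 1) l)"
      by (rule exponential_distributed_sum) (use l expo indep_vars_subset[OF ind] in auto)
    from distributed_emeasure[OF this, of "{..1}"]
    show ?thesis by (simp add: vimage_def Int_def conj_commute)
  qed
  then have "(\<Sum>k. emeasure M {\<omega>\<in>space M. (\<Sum>j\<le>k. V j \<omega>) \<le> 1})
      = (\<integral>\<^sup>+x. (\<Sum>k. ennreal (erlang_density k l x) * indicator {..1} x) \<partial>lborel)"
    by (simp add: nn_integral_suminf del: ennreal_suminf_multc)
  also have "\<dots> = (\<integral>\<^sup>+x. ennreal l * indicator {0..1::real} x \<partial>lborel)"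
    by (intro nn_integral_cong) (auto simp: suminf_erlang_density[OF l] indicator_def)
  also have "\<dots> = ennreal l"
    by (subst nn_integral_cmult_indicator) auto
  finally show ?thesis .
qed

lemma nn_integral_indep_mult:
  assumes ind: "indep_var borel X borel Y" and [measurable]: "f \<in> borel_measurable borel" "g \<in> borel_measurable borel"
  shows "(\<integral>\<^sup>+\<omega>. f (X \<omega>) * g (Y \<omega>) \<partial>M) = (\<integral>\<^sup>+\<omega>. f (X \<omega>) \<partial>M) * (\<integral>\<^sup>+\<omega>. g (Y \<omega>) \<partial>M)"
proof -
  from ind have [measurable]: "X \<in> M \<rightarrow>\<^sub>M borel" "Y \<in> M \<rightarrow>\<^sub>M borel"
    and eq: "distr M borel X \<Otimes>\<^sub>M distr M borel Y = distr M (borel \<Otimes>\<^sub>M borel) (\<lambda>\<omega>. (X \<omega>, Y \<omega>))"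
    by (auto simp: indep_var_distribution_eq)
  interpret Y: prob_space "distr M borel Y" by (rule prob_space_distr) measurable
  have "(\<integral>\<^sup>+\<omega>. f (X \<omega>) * g (Y \<omega>) \<partial>M) = (\<integral>\<^sup>+p. f (fst p) * g (snd p) \<partial>distr M (borel \<Otimes>\<^sub>M borel) (\<lambda>\<omega>. (X \<omega>, Y \<omega>)))"
    by (subst nn_integral_distr) auto
  also have "\<dots> = (\<integral>\<^sup>+x. \<integral>\<^sup>+y. f x * g y \<partial>distr M borel Y \<partial>distr M borel X)"
    unfolding eq[symmetric] by (subst Y.nn_integral_fst[symmetric]) auto
  also have "\<dots> = (\<integral>\<^sup>+x. f x * (\<integral>\<^sup>+\<omega>. g (Y \<omega>) \<partial>M) \<partial>distr M borel X)"
    by (intro nn_integral_cong) (subst nn_integral_cmult, auto simp: nn_integral_distr)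
  also have "\<dots> = (\<integral>\<^sup>+\<omega>. f (X \<omega>) \<partial>M) * (\<integral>\<^sup>+\<omega>. g (Y \<omega>) \<partial>M)"
    by (subst nn_integral_multc) (auto simp: nn_integral_distr)
  finally show ?thesis .
qed

lemma nn_integral_claims:
  fixes V Y :: "nat \<Rightarrow> 'a \<Rightarrow> real"
  assumes l: "0 < l" and expo: "\<And>k. distributed M lborel (V k) (exponential_density l)"
    and ind: "indep_vars (\<lambda>_. borel) V UNIV"
    and Y: "\<And>k. Y k \<in> borel_measurable M" "\<And>k. distr M borel (Y k) = distr M borel (Y 0)" "\<And>k. AE \<omega> in M. 0 < Y k \<omega>"
    and VY: "\<And>k. indep_var borel (\<lambda>\<omega>. \<Sum>j\<le>k. V j \<omega>) borel (Y k)"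
  obtains C where "C \<in> borel_measurable M" "\<And>\<omega>. 0 \<le> C \<omega>"
    "AE \<omega> in M. (\<Sum>k\<in>{k. (\<Sum>j\<le>k. V j \<omega>) \<le> 1}. Y k \<omega>) = C \<omega>"
    "(\<integral>\<^sup>+\<omega>. ennreal (C \<omega>) \<partial>M) = ennreal l * (\<integral>\<^sup>+\<omega>. ennreal (Y 0 \<omega>) \<partial>M)"
proof -
  note [measurable] = Y(1)
  have V[measurable]: "V k \<in> borel_measurable M" for k using distributed_measurable[OF expo[of k]] by simp
  define A where "A k = {\<omega>\<in>space M. (\<Sum>j\<le>k. V j \<omega>) \<le> 1}" for k
  have A[measurable]: "A k \<in> sets M" for k unfolding A_def by measurable
  have sumA: "(\<Sum>k. emeasure M (A k)) = ennreal l"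
    unfolding A_def by (rule suminf_emeasure_arrivals[OF l expo ind])
  have "summable (\<lambda>k. measure M (A k))"
    by (rule summable_suminf_not_top) (use sumA in \<open>auto simp: emeasure_eq_measure\<close>)
  then have fin: "AE \<omega> in M. eventually (\<lambda>k. \<omega> \<in> space M - A k) sequentially"
    by (intro borel_cantelli_AE1) (auto simp: emeasure_eq_measure)
  have "AE \<omega> in M. \<forall>k. 0 < Y k \<omega>" using Y(3) by (simp add: AE_all_countable)
  with fin AE_space have eq: "AE \<omega> in M. 0 \<le> (\<Sum>k\<in>{k. (\<Sum>j\<le>k. V j \<omega>) \<le> 1}. Y k \<omega>) \<and>
      ennreal (\<Sum>k\<in>{k. (\<Sum>j\<le>k. V j \<omega>) \<le> 1}. Y k \<omega>) = (\<Sum>k. indicator {..1} (\<Sum>j\<le>k. V j \<omega>) * ennreal (Y k \<omega>))"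
  proof eventually_elim
    case (elim \<omega>)
    let ?S = "{k. (\<Sum>j\<le>k. V j \<omega>) \<le> 1}"
    from elim(1) obtain n where "\<And>k. n \<le> k \<Longrightarrow> \<omega> \<notin> A k" by (auto simp: eventually_sequentially)
    then have "?S \<subseteq> {..<n}" using elim(2) by (auto simp: A_def not_le[symmetric])
    then have fS: "finite ?S" by (rule finite_subset) simp
    have "(\<Sum>k. indicator {..1} (\<Sum>j\<le>k. V j \<omega>) * ennreal (Y k \<omega>)) = (\<Sum>k\<in>?S. indicator {..1} (\<Sum>j\<le>k. V j \<omega>) * ennreal (Y k \<omega>))"
      by (rule suminf_finite[OF fS]) auto
    also have "\<dots> = (\<Sum>k\<in>?S. ennreal (Y k \<omega>))" by (intro sum.cong) auto
    also have "\<dots> = ennreal (\<Sum>k\<in>?S. Y k \<omega>)" using elim(3) by (intro sum_ennreal) (auto intro: less_imp_le)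
    finally have "ennreal (\<Sum>k\<in>?S. Y k \<omega>) = (\<Sum>k. indicator {..1} (\<Sum>j\<le>k. V j \<omega>) * ennreal (Y k \<omega>))" by (simp only:)
    moreover have "0 \<le> (\<Sum>k\<in>?S. Y k \<omega>)" by (rule sum_nonneg) (use elim(3) in \<open>auto intro: less_imp_le\<close>)
    ultimately show ?case by simp
  qed
  define C where "C \<omega> = enn2real (\<Sum>k. indicator {..1} (\<Sum>j\<le>k. V j \<omega>) * ennreal (Y k \<omega>))" for \<omega>
  have C: "C \<in> borel_measurable M" unfolding C_def by measurable
  have CY: "AE \<omega> in M. (\<Sum>k\<in>{k. (\<Sum>j\<le>k. V j \<omega>) \<le> 1}. Y k \<omega>) = C \<omega>"
    using eq
  proof eventually_elim
    case (elim \<omega>)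
    then show ?case unfolding C_def elim[THEN conjunct2, symmetric] by (subst enn2real_ennreal) auto
  qed
  have "(\<integral>\<^sup>+\<omega>. ennreal (C \<omega>) \<partial>M)
      = (\<integral>\<^sup>+\<omega>. (\<Sum>k. indicator {..1} (\<Sum>j\<le>k. V j \<omega>) * ennreal (Y k \<omega>)) \<partial>M)"
    using eq CY by (intro nn_integral_cong_AE, eventually_elim) (simp only:)
  also have "\<dots> = (\<Sum>k. \<integral>\<^sup>+\<omega>. indicator {..1} (\<Sum>j\<le>k. V j \<omega>) * ennreal (Y k \<omega>) \<partial>M)"
    by (rule nn_integral_suminf) measurable
  also have "\<dots> = (\<Sum>k. emeasure M (A k) * (\<integral>\<^sup>+\<omega>. ennreal (Y 0 \<omega>) \<partial>M))"
  proof (intro suminf_cong)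
    fix k
    have "(\<integral>\<^sup>+\<omega>. ennreal (Y k \<omega>) \<partial>M) = (\<integral>\<^sup>+y. ennreal y \<partial>distr M borel (Y k))"
      by (subst nn_integral_distr) auto
    also have "\<dots> = (\<integral>\<^sup>+\<omega>. ennreal (Y 0 \<omega>) \<partial>M)"
      unfolding Y(2)[of k] by (subst nn_integral_distr) auto
    finally have Y0: "(\<integral>\<^sup>+\<omega>. ennreal (Y k \<omega>) \<partial>M) = (\<integral>\<^sup>+\<omega>. ennreal (Y 0 \<omega>) \<partial>M)" .
    have "(\<integral>\<^sup>+\<omega>. indicator {..1} (\<Sum>j\<le>k. V j \<omega>) \<partial>M) = (\<integral>\<^sup>+\<omega>. indicator (A k) \<omega> \<partial>M)"
      by (intro nn_integral_cong) (auto simp: A_def indicator_def)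
    then have "(\<integral>\<^sup>+\<omega>. indicator {..1} (\<Sum>j\<le>k. V j \<omega>) \<partial>M) = emeasure M (A k)" by simp
    then show "(\<integral>\<^sup>+\<omega>. indicator {..1} (\<Sum>j\<le>k. V j \<omega>) * ennreal (Y k \<omega>) \<partial>M) = emeasure M (A k) * (\<integral>\<^sup>+\<omega>. ennreal (Y 0 \<omega>) \<partial>M)"
      using nn_integral_indep_mult[OF VY, of "indicator {..1}" ennreal k] Y0 by simp
  qed
  also have "\<dots> = ennreal l * (\<integral>\<^sup>+\<omega>. ennreal (Y 0 \<omega>) \<partial>M)"
    by (simp add: sumA)
  finally show ?thesis using that[OF C _ CY] by (simp add: C_def)
qed

lemma mu_balance:
  fixes W J :: "nat \<Rightarrow> nat \<Rightarrow> 'a \<Rightarrow> real"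
  assumes c: "0 < c i" and l: "0 < l" and expo: "\<And>k. distributed M lborel (W i k) (exponential_density l)"
    and J: "\<And>k. J i k \<in> borel_measurable M" "\<And>k. distr M borel (J i k) = distr M borel (J i 0)" "\<And>k. AE \<omega> in M. 0 < J i k \<omega>"
    and indep: "indep_vars (\<lambda>_. borel) (\<lambda>(i, b, k). if b then W i k else J i k) I" and I: "{i} \<times> UNIV \<times> UNIV \<subseteq> I"
  shows "(\<integral>\<^sup>+\<omega>. ennreal (Xproc c W J i 1 \<omega>) \<partial>M) + ennreal l * (\<integral>\<^sup>+\<omega>. ennreal (J i 0 \<omega>) \<partial>M)
      = (\<integral>\<^sup>+\<omega>. ennreal (- Xproc c W J i 1 \<omega>) \<partial>M) + ennreal (c i)"
    and "(\<integral>\<^sup>+\<omega>. ennreal (Xproc c W J i 1 \<omega>) \<partial>M) \<le> ennreal (c i)"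
proof -
  note [measurable] = J(1)
  have V[measurable]: "W i k \<in> borel_measurable M" for k using distributed_measurable[OF expo[of k]] by simp
  let ?X = "\<lambda>(i, b, k). if b then W i k else J i k"
  have "indep_vars (\<lambda>k. PiM {(i, True, k)} (\<lambda>_. borel)) (\<lambda>k \<omega>. restrict (\<lambda>p. ?X p \<omega>) {(i, True, k)}) UNIV"
    by (rule indep_vars_restrict[OF indep]) (use I in \<open>auto simp: disjoint_family_on_def\<close>)
  then have "indep_vars (\<lambda>_. borel) (\<lambda>k \<omega>. (\<lambda>f. f (i, True, k)) (restrict (\<lambda>p. ?X p \<omega>) {(i, True, k)})) UNIV"
    by (rule indep_vars_compose2) (auto intro!: measurable_component_singleton)
  then have ind: "indep_vars (\<lambda>_. borel) (W i) UNIV" by simp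
  have VY: "indep_var borel (\<lambda>\<omega>. \<Sum>j\<le>k. W i j \<omega>) borel (J i k)" for k
  proof -
    let ?A = "{i} \<times> {True} \<times> {..k}" and ?B = "{(i, False, k)}"
    have "indep_var (PiM ?A (\<lambda>_. borel)) (\<lambda>\<omega>. restrict (\<lambda>p. ?X p \<omega>) ?A) (PiM ?B (\<lambda>_. borel)) (\<lambda>\<omega>. restrict (\<lambda>p. ?X p \<omega>) ?B)"
      by (rule indep_var_restrict[OF indep]) (use I in auto)
    then have "indep_var borel ((\<lambda>f. \<Sum>j\<le>k. f (i, True, j)) \<circ> (\<lambda>\<omega>. restrict (\<lambda>p. ?X p \<omega>) ?A))
        borel ((\<lambda>f. f (i, False, k)) \<circ> (\<lambda>\<omega>. restrict (\<lambda>p. ?X p \<omega>) ?B))"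
      by (rule indep_var_compose) (auto intro!: borel_measurable_sum measurable_component_singleton)
    then show ?thesis by (simp add: comp_def)
  qed
  obtain C where C[measurable]: "C \<in> borel_measurable M" and C0: "\<And>\<omega>. 0 \<le> C \<omega>"
    and CJ: "AE \<omega> in M. (\<Sum>k\<in>{k. (\<Sum>j\<le>k. W i j \<omega>) \<le> 1}. J i k \<omega>) = C \<omega>"
    and EC: "(\<integral>\<^sup>+\<omega>. ennreal (C \<omega>) \<partial>M) = ennreal l * (\<integral>\<^sup>+\<omega>. ennreal (J i 0 \<omega>) \<partial>M)"
    by (rule nn_integral_claims[OF l expo ind J VY]) (rule that)
  have "AE \<omega> in M. Xproc c W J i 1 \<omega> = c i - C \<omega>"
    using CJ by eventually_elim (simp add: Xproc_def arr_def)
  then have XC: "(\<integral>\<^sup>+\<omega>. ennreal (Xproc c W J i 1 \<omega>) \<partial>M) = (\<integral>\<^sup>+\<omega>. ennreal (c i - C \<omega>) \<partial>M)"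
    "(\<integral>\<^sup>+\<omega>. ennreal (- Xproc c W J i 1 \<omega>) \<partial>M) = (\<integral>\<^sup>+\<omega>. ennreal (- (c i - C \<omega>)) \<partial>M)"
    by (intro nn_integral_cong_AE; eventually_elim; simp)+
  have "(\<integral>\<^sup>+\<omega>. ennreal (c i - C \<omega>) \<partial>M) \<le> (\<integral>\<^sup>+\<omega>. ennreal (c i) \<partial>M)"
    using C0 by (intro nn_integral_mono ennreal_leI) auto
  then show "(\<integral>\<^sup>+\<omega>. ennreal (Xproc c W J i 1 \<omega>) \<partial>M) \<le> ennreal (c i)"
    by (simp add: XC emeasure_space_1)
  have "(\<integral>\<^sup>+\<omega>. ennreal (c i - C \<omega>) + ennreal (C \<omega>) \<partial>M) = (\<integral>\<^sup>+\<omega>. ennreal (- (c i - C \<omega>)) + ennreal (c i) \<partial>M)"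
  proof (intro nn_integral_cong)
    fix \<omega>
    show "ennreal (c i - C \<omega>) + ennreal (C \<omega>) = ennreal (- (c i - C \<omega>)) + ennreal (c i)"
    proof (cases "C \<omega> \<le> c i")
      case True
      then show ?thesis using C0[of \<omega>] by (simp add: ennreal_plus[symmetric] ennreal_neg del: ennreal_plus)
    next
      case False
      then show ?thesis using c by (simp add: ennreal_plus[symmetric] ennreal_neg del: ennreal_plus)
    qed
  qed
  then have "(\<integral>\<^sup>+\<omega>. ennreal (c i - C \<omega>) \<partial>M) + (\<integral>\<^sup>+\<omega>. ennreal (C \<omega>) \<partial>M)
      = (\<integral>\<^sup>+\<omega>. ennreal (- (c i - C \<omega>)) \<partial>M) + ennreal (c i)"
    by (subst (asm) (1 2) nn_integral_add) (auto simp: emeasure_space_1)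
  then show "(\<integral>\<^sup>+\<omega>. ennreal (Xproc c W J i 1 \<omega>) \<partial>M) + ennreal l * (\<integral>\<^sup>+\<omega>. ennreal (J i 0 \<omega>) \<partial>M)
      = (\<integral>\<^sup>+\<omega>. ennreal (- Xproc c W J i 1 \<omega>) \<partial>M) + ennreal (c i)"
    by (simp add: XC EC)
qed

lemma mu_infinite_or_finite:
  fixes W J :: "nat \<Rightarrow> nat \<Rightarrow> 'a \<Rightarrow> real"
  assumes c: "0 < c i" and l: "0 < l" and expo: "\<And>k. distributed M lborel (W i k) (exponential_density l)"
    and J: "\<And>k. J i k \<in> borel_measurable M" "\<And>k. distr M borel (J i k) = distr M borel (J i 0)" "\<And>k. AE \<omega> in M. 0 < J i k \<omega>"
    and indep: "indep_vars (\<lambda>_. borel) (\<lambda>(i, b, k). if b then W i k else J i k) I" and I: "{i} \<times> UNIV \<times> UNIV \<subseteq> I"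
  obtains (infinite) "mu M c W J i = - \<infinity>"
  | (finite) m where "0 \<le> m" "(\<integral>\<^sup>+\<omega>. ennreal (J i 0 \<omega>) \<partial>M) = ennreal m" "mu M c W J i = ereal (c i - l * m)"
proof -
  let ?P = "\<integral>\<^sup>+\<omega>. ennreal (Xproc c W J i 1 \<omega>) \<partial>M" and ?N = "\<integral>\<^sup>+\<omega>. ennreal (- Xproc c W J i 1 \<omega>) \<partial>M"
  let ?E = "\<integral>\<^sup>+\<omega>. ennreal (J i 0 \<omega>) \<partial>M"
  note bal = mu_balance[where c=c and i=i and W=W and J=J, OF c l expo J indep I]
  obtain p where p: "?P = ennreal p" "0 \<le> p"
    using bal(2) by (cases ?P) (auto simp: top_unique)
  show ?thesis
  proof (cases ?E)
    case (real m)
    then have eq: "ennreal (p + l * m) = ?N + ennreal (c i)"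
      using bal(1) p l by (simp add: ennreal_plus ennreal_mult)
    obtain n where n: "?N = ennreal n" "0 \<le> n" using eq by (cases ?N) auto
    have "ennreal (p + l * m) = ennreal (n + c i)" using eq n c by simp
    then have "p + l * m = n + c i" using p n c l real by (subst (asm) ennreal_inj) auto
    moreover have "mu M c W J i = ereal (p - n)"
      unfolding mu_def p(1) n(1) using p n by (simp add: enn2ereal_ennreal)
    ultimately have "mu M c W J i = ereal (c i - l * m)" by (simp add: algebra_simps)
    then show ?thesis using real by (intro finite) auto
  next
    case top
    then have "?N = \<infinity>" using bal(1) l by (auto simp: ennreal_mult_top ennreal_add_eq_top top_add dest: sym)
    then have "mu M c W J i = - \<infinity>" unfolding mu_def p(1) using p by (simp add: enn2ereal_ennreal)
    then show ?thesis by (rule infinite)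
  qed
qed

lemma distr_exponential:
  assumes "distributed M lborel X (exponential_density q)"
  shows "distr M borel X = exp_law q"
proof -
  have "distr M borel X = distr M lborel X" by (rule distr_cong) auto
  then show ?thesis using assms by (simp add: distributed_def)
qed

lemma AE_exponential_nonneg:
  assumes "distributed M lborel X (exponential_density q)"
  shows "AE \<omega> in M. 0 \<le> X \<omega>"
proof -
  have [measurable]: "X \<in> borel_measurable M" using distributed_measurable[OF assms] by simp
  have "AE t in exp_law q. 0 \<le> t"
    by (subst AE_density) (auto simp: exponential_density_def)
  then have "AE t in distr M borel X. 0 \<le> t" unfolding distr_exponential[OF assms] .
  then show ?thesis by (subst (asm) AE_distr_iff) auto
qed

lemma coupled_risk_paths_of_claims:
  fixes W J :: "nat \<Rightarrow> nat \<Rightarrow> 'a \<Rightarrow> real" and c lam :: "nat \<Rightarrow> real"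
  assumes pos: "\<forall>i\<in>{1,2}. 0 < c i \<and> 0 < lam i"
    and expo: "\<forall>i\<in>{1,2}. \<forall>k. distributed M lborel (W i k) (exponential_density (lam i))"
    and Jmeas: "\<forall>i\<in>{1,2}. \<forall>k. J i k \<in> borel_measurable M"
    and Jiid: "\<forall>i\<in>{1,2}. \<forall>k. distr M borel (J i k) = distr M borel (J i 0)"
    and Jpos: "\<forall>i\<in>{1,2}. \<forall>k. AE \<omega> in M. 0 < J i k \<omega>"
    and indep: "indep_vars (\<lambda>_. borel) (\<lambda>(i, b, k). if b then W i k else J i k) ({1,2} \<times> UNIV \<times> UNIV)"
  shows "coupled_risk_paths M c (lam 1) (lam 2) (distr M borel (J 1 0)) (distr M borel (J 2 0)) W J"
proof -
  have Jm: "J i 0 \<in> borel_measurable M" if "i \<in> {1, 2}" for i using Jmeas that by blast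
  have Dprob: "prob_space (distr M borel (J i 0))" if "i \<in> {1, 2}" for i
    by (rule prob_space_distr[OF Jm[OF that]])
  have Dpos: "AE j in distr M borel (J i 0). 0 < j" if "i \<in> {1, 2}" for i
    using Jpos that by (subst AE_distr_iff[OF Jm[OF that]]) auto
  interpret coupled_risk "c 1" "c 2" "lam 1" "lam 2" "distr M borel (J 1 0)" "distr M borel (J 2 0)"
  proof (rule coupled_risk.intro)
    show "0 < c 1" "0 < c 2" "0 < lam 1" "0 < lam 2" using pos by blast+
    show "prob_space (distr M borel (J 1 0))" "prob_space (distr M borel (J 2 0))" by (rule Dprob; simp)+
    show "AE j in distr M borel (J 1 0). 0 < j" "AE j in distr M borel (J 2 0). 0 < j" by (rule Dpos; simp)+
  qed (rule sets_distr)+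
  have law: "distr M borel (W i k) \<Otimes>\<^sub>M distr M borel (J i k) = exp_law (lam i) \<Otimes>\<^sub>M distr M borel (J i 0)" if i: "i \<in> {1, 2}" for i k
  proof -
    have "distributed M lborel (W i k) (exponential_density (lam i))" using expo i by blast
    moreover have "distr M borel (J i k) = distr M borel (J i 0)" using Jiid i by blast
    ultimately show ?thesis by (simp only: distr_exponential)
  qed
  have W0: "AE \<omega> in M. \<forall>k. 0 \<le> W i k \<omega>" if i: "i \<in> {1, 2}" for i
  proof -
    have "AE \<omega> in M. 0 \<le> W i k \<omega>" for k
      by (rule AE_exponential_nonneg[of _ "lam i"]) (use expo i in blast)
    then show ?thesis by (simp add: AE_all_countable)
  qed
  show ?thesis
  proof (intro coupled_risk_paths.intro coupled_risk_paths_axioms.intro)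
    show "prob_space M" by unfold_locales
    show "coupled_risk (c 1) (c 2) (lam 1) (lam 2) (distr M borel (J 1 0)) (distr M borel (J 2 0))" by unfold_locales
    show "env W J 1 \<in> M \<rightarrow>\<^sub>M marks" "env W J 2 \<in> M \<rightarrow>\<^sub>M marks" by (rule distr_env_both[OF indep])+
    show "distr M (marks \<Otimes>\<^sub>M marks) (\<lambda>\<omega>. (env W J 1 \<omega>, env W J 2 \<omega>)) = path1 \<Otimes>\<^sub>M path2"
      unfolding distr_env_both(3)[OF indep] path1_def path2_def mark1_def mark2_def
      using distr_env[OF indep, where i=1, OF _ law] distr_env[OF indep, where i=2, OF _ law] by simp
    show "AE \<omega> in M. \<forall>k. 0 \<le> W 1 k \<omega> \<and> 0 \<le> W 2 k \<omega>"
      using W0[OF insertI1] W0[OF insertI2[OF singletonI]] by eventually_elim blast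
  qed
qed

end

lemma distr_add_commute:
  fixes A B :: "ereal measure"
  assumes "prob_space A" "prob_space B" and [measurable_cong, simp]: "sets A = sets borel" "sets B = sets borel"
  shows "distr (A \<Otimes>\<^sub>M B) borel (\<lambda>(a, b). a + b) = distr (B \<Otimes>\<^sub>M A) borel (\<lambda>(a, b). a + b)"
proof -
  interpret A: prob_space A by fact
  interpret B: prob_space B by fact
  interpret AB: pair_sigma_finite A B ..
  have "distr (A \<Otimes>\<^sub>M B) borel (\<lambda>(a, b). a + b) = distr (distr (B \<Otimes>\<^sub>M A) (A \<Otimes>\<^sub>M B) (\<lambda>(x, y). (y, x))) borel (\<lambda>(a, b). a + b)"
    by (subst AB.distr_pair_swap) simp
  also have "\<dots> = distr (B \<Otimes>\<^sub>M A) borel (\<lambda>(a, b). a + b)"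
    by (subst distr_distr) (auto simp: comp_def split_beta' add.commute)
  finally show ?thesis .
qed

theorem theorem3p1:
  fixes M :: "'a measure" and c lam :: "nat \<Rightarrow> real"
    and W J :: "nat \<Rightarrow> nat \<Rightarrow> 'a \<Rightarrow> real" and r1 r2 :: real
  assumes P: "prob_space M"
    and pos: "\<forall>i\<in>{1,2}. 0 < c i \<and> 0 < lam i"
    and expo: "\<forall>i\<in>{1,2}. \<forall>k. distributed M lborel (W i k) (exponential_density (lam i))"
    and Jmeas: "\<forall>i\<in>{1,2}. \<forall>k. J i k \<in> borel_measurable M"
    and Jiid: "\<forall>i\<in>{1,2}. \<forall>k. distr M borel (J i k) = distr M borel (J i 0)"
    and Jpos: "\<forall>i\<in>{1,2}. \<forall>k. AE \<omega> in M. 0 < J i k \<omega>"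
    and indep: "prob_space.indep_vars M (\<lambda>_. borel)
                  (\<lambda>(i, b, k). if b then W i k else J i k) ({1,2} \<times> UNIV \<times> UNIV)"
    and r: "0 < r1" "0 < r2"
    and safety: "(0 < mu M c W J 1 \<and> 0 < mu M c W J 2)
       \<or> (mu M c W J 1 \<le> 0 \<and> 0 < mu M c W J 2 + ereal r1 * mu M c W J 1)
       \<or> (mu M c W J 2 \<le> 0 \<and> 0 < mu M c W J 1 + ereal r2 * mu M c W J 2)"
  shows "distr M borel (Ucap c W J (ereal r1) (ereal r2))
           = distr (distr M borel (Ucap c W J (ereal r1) 0) \<Otimes>\<^sub>M distr M borel (Ucap c W J 0 (ereal r2)))
               borel (\<lambda>(a, b). a + b)
    \<and> (0 < mu M c W J 2 \<longrightarrow>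
         (\<forall>A\<in>sets (borel :: ereal measure).
            measure M {\<omega>\<in>space M. Ucap c W J (ereal r1) 0 \<omega> \<in> A}
            = measure M {\<omega>\<in>space M. Ucap c W J (ereal r1) \<infinity> \<omega> \<in> A \<and> Ucap c W J 0 \<infinity> \<omega> = 0}
              / measure M {\<omega>\<in>space M. Ucap c W J 0 \<infinity> \<omega> = 0}))
    \<and> (0 < mu M c W J 1 \<longrightarrow>
         distr M borel (Ucap c W J \<infinity> (ereal r2))
           = distr (distr M borel (Ucap c W J 0 (ereal r2)) \<Otimes>\<^sub>M distr M borel (Ucap c W J \<infinity> 0))
               borel (\<lambda>(a, b). a + b))"
proof -
  interpret prob_space M by (rule P)
  let ?D = "\<lambda>i. distr M borel (J i 0)"
  have paths: "coupled_risk_paths M c (lam 1) (lam 2) (?D 1) (?D 2) W J"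
    by (rule coupled_risk_paths_of_claims[OF pos expo Jmeas Jiid Jpos indep])
  interpret coupled_risk_paths M c "lam 1" "lam 2" "?D 1" "?D 2" W J by (rule paths)
  have mean: "mu M c W J i = - \<infinity> \<or> (\<exists>m. 0 \<le> m \<and> (\<integral>\<^sup>+j. ennreal j \<partial>?D i) = ennreal m \<and> mu M c W J i = ereal (c i - lam i * m))"
    if i: "i \<in> {1, 2}" for i
  proof -
    have a: "0 < c i" "0 < lam i" using pos i by blast+
    have b: "\<And>k. distributed M lborel (W i k) (exponential_density (lam i))" using expo i by blast
    have d: "\<And>k. J i k \<in> borel_measurable M" using Jmeas i by blast
    have e: "\<And>k. distr M borel (J i k) = ?D i" using Jiid i by blast
    have f: "\<And>k. AE \<omega> in M. 0 < J i k \<omega>" using Jpos i by blast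
    have g: "{i} \<times> UNIV \<times> UNIV \<subseteq> {1, 2} \<times> UNIV \<times> UNIV" using i by blast
    have h: "(\<integral>\<^sup>+j. ennreal j \<partial>?D i) = (\<integral>\<^sup>+\<omega>. ennreal (J i 0 \<omega>) \<partial>M)"
      using d by (intro nn_integral_distr) auto
    show ?thesis
      by (rule mu_infinite_or_finite[where c=c and i=i and W=W and J=J, OF a b d e f indep g]) (auto simp: h)
  qed
  have "mu M c W J 1 \<noteq> - \<infinity>" "mu M c W J 2 \<noteq> - \<infinity>"
    using safety mean[of 1] mean[of 2] r by auto
  then obtain m1 m2 where m1: "(\<integral>\<^sup>+j. ennreal j \<partial>?D 1) = ennreal m1" "0 \<le> m1"
    and m2: "(\<integral>\<^sup>+j. ennreal j \<partial>?D 2) = ennreal m2" "0 \<le> m2"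
    and mu1: "mu M c W J 1 = ereal (c 1 - lam 1 * m1)" and mu2: "mu M c W J 2 = ereal (c 2 - lam 2 * m2)"
    using mean[of 1] mean[of 2] by auto
  have safety': "(0 < c 1 - lam 1 * m1 \<and> 0 < c 2 - lam 2 * m2)
      \<or> (c 1 - lam 1 * m1 \<le> 0 \<and> 0 < (c 2 - lam 2 * m2) + r1 * (c 1 - lam 1 * m1))
      \<or> (c 2 - lam 2 * m2 \<le> 0 \<and> 0 < (c 1 - lam 1 * m1) + r2 * (c 2 - lam 2 * m2))"
    using safety unfolding mu1 mu2 by (simp only: times_ereal.simps plus_ereal.simps ereal_less ereal_less_eq)
  have neg: "r * (lam i * m - c i) = - (r * (c i - lam i * m))" for r m i by (simp add: algebra_simps)
  have neg0: "- (q * a) \<le> 0" if "0 < q" "0 < a" for q a :: real using that by simp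
  have pos_r: "r1 * a \<le> 0" "r2 * a \<le> 0" if "a \<le> 0" for a using r that by (auto simp: mult_le_0_iff)
  have safe1: "r2 * (lam 2 * m2 - c 2) < c 1 - lam 1 * m1" if "lam 1 * m1 < c 1"
    using safety' neg0[OF r(2), of "c 2 - lam 2 * m2"] that unfolding neg by auto
  have safe2: "r1 * (lam 1 * m1 - c 1) < c 2 - lam 2 * m2" if "lam 2 * m2 < c 2"
    using safety' neg0[OF r(1), of "c 1 - lam 1 * m1"] that unfolding neg by auto
  have safe: "lam 1 * m1 < c 1 \<or> lam 2 * m2 < c 2"
    using safety' pos_r[of "c 1 - lam 1 * m1"] pos_r[of "c 2 - lam 2 * m2"] by auto
  have part1: "distr M borel (Ucap c W J (ereal r1) (ereal r2))
      = distr (distr M borel (Ucap c W J (ereal r1) 0) \<Otimes>\<^sub>M distr M borel (Ucap c W J 0 (ereal r2))) borel (\<lambda>(a, b). a + b)"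
  proof (rule distr_Ucap_sum)
    show "((\<lambda>x. surv (ereal r1) (ereal r2) x 0) \<longlongrightarrow> 1) at_top"
      using safe safe1 safe2 by (intro surv_tendsto_1[OF m1 m2 r]) auto
  qed (use r in auto)
  have part2: "measure M {\<omega>\<in>space M. Ucap c W J (ereal r1) 0 \<omega> \<in> A}
      = measure M {\<omega>\<in>space M. Ucap c W J (ereal r1) \<infinity> \<omega> \<in> A \<and> Ucap c W J 0 \<infinity> \<omega> = 0}
        / measure M {\<omega>\<in>space M. Ucap c W J 0 \<infinity> \<omega> = 0}"
    if "0 < mu M c W J 2" and A: "A \<in> sets borel" for A
  proof -
    have "lam 2 * m2 < c 2" using that(1) unfolding mu2 by simp
    note no_help = surv_no_help_2[OF m1 m2 r(1) this safe2[OF this]]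
    show ?thesis using r by (intro Ucap_conditional[OF _ no_help(2,1) A]) auto
  qed
  have part3: "distr M borel (Ucap c W J \<infinity> (ereal r2))
      = distr (distr M borel (Ucap c W J 0 (ereal r2)) \<Otimes>\<^sub>M distr M borel (Ucap c W J \<infinity> 0)) borel (\<lambda>(a, b). a + b)"
    if "0 < mu M c W J 1"
  proof -
    have "lam 1 * m1 < c 1" using that unfolding mu1 by simp
    from surv_inf_tendsto_1[OF m1 m2 r(2) this safe1[OF this]]
    have "distr M borel (Ucap c W J \<infinity> (ereal r2))
        = distr (distr M borel (Ucap c W J \<infinity> 0) \<Otimes>\<^sub>M distr M borel (Ucap c W J 0 (ereal r2))) borel (\<lambda>(a, b). a + b)"
      using r by (intro distr_Ucap_sum) auto
    also have "\<dots> = distr (distr M borel (Ucap c W J 0 (ereal r2)) \<Otimes>\<^sub>M distr M borel (Ucap c W J \<infinity> 0)) borel (\<lambda>(a, b). a + b)"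
      using r by (intro distr_add_commute prob_space_distr Ucap_measurable) auto
    finally show ?thesis .
  qed
  show ?thesis using part1 part2 part3 by blast
qed

end
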